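(* For any $\varkappa>0$ and any $s\neq t\in\mathbb{R}$, $$\int_{C^1_{0,+}(\mathbb{R})}\exp\Big\{\frac{8}{\varkappa^2}\,\mathcal{O}(f;s,t)_0\Big\}\,d\mathscr{M}^\infty_{\varkappa^2}(f)<\infty .$$
   Context: $C^1_{0,+}(\mathbb{R})=\{f\in C^1(\mathbb{R}): f(0)=0,\ f'(0)=1,\ f'(t)>0\ \forall t\}$, with the topology of uniform convergence of $f$ and $f'$ on compact sets. For such $f$ and $s\ne t\in\mathbb{R}$, $\mathcal{O}(f;s,t)_0=\frac{\sqrt{f'(s)f'(t)}}{|f(t)-f(s)|}$. The Schwarzian measure on the real line $\mathscr{M}^\infty_{\varkappa^2}$ is the law (a Borel probability measure on $C^1_{0,+}(\mathbb{R})$) of $t\mapsto\int_0^te^{\xi(s)}ds$, where $\xi$ is a two-sided Brownian motion on $\mathbb{R}$ with $\xi(0)=0$ and variance $\varkappa^2$ ($\mathrm{Var}\,\xi(t)=\varkappa^2|t|$). *)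

theory Defs
  imports "HOL-Probability.Probability"
begin

section \<open>Two-sided Brownian motion\<close>

locale two_sided_brownian_motion = prob_space M
  for M :: "'a measure" and v :: real and \<xi> :: "real \<Rightarrow> 'a \<Rightarrow> real" +
  assumes start: "\<omega> \<in> space M \<Longrightarrow> \<xi> 0 \<omega> = 0"
    and continuous_paths: "\<omega> \<in> space M \<Longrightarrow> continuous_on UNIV (\<lambda>t. \<xi> t \<omega>)"
    and gaussian_increments: "s < t \<Longrightarrow>
      distributed M lborel (\<lambda>\<omega>. \<xi> t \<omega> - \<xi> s \<omega>)
        (\<lambda>x. ennreal (normal_density 0 (sqrt (v * (t - s))) x))"
    and independent_increments: "\<And>(n::nat) \<tau>. strict_mono_on {..n} \<tau> \<Longrightarrow>
      indep_vars (\<lambda>_. borel) (\<lambda>i \<omega>. \<xi> (\<tau> (Suc i)) \<omega> - \<xi> (\<tau> i) \<omega>) {..<n}"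


section \<open>The space of increasing \<open>C\<^sup>1\<close> functions\<close>

definition C1_0plus :: "(real \<Rightarrow> real) set" where
  "C1_0plus = {f. f C1_differentiable_on UNIV \<and> f 0 = 0 \<and> deriv f 0 = 1 \<and> (\<forall>t. deriv f t > 0)}"

text \<open>The topology of uniform convergence of \<open>f\<close> and its derivative on compact sets.\<close>

definition C1_open :: "(real \<Rightarrow> real) set \<Rightarrow> bool" where
  "C1_open U \<longleftrightarrow> U \<subseteq> C1_0plus \<and>
     (\<forall>f\<in>U. \<exists>K e. compact K \<and> e > 0 \<and>
        (\<forall>g\<in>C1_0plus. (\<forall>x\<in>K. \<bar>g x - f x\<bar> < e \<and> \<bar>deriv g x - deriv f x\<bar> < e) \<longrightarrow> g \<in> U))"

definition C1_topology :: "(real \<Rightarrow> real) topology" where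
  "C1_topology = topology C1_open"

definition C1_borel :: "(real \<Rightarrow> real) measure" where
  "C1_borel = sigma C1_0plus {U. openin C1_topology U}"

lemma istopology_C1_open: "istopology C1_open"
  unfolding istopology_def
proof (intro conjI allI impI)
  fix S T assume S: "C1_open S" and T: "C1_open T"
  show "C1_open (S \<inter> T)"
    unfolding C1_open_def
  proof (intro conjI ballI)
    show "S \<inter> T \<subseteq> C1_0plus" using S unfolding C1_open_def by blast
    fix f assume f: "f \<in> S \<inter> T"
    obtain K e where K: "compact K" "e > 0"
      "\<forall>g\<in>C1_0plus. (\<forall>x\<in>K. \<bar>g x - f x\<bar> < e \<and> \<bar>deriv g x - deriv f x\<bar> < e) \<longrightarrow> g \<in> S"
      using S f unfolding C1_open_def by blast
    obtain L d where L: "compact L" "d > 0"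
      "\<forall>g\<in>C1_0plus. (\<forall>x\<in>L. \<bar>g x - f x\<bar> < d \<and> \<bar>deriv g x - deriv f x\<bar> < d) \<longrightarrow> g \<in> T"
      using T f unfolding C1_open_def by blast
    show "\<exists>K e. compact K \<and> e > 0 \<and> (\<forall>g\<in>C1_0plus.
        (\<forall>x\<in>K. \<bar>g x - f x\<bar> < e \<and> \<bar>deriv g x - deriv f x\<bar> < e) \<longrightarrow> g \<in> S \<inter> T)"
      using K L by (intro exI[of _ "K \<union> L"] exI[of _ "min e d"]) auto
  qed
next
  fix \<K> assume \<K>: "\<forall>K\<in>\<K>. C1_open K"
  show "C1_open (\<Union>\<K>)"
    unfolding C1_open_def
  proof (intro conjI ballI)
    show "\<Union>\<K> \<subseteq> C1_0plus" using \<K> unfolding C1_open_def by blast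
    fix f assume "f \<in> \<Union>\<K>"
    then obtain S where S: "S \<in> \<K>" "f \<in> S" by blast
    then have "C1_open S" using \<K> by blast
    then obtain K e where K: "compact K" "e > 0"
      "\<forall>g\<in>C1_0plus. (\<forall>x\<in>K. \<bar>g x - f x\<bar> < e \<and> \<bar>deriv g x - deriv f x\<bar> < e) \<longrightarrow> g \<in> S"
      using S(2) unfolding C1_open_def by blast
    show "\<exists>K e. compact K \<and> e > 0 \<and> (\<forall>g\<in>C1_0plus.
        (\<forall>x\<in>K. \<bar>g x - f x\<bar> < e \<and> \<bar>deriv g x - deriv f x\<bar> < e) \<longrightarrow> g \<in> \<Union>\<K>)"
    proof (intro exI conjI ballI impI)
      fix g assume "g \<in> C1_0plus" "\<forall>x\<in>K. \<bar>g x - f x\<bar> < e \<and> \<bar>deriv g x - deriv f x\<bar> < e"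
      then have "g \<in> S" using K(3) by simp
      then show "g \<in> \<Union>\<K>" using S(1) by (rule UnionI[rotated])
    qed (use K in simp_all)
  qed
qed

lemma openin_C1_topology: "openin C1_topology = C1_open"
  unfolding C1_topology_def by (rule topology_inverse'[OF istopology_C1_open])

lemma C1_open_C1_0plus: "C1_open C1_0plus"
  unfolding C1_open_def by (auto intro!: exI[of _ "{}"] exI[of _ 1])

lemma topspace_C1_topology: "topspace C1_topology = C1_0plus"
proof
  show "topspace C1_topology \<subseteq> C1_0plus"
    unfolding topspace_def openin_C1_topology by (auto simp only: C1_open_def)
  show "C1_0plus \<subseteq> topspace C1_topology"
    by (rule openin_subset) (simp only: openin_C1_topology C1_open_C1_0plus)
qed

lemma space_C1_borel [simp]: "space C1_borel = C1_0plus"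
  unfolding C1_borel_def by (rule space_measure_of) (auto simp: openin_C1_topology C1_open_def)

lemma sets_C1_borel: "sets C1_borel = sigma_sets C1_0plus {U. C1_open U}"
  unfolding C1_borel_def openin_C1_topology
  by (rule sets_measure_of) (auto simp: C1_open_def)


section \<open>The observable and the Schwarzian measure\<close>

definition obs :: "(real \<Rightarrow> real) \<Rightarrow> real \<Rightarrow> real \<Rightarrow> real" where
  "obs f s t = sqrt (deriv f s * deriv f t) / \<bar>f t - f s\<bar>"

text \<open>The interval integral is oriented: for \<open>t < 0\<close> it is minus the integral over \<open>(t, 0)\<close>.\<close>

definition exp_primitive :: "(real \<Rightarrow> 'a \<Rightarrow> real) \<Rightarrow> 'a \<Rightarrow> real \<Rightarrow> real" where
  "exp_primitive \<xi> \<omega> = (\<lambda>t. LBINT u=0..t. exp (\<xi> u \<omega>))"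

definition schwarzian_measure :: "'a measure \<Rightarrow> (real \<Rightarrow> 'a \<Rightarrow> real) \<Rightarrow> (real \<Rightarrow> real) measure" where
  "schwarzian_measure M \<xi> = distr M C1_borel (exp_primitive \<xi>)"


section \<open>Well-definedness\<close>

text \<open>If its map argument were not measurable, \<^const>\<open>distr\<close> would be the null measure.
  The following lemmas exclude this, and show that the observable is measurable.\<close>

context two_sided_brownian_motion
begin

lemma borel_measurable_path [measurable]: "\<xi> t \<in> borel_measurable M"
proof -
  have inc: "(\<lambda>\<omega>. \<xi> b \<omega> - \<xi> a \<omega>) \<in> borel_measurable M" if "a < b" for a b
    using distributed_measurable[OF gaussian_increments[OF that]] by simp
  consider "t = 0" | "t > 0" | "t < 0" by linarith
  then show ?thesis
  proof cases
    case 1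
    show ?thesis
      by (rule measurable_cong[THEN iffD2, of _ _ "\<lambda>_. 0"]) (auto simp: 1 start)
  next
    case 2
    show ?thesis
      by (rule measurable_cong[THEN iffD2, OF _ inc[OF 2]]) (auto simp: start)
  next
    case 3
    have "(\<lambda>\<omega>. - (\<xi> 0 \<omega> - \<xi> t \<omega>)) \<in> borel_measurable M"
      using inc[OF 3] by (rule borel_measurable_uminus)
    then show ?thesis
      by (rule measurable_cong[THEN iffD2, rotated]) (auto simp: start)
  qed
qed

lemma has_field_derivative_exp_primitive:
  assumes "\<omega> \<in> space M"
  shows "(exp_primitive \<xi> \<omega> has_field_derivative exp (\<xi> x \<omega>)) (at x)"
proof -
  define b where "b = \<bar>x\<bar> + 1"
  have c: "continuous_on {-b..b} (\<lambda>u. exp (\<xi> u \<omega>))"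
    by (intro continuous_intros continuous_on_subset[OF continuous_paths[OF assms]]) auto
  have "((\<lambda>t. LBINT u=ereal 0..t. exp (\<xi> u \<omega>)) has_vector_derivative exp (\<xi> x \<omega>))
      (at x within {-b..b})"
    by (rule interval_integral_FTC2[OF _ _ c]) (auto simp: b_def)
  moreover have "at x within {-b..b} = at x"
    by (rule at_within_Icc_at) (auto simp: b_def)
  ultimately show ?thesis
    by (simp add: exp_primitive_def has_real_derivative_iff_has_vector_derivative zero_ereal_def)
qed

lemma deriv_exp_primitive: "\<omega> \<in> space M \<Longrightarrow> deriv (exp_primitive \<xi> \<omega>) x = exp (\<xi> x \<omega>)"
  by (rule DERIV_imp_deriv) (rule has_field_derivative_exp_primitive)

lemma exp_primitive_in_C1_0plus:
  assumes "\<omega> \<in> space M"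
  shows "exp_primitive \<xi> \<omega> \<in> C1_0plus"
  unfolding C1_0plus_def
proof (intro CollectI conjI allI)
  show "exp_primitive \<xi> \<omega> C1_differentiable_on UNIV"
    unfolding C1_differentiable_on_def
    using has_field_derivative_exp_primitive[OF assms] continuous_paths[OF assms]
    by (auto intro!: exI[of _ "\<lambda>x. exp (\<xi> x \<omega>)"] continuous_intros
        simp: has_real_derivative_iff_has_vector_derivative)
  show "exp_primitive \<xi> \<omega> 0 = 0" by (simp add: exp_primitive_def zero_ereal_def)
qed (simp_all add: deriv_exp_primitive assms start)

end

lemma C1_0plus_DERIV:
  assumes "f \<in> C1_0plus"
  shows "(f has_field_derivative deriv f x) (at x)"
proof -
  obtain D where D: "\<And>x. (f has_field_derivative D x) (at x)"
    using assms unfolding C1_0plus_def C1_differentiable_on_def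
    by (auto simp: has_real_derivative_iff_has_vector_derivative[symmetric])
  then show ?thesis using DERIV_imp_deriv[OF D] by simp
qed

lemma C1_0plus_continuous_deriv:
  assumes "f \<in> C1_0plus"
  shows "continuous_on UNIV (deriv f)"
proof -
  obtain D where D: "\<And>x. (f has_field_derivative D x) (at x)" "continuous_on UNIV D"
    using assms unfolding C1_0plus_def C1_differentiable_on_def
    by (auto simp: has_real_derivative_iff_has_vector_derivative[symmetric])
  have "deriv f = D" using D(1) by (auto dest: DERIV_imp_deriv)
  with D(2) show ?thesis by simp
qed

text \<open>The topology has a countable base: the boxes below, whose centres are polynomials with
  rational coefficients approximating the derivative (functions in the space vanish at \<open>0\<close>).\<close>

definition rat_poly :: "rat list \<Rightarrow> real \<Rightarrow> real" where
  "rat_poly l x = (\<Sum>i<length l. of_rat (l ! i) * x ^ i)"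

lemma rat_poly_approx:
  fixes h :: "real \<Rightarrow> real"
  assumes "continuous_on UNIV h" "d > 0" "N \<ge> 1"
  shows "\<exists>l. \<forall>x. \<bar>x\<bar> \<le> N \<longrightarrow> \<bar>h x - rat_poly l x\<bar> < d"
proof -
  obtain g where g: "real_polynomial_function g" "\<And>x. x \<in> {-N..N} \<Longrightarrow> \<bar>h x - g x\<bar> < d/2"
    using Stone_Weierstrass_real_polynomial_function[of "{-N..N}" h "d/2"]
      continuous_on_subset[OF assms(1)] assms(2) by (metis compact_Icc half_gt_zero subset_UNIV)
  obtain a n where a: "g = (\<lambda>x. \<Sum>i\<le>n. a i * x^i)"
    using g(1) unfolding real_polynomial_function_iff_sum by blast
  define e where "e = d / (2 * (real n + 1) * N ^ n)"
  have Npos: "N ^ n > 0" using assms(3) by simp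
  have e: "e > 0" unfolding e_def using assms Npos by (intro divide_pos_pos mult_pos_pos) auto
  have "\<exists>q::rat. \<bar>a i - of_rat q\<bar> < e" for i
  proof -
    obtain q where "a i < of_rat q" "of_rat q < a i + e"
      using of_rat_dense[of "a i" "a i + e"] e by auto
    then show ?thesis by (intro exI[of _ q]) auto
  qed
  then obtain q :: "nat \<Rightarrow> rat" where q: "\<And>i. \<bar>a i - of_rat (q i)\<bar> < e" by metis
  define l where "l = map q [0..<Suc n]"
  have l: "rat_poly l x = (\<Sum>i\<le>n. of_rat (q i) * x^i)" for x
    unfolding rat_poly_def l_def lessThan_Suc_atMost[symmetric]
    by (rule sum.cong) (auto simp del: upt_Suc)
  have "\<bar>h x - rat_poly l x\<bar> < d" if x: "\<bar>x\<bar> \<le> N" for x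
  proof -
    have "\<bar>g x - rat_poly l x\<bar> = \<bar>\<Sum>i\<le>n. (a i - of_rat (q i)) * x^i\<bar>"
      unfolding l a by (simp add: sum_subtractf algebra_simps)
    also have "\<dots> \<le> (\<Sum>i\<le>n. \<bar>(a i - of_rat (q i)) * x^i\<bar>)" by (rule sum_abs)
    also have "\<dots> \<le> (\<Sum>i\<le>n. e * N ^ n)"
    proof (rule sum_mono)
      fix i assume "i \<in> {..n}"
      have "\<bar>x\<bar> ^ i \<le> N ^ i" using x by (intro power_mono) auto
      also have "\<dots> \<le> N ^ n" using \<open>i \<in> {..n}\<close> assms(3) by (intro power_increasing) auto
      finally show "\<bar>(a i - of_rat (q i)) * x^i\<bar> \<le> e * N ^ n"
        unfolding abs_mult power_abs using q[of i] e by (intro mult_mono) auto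
    qed
    also have "\<dots> = d / 2" unfolding e_def using Npos assms(3) by (simp add: divide_simps)
    finally have "\<bar>g x - rat_poly l x\<bar> \<le> d / 2" .
    moreover have "\<bar>h x - g x\<bar> < d/2" using x by (intro g(2)) auto
    ultimately show ?thesis by linarith
  qed
  then show ?thesis by blast
qed

definition C1_box :: "rat list \<Rightarrow> nat \<Rightarrow> rat \<Rightarrow> (real \<Rightarrow> real) set" where
  "C1_box l n q = {g \<in> C1_0plus. \<forall>x. \<bar>x\<bar> < real n \<longrightarrow> \<bar>deriv g x - rat_poly l x\<bar> \<le> of_rat q}"

lemma C1_open_box:
  assumes "C1_open U" "f \<in> U"
  shows "\<exists>l n q. f \<in> C1_box l n q \<and> C1_box l n q \<subseteq> U"
proof -
  obtain K e where K: "compact K" and e: "e > 0" and U: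
    "\<And>g. g \<in> C1_0plus \<Longrightarrow> (\<forall>x\<in>K. \<bar>g x - f x\<bar> < e \<and> \<bar>deriv g x - deriv f x\<bar> < e) \<Longrightarrow> g \<in> U"
    using assms unfolding C1_open_def by blast
  have f: "f \<in> C1_0plus" using assms unfolding C1_open_def by blast
  obtain B where B: "\<And>x. x \<in> K \<Longrightarrow> \<bar>x\<bar> \<le> B"
    using compact_imp_bounded[OF K] unfolding bounded_iff by auto
  obtain n :: nat where n': "max B 1 < real n" using reals_Archimedean2 by blast
  then have n: "real n \<ge> 1" by simp
  have "0 < e / (2 * real n)" using e n by (intro divide_pos_pos) auto
  then obtain q where q: "(0::real) < of_rat q" "of_rat q < e / (2 * real n)"
    using of_rat_dense by blast
  have qe: "2 * real n * of_rat q < e" using q(2) n by (simp add: field_simps)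
  obtain l where l: "\<And>x. \<bar>x\<bar> \<le> real n \<Longrightarrow> \<bar>deriv f x - rat_poly l x\<bar> < of_rat q"
    using rat_poly_approx[OF C1_0plus_continuous_deriv[OF f] q(1) n] by blast
  have "f \<in> C1_box l n q" unfolding C1_box_def using f l by (auto intro: less_imp_le)
  moreover have "C1_box l n q \<subseteq> U"
  proof
    fix g assume g: "g \<in> C1_box l n q"
    then have gC: "g \<in> C1_0plus" by (simp add: C1_box_def)
    have d: "\<bar>deriv g x - deriv f x\<bar> \<le> 2 * of_rat q" if "\<bar>x\<bar> < real n" for x
    proof -
      have "\<bar>deriv g x - rat_poly l x\<bar> \<le> of_rat q" using g that by (simp add: C1_box_def)
      with l[of x] that show ?thesis by linarith
    qed
    show "g \<in> U"
    proof (rule U[OF gC], intro ballI conjI)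
      fix x assume "x \<in> K"
      then have x: "\<bar>x\<bar> < real n" using B[of x] n' by simp
      have "2 * of_rat q * 1 \<le> 2 * of_rat q * real n" using n q(1) by (intro mult_left_mono) auto
      then show "\<bar>deriv g x - deriv f x\<bar> < e" using d[OF x] qe by (simp add: algebra_simps)
      have "norm ((g x - f x) - (g 0 - f 0)) \<le> (2 * of_rat q) * norm (x - 0)"
      proof (rule field_differentiable_bound[where f = "\<lambda>x. g x - f x" and
          f' = "\<lambda>x. deriv g x - deriv f x" and S = "{-\<bar>x\<bar>..\<bar>x\<bar>}"])
        show "convex {-\<bar>x\<bar>..\<bar>x\<bar>}" by simp
        fix z assume z: "z \<in> {-\<bar>x\<bar>..\<bar>x\<bar>}"
        show "((\<lambda>x. g x - f x) has_field_derivative deriv g z - deriv f z) (at z within {-\<bar>x\<bar>..\<bar>x\<bar>})"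
          by (rule has_field_derivative_at_within[OF DERIV_diff[OF C1_0plus_DERIV[OF gC] C1_0plus_DERIV[OF f]]])
        show "norm (deriv g z - deriv f z) \<le> 2 * of_rat q" proof -
          have "\<bar>z\<bar> < real n" using z x by (simp add: abs_le_iff) linarith
          then show ?thesis using d by simp
        qed
      qed auto
      moreover have "g 0 = 0" "f 0 = 0" using gC f by (auto simp: C1_0plus_def)
      moreover have "(2 * of_rat q) * \<bar>x\<bar> \<le> 2 * of_rat q * real n"
        using x q(1) by (intro mult_left_mono) auto
      ultimately show "\<bar>g x - f x\<bar> < e" using qe by (simp add: algebra_simps)
    qed
  qed
  ultimately show ?thesis by blast
qed

context two_sided_brownian_motion
begin

lemma C1_box_vimage: "exp_primitive \<xi> -` C1_box l n q \<inter> space M \<in> sets M"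
proof -
  have dense: "(\<forall>x. \<bar>x\<bar> < real n \<longrightarrow> \<bar>exp (\<xi> x \<omega>) - rat_poly l x\<bar> \<le> of_rat q) \<longleftrightarrow>
      (\<forall>r::rat. \<bar>of_rat r\<bar> < real n \<longrightarrow>
        \<bar>exp (\<xi> (of_rat r) \<omega>) - rat_poly l (of_rat r)\<bar> \<le> of_rat q)" (is "?A \<longleftrightarrow> ?B")
    if \<omega>: "\<omega> \<in> space M" for \<omega>
  proof
    assume B: ?B
    let ?S = "{x. \<bar>x\<bar> < real n} \<inter> {x. of_rat q < \<bar>exp (\<xi> x \<omega>) - rat_poly l x\<bar>}"
    have "open ?S"
      unfolding rat_poly_def
      by (intro open_Int open_Collect_less continuous_intros continuous_paths[OF \<omega>])
    have "?S = {}"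
    proof (rule ccontr)
      assume "?S \<noteq> {}"
      then obtain x where "x \<in> ?S" by blast
      with \<open>open ?S\<close> obtain e where e: "e > 0" "ball x e \<subseteq> ?S" by (rule openE)
      obtain r where r: "x < of_rat r" "of_rat r < x + e"
        using of_rat_dense[of x "x + e"] e by auto
      then have "of_rat r \<in> ball x e" by (simp add: dist_real_def)
      then have "of_rat r \<in> ?S" using e by blast
      with B show False by auto
    qed
    then show ?A by (auto simp: not_less)
  qed blast
  have "exp_primitive \<xi> -` C1_box l n q \<inter> space M =
      {\<omega> \<in> space M. \<forall>r::rat. \<bar>of_rat r\<bar> < real n \<longrightarrow>
        \<bar>exp (\<xi> (of_rat r) \<omega>) - rat_poly l (of_rat r)\<bar> \<le> of_rat q}"
  proof (intro set_eqI)
    fix \<omega>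
    show "\<omega> \<in> exp_primitive \<xi> -` C1_box l n q \<inter> space M \<longleftrightarrow>
      \<omega> \<in> {\<omega> \<in> space M. \<forall>r::rat. \<bar>of_rat r\<bar> < real n \<longrightarrow>
        \<bar>exp (\<xi> (of_rat r) \<omega>) - rat_poly l (of_rat r)\<bar> \<le> of_rat q}"
    proof (cases "\<omega> \<in> space M")
      case True
      have "\<omega> \<in> exp_primitive \<xi> -` C1_box l n q \<longleftrightarrow>
          (\<forall>x. \<bar>x\<bar> < real n \<longrightarrow> \<bar>exp (\<xi> x \<omega>) - rat_poly l x\<bar> \<le> of_rat q)"
        using True by (simp add: C1_box_def exp_primitive_in_C1_0plus deriv_exp_primitive)
      then show ?thesis unfolding dense[OF True] using True by blast
    qed simp
  qed
  also have "\<dots> \<in> sets M" by measurable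
  finally show ?thesis .
qed

lemma exp_primitive_measurable: "exp_primitive \<xi> \<in> measurable M C1_borel"
  unfolding C1_borel_def openin_C1_topology
proof (rule measurable_sigma_sets[OF refl[THEN trans]])
  show "sets (sigma C1_0plus {U. C1_open U}) = sigma_sets C1_0plus {U. C1_open U}"
    by (rule sets_measure_of) (auto simp: C1_open_def)
  show "{U. C1_open U} \<subseteq> Pow C1_0plus" by (auto simp: C1_open_def)
  show "exp_primitive \<xi> \<in> space M \<rightarrow> C1_0plus" by (auto intro: exp_primitive_in_C1_0plus)
  fix U assume "U \<in> {U. C1_open U}"
  then have U: "C1_open U" by simp
  define I where "I = {(l, n, q). C1_box l n q \<subseteq> U}"
  have "U = (\<Union>(l, n, q)\<in>I. C1_box l n q)"
    using C1_open_box[OF U] unfolding I_def by fastforce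
  then have "exp_primitive \<xi> -` U \<inter> space M =
      (\<Union>i\<in>I. case i of (l, n, q) \<Rightarrow> exp_primitive \<xi> -` C1_box l n q \<inter> space M)"
    by auto
  also have "\<dots> \<in> sets M"
    by (rule sets.countable_UN') (auto simp: C1_box_vimage)
  finally show "exp_primitive \<xi> -` U \<inter> space M \<in> sets M" .
qed

lemma prob_space_schwarzian_measure: "prob_space (schwarzian_measure M \<xi>)"
  unfolding schwarzian_measure_def by (rule prob_space_distr[OF exp_primitive_measurable])

end

lemma borel_measurable_C1_eval: "(\<lambda>f. f x) \<in> borel_measurable C1_borel"
  and borel_measurable_C1_deriv: "(\<lambda>f. deriv f x) \<in> borel_measurable C1_borel"
proof -
  have *: "F \<in> borel_measurable C1_borel"
    if F: "\<And>f g e. \<lbrakk>\<bar>g x - f x\<bar> < e; \<bar>deriv g x - deriv f x\<bar> < e\<rbrakk> \<Longrightarrow> \<bar>F g - F f\<bar> < e"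
    for F :: "(real \<Rightarrow> real) \<Rightarrow> real"
    unfolding borel_measurable_iff_greater space_C1_borel sets_C1_borel
  proof (intro allI sigma_sets.Basic CollectI)
    fix a
    show "C1_open {f \<in> C1_0plus. a < F f}"
      unfolding C1_open_def
    proof (intro conjI ballI)
      fix f assume "f \<in> {f \<in> C1_0plus. a < F f}"
      then show "\<exists>K e. compact K \<and> e > 0 \<and> (\<forall>g\<in>C1_0plus.
          (\<forall>x\<in>K. \<bar>g x - f x\<bar> < e \<and> \<bar>deriv g x - deriv f x\<bar> < e) \<longrightarrow> g \<in> {f \<in> C1_0plus. a < F f})"
      proof (intro exI conjI ballI impI)
        show "compact {x}" by simp
        show "F f - a > 0" using \<open>f \<in> _\<close> by simp
        fix g assume g: "g \<in> C1_0plus"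
          "\<forall>y\<in>{x}. \<bar>g y - f y\<bar> < F f - a \<and> \<bar>deriv g y - deriv f y\<bar> < F f - a"
        then have "\<bar>F g - F f\<bar> < F f - a" by (intro F) simp_all
        then show "g \<in> {f \<in> C1_0plus. a < F f}" using g(1) by simp
      qed
    qed blast
  qed
  show "(\<lambda>f. f x) \<in> borel_measurable C1_borel" "(\<lambda>f. deriv f x) \<in> borel_measurable C1_borel"
    by (rule *, assumption)+
qed

lemma borel_measurable_obs: "(\<lambda>f. obs f s t) \<in> borel_measurable C1_borel"
proof -
  note [measurable] = borel_measurable_C1_eval borel_measurable_C1_deriv
  show ?thesis unfolding obs_def by measurable
qed

end

theory Submission
  imports Defs "HOL-Complex_Analysis.Complex_Analysis"
begin

text \<open>
  Write \<open>v = \<kappa>\<^sup>2\<close> and, for \<open>s < t\<close>, let \<open>B = \<xi> t - \<xi> s\<close> and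
  \<open>A = \<integral> exp (\<xi> u - \<xi> s) du\<close> over \<open>[s, t]\<close>. The observable is \<open>Ob = exp (B / 2) / A\<close>,
  and the exponent \<open>8 / v\<close> is exactly the exponential decay rate of its tail, so that
  large-deviation estimates cannot decide the question. The proof computes a Laplace transform.

  Moving the path in the direction of its own exponential integral, i.e. adding
  \<open>\<epsilon> \<integral> exp (\<xi> r - \<xi> s) dr\<close> (over \<open>[s, u]\<close>) to \<open>\<xi> u\<close>, is the infinitesimal action of a Moebius
  transformation on \<open>f = \<integral> exp \<xi>\<close>. It leaves \<open>Ob\<close> unchanged and moves \<open>B\<close>. Gaussian
  integration by parts in this direction (\<open>integration_by_parts\<close>), whose divergence is
  elementary, gives, with \<open>a = 4 / v\<close>,

    \<open>E [\<psi>' B * exp (a * Ob * cosh (B / 2)) * k Ob] = 0\<close>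

  for compactly supported \<open>\<psi>\<close> and \<open>k\<close> (\<open>weighted_integral_of_derivative_eq_0\<close>). Thus under the
  tilt \<open>exp (a * Ob * cosh (B / 2))\<close> the pair \<open>(B, Ob)\<close> is distributed as Lebesgue measure times
  some measure \<open>\<Theta>\<close>, that is, the law of \<open>(B, Ob)\<close> is
  \<open>exp (- a * r * cosh (b / 2)) db \<Theta>(dr)\<close>.

  Since \<open>B\<close> is Gaussian, integrating out \<open>r\<close> determines the Laplace transform of \<open>\<Theta>\<close>: it is
  \<open>\<integral> exp (- a * l * r) \<Theta>(dr) = c * exp (- 2 * (arcosh l)\<^sup>2 / (v * (t - s)))\<close> for \<open>l > 1\<close>
  (\<open>tilted_mass_eq_density\<close>). The right-hand side extends holomorphically across \<open>l = 1\<close>, because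
  \<open>(arcosh l)\<^sup>2 = - (arccos l)\<^sup>2\<close> and the square removes the branch point; the nearest singularity
  is \<open>l = -1\<close>. By the theorem of Pringsheim and Landau, the Laplace transform of a positive measure
  converges up to the first singularity on the real axis (\<open>laplace_transform_extends\<close>),
  so the identity holds for all \<open>l > -1\<close>, and as \<open>(arccos l)\<^sup>2 \<le> \<pi>\<^sup>2\<close> stays bounded there, it
  persists at \<open>l = -1\<close> by Fatou's lemma (\<open>tilted_mass_critical\<close>).

  As \<open>8 / v = 2 * a\<close>, the required expectation is
  \<open>\<integral> \<integral> exp (- a * (cosh (b / 2) - 2) * r) \<Theta>(dr) db\<close>. The inner integral involves only
  the values \<open>l = cosh (b / 2) - 2 \<ge> -1\<close>: it is bounded, and for large \<open>b\<close> it decays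
  like a Gaussian. The critical point \<open>l = -1\<close> is attained at \<open>b = 0\<close>.
\<close>

section \<open>Laplace transforms and the square of the arcsine\<close>

text \<open>Agreement on a real interval with the centre as its end point is enough, since the zeros of a
  nonzero power series do not accumulate at the centre.\<close>

lemma powser_coeffs_unique:
  fixes c d :: "nat \<Rightarrow> complex"
  assumes \<rho>: "\<rho> > 0"
    and c: "\<And>x. 0 < x \<Longrightarrow> x < \<rho> \<Longrightarrow> (\<lambda>n. c n * of_real x ^ n) sums f x"
    and d: "\<And>x. 0 < x \<Longrightarrow> x < \<rho> \<Longrightarrow> (\<lambda>n. d n * of_real x ^ n) sums f x"
  shows "c = d"
proof (rule ccontr)
  assume "c \<noteq> d"
  then obtain m where m: "c m \<noteq> d m" by blast
  (* one more factor of the variable makes the sum vanish at the origin whatever c 0 - d 0 is *)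
  define e where "e n = (case n of 0 \<Rightarrow> 0 | Suc k \<Rightarrow> c k - d k)" for n
  define F where "F z = z * (\<Sum>n. (c n - d n) * z ^ n)" for z :: complex
  have cd: "(\<lambda>n. (c n - d n) * of_real x ^ n) sums 0" if "0 < x" "x < \<rho>" for x :: real
    using sums_diff[OF c[OF that] d[OF that]] by (simp add: algebra_simps)
  have "(\<lambda>n. e n * (z - 0) ^ n) sums F z" if z: "norm (z - 0) < \<rho> / 2" for z
  proof -
    have "summable (\<lambda>n. (c n - d n) * z ^ n)"
      using \<rho> z by (intro powser_inside[OF sums_summable[OF cd[of "\<rho>/2"]]]) auto
    then have "(\<lambda>n. z * ((c n - d n) * z ^ n)) sums F z"
      unfolding F_def by (intro sums_mult summable_sums)
    then have "(\<lambda>n. e (Suc n) * z ^ Suc n) sums F z" by (simp add: e_def algebra_simps)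
    then show ?thesis unfolding diff_zero by (subst (asm) sums_Suc_iff) (simp add: e_def)
  qed
  moreover have "F 0 = 0" by (simp add: F_def)
  moreover have "e (Suc m) \<noteq> 0" using m by (simp add: e_def)
  ultimately obtain s where s: "0 < s" "\<And>z. z \<in> cball 0 s - {0} \<Longrightarrow> F z \<noteq> 0"
    using powser_0_nonzero[of "\<rho>/2" 0 e F "Suc m"] \<rho> by (metis half_gt_zero zero_less_Suc)
  define x where "x = min s (\<rho>/2)"
  have x: "0 < x" "x \<le> s" "x < \<rho>" using s(1) \<rho> by (auto simp: x_def)
  have "F (of_real x) = 0" unfolding F_def using sums_unique[OF cd[OF x(1,3)]] by simp
  moreover have "F (of_real x) \<noteq> 0" using x by (intro s(2)) auto
  ultimately show False by simp
qed

text \<open>The theorem of Pringsheim and Landau. Around a point \<open>s0\<close> of convergence the Laplace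
  transform is a power series in \<open>s0 - s\<close> whose coefficients, the moments of \<open>X\<close> under
  \<open>exp (- s0 * X)\<close>, are nonnegative; by Tonelli, summing this series to the left of \<open>s0\<close>
  yields the transform again, whether finite or not. The coefficients are those of \<open>G\<close>,
  whose Taylor series converges in every disc contained in \<open>ball 0 R\<close>.\<close>

lemma laplace_transform_extends:
  fixes X :: "'b \<Rightarrow> real" and G :: "complex \<Rightarrow> complex"
  assumes X [measurable]: "X \<in> borel_measurable \<nu>" and X0: "\<And>\<omega>. \<omega> \<in> space \<nu> \<Longrightarrow> X \<omega> \<ge> 0"
    and G: "G holomorphic_on ball 0 R"
    and real: "\<And>s. 0 < s \<Longrightarrow> s < R \<Longrightarrow> G (of_real s) \<in> \<real> \<and> Re (G (of_real s)) \<ge> 0"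
    and L: "\<And>s. 0 < s \<Longrightarrow> s < R \<Longrightarrow>
      (\<integral>\<^sup>+ \<omega>. ennreal (exp (- s * X \<omega>)) \<partial>\<nu>) = ennreal (Re (G (of_real s)))"
    and s: "- R < s" "s \<le> 0"
  shows "(\<integral>\<^sup>+ \<omega>. ennreal (exp (- s * X \<omega>)) \<partial>\<nu>) = ennreal (Re (G (of_real s)))"
proof -
  \<comment> \<open>The disc of radius \<open>R - s0\<close> about \<open>s0\<close> lies in \<open>ball 0 R\<close>; it contains \<open>s\<close> as soon as
    \<open>2 * s0 < R + s\<close>.\<close>
  define s0 where "s0 = (R + s) / 4"
  define r where "r = R - s0"
  have R: "R > 0" and s0: "s0 > 0" "2 * s0 < R + s" using s by (auto simp: s0_def)
  have r: "r > s0" "s0 - s < r" using s0 s by (auto simp: r_def)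
  define g where "g n = (deriv ^^ n) G (of_real s0) / fact n" for n
  have "ball (of_real s0) r \<subseteq> ball (0::complex) R"
  proof
    fix z :: complex assume "z \<in> ball (of_real s0) r"
    moreover have "norm z \<le> norm (z - of_real s0) + norm (of_real s0 :: complex)"
      using norm_triangle_ineq[of "z - of_real s0" "of_real s0"] by simp
    ultimately show "z \<in> ball 0 R" using s0 by (simp add: dist_norm norm_minus_commute r_def)
  qed
  then have G': "G holomorphic_on ball (of_real s0) r" using G by (rule holomorphic_on_subset[rotated])
  have g: "(\<lambda>n. (g n * (-1) ^ n) * of_real x ^ n) sums G (of_real (s0 - x))" if "0 < x" "x < r" for x
  proof -
    have "(\<lambda>n. g n * (of_real (s0 - x) - of_real s0) ^ n) sums G (of_real (s0 - x))"
      unfolding g_def by (rule holomorphic_power_series[OF G']) (use that in \<open>auto simp: dist_norm\<close>)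
    moreover have "(of_real (s0 - x) - of_real s0 :: complex) ^ n = (-1) ^ n * of_real x ^ n" for n
      by (simp add: power_minus[of "of_real x"])
    ultimately show ?thesis by (simp add: mult.assoc)
  qed
  define m where "m n = (\<integral>\<^sup>+ \<omega>. ennreal (X \<omega> ^ n / fact n * exp (- s0 * X \<omega>)) \<partial>\<nu>)" for n
  have m: "(\<integral>\<^sup>+ \<omega>. ennreal (exp (- (s0 - x) * X \<omega>)) \<partial>\<nu>) = (\<Sum>n. m n * ennreal (x ^ n))"
    if x: "x > 0" for x
  proof -
    have "ennreal (exp (- (s0 - x) * X \<omega>)) =
        (\<Sum>n. ennreal (X \<omega> ^ n / fact n * exp (- s0 * X \<omega>)) * ennreal (x ^ n))"
      if \<omega>: "\<omega> \<in> space \<nu>" for \<omega>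
    proof -
      have "(\<lambda>n. (x * X \<omega>) ^ n /\<^sub>R fact n) sums exp (x * X \<omega>)" by (rule exp_converges)
      then have "(\<lambda>n. (x * X \<omega>) ^ n /\<^sub>R fact n * exp (- s0 * X \<omega>)) sums
          (exp (x * X \<omega>) * exp (- s0 * X \<omega>))" by (rule sums_mult2)
      moreover have "exp (x * X \<omega>) * exp (- s0 * X \<omega>) = exp (- (s0 - x) * X \<omega>)"
        by (simp add: exp_add[symmetric] algebra_simps)
      moreover have "(\<lambda>n. (x * X \<omega>) ^ n /\<^sub>R fact n * exp (- s0 * X \<omega>)) =
          (\<lambda>n. X \<omega> ^ n / fact n * exp (- s0 * X \<omega>) * x ^ n)"
        by (simp add: fun_eq_iff power_mult_distrib field_simps)
      ultimately have "(\<lambda>n. X \<omega> ^ n / fact n * exp (- s0 * X \<omega>) * x ^ n) sums exp (- (s0 - x) * X \<omega>)"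
        by simp
      then have "(\<Sum>n. ennreal (X \<omega> ^ n / fact n * exp (- s0 * X \<omega>) * x ^ n)) =
          ennreal (exp (- (s0 - x) * X \<omega>))"
        using X0[OF \<omega>] x by (intro suminf_ennreal_eq) auto
      then show ?thesis using X0[OF \<omega>] x by (simp add: ennreal_mult[symmetric])
    qed
    then have "(\<integral>\<^sup>+ \<omega>. ennreal (exp (- (s0 - x) * X \<omega>)) \<partial>\<nu>) =
        (\<integral>\<^sup>+ \<omega>. (\<Sum>n. ennreal (X \<omega> ^ n / fact n * exp (- s0 * X \<omega>)) * ennreal (x ^ n)) \<partial>\<nu>)"
      by (intro nn_integral_cong) auto
    also have "\<dots> = (\<Sum>n. m n * ennreal (x ^ n))"
      by (subst nn_integral_suminf) (auto simp: nn_integral_multc m_def)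
    finally show ?thesis .
  qed
  have m_sum: "(\<Sum>n. m n * ennreal (x ^ n)) = ennreal (Re (G (of_real (s0 - x))))" if "0 < x" "x < s0" for x
    using m[of x] L[of "s0 - x"] that s0 s by simp
  \<comment> \<open>Finiteness of the moments comes from the convergence of the transform to the left of \<open>s0\<close>,
    here at \<open>s0 / 2\<close>.\<close>
  have fin: "m n < \<top>" for n
  proof (rule ccontr)
    assume "\<not> m n < \<top>"
    then have "m n * ennreal ((s0/2) ^ n) = \<top>"
      using s0 by (simp add: less_top[symmetric] ennreal_top_mult)
    moreover have "m n * ennreal ((s0/2) ^ n) \<le> (\<Sum>n. m n * ennreal ((s0/2) ^ n))"
      using sum_le_suminf[of "\<lambda>n. m n * ennreal ((s0/2) ^ n)" "{n}"] by simp
    ultimately show False using m_sum[of "s0/2"] s0 by (simp add: top_unique)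
  qed
  define \<mu> where "\<mu> n = enn2real (m n)" for n
  have \<mu>: "m n = ennreal (\<mu> n)" "\<mu> n \<ge> 0" for n using fin[of n] by (auto simp: \<mu>_def)
  have mu_sums: "(\<lambda>n. complex_of_real (\<mu> n) * of_real x ^ n) sums G (of_real (s0 - x))" if x: "0 < x" "x < s0" for x
  proof -
    have G0: "G (of_real (s0 - x)) \<in> \<real>" "Re (G (of_real (s0 - x))) \<ge> 0"
      using real[of "s0 - x"] x s0 s by auto
    have total: "(\<Sum>n. ennreal (\<mu> n * x ^ n)) = ennreal (Re (G (of_real (s0 - x))))"
      using m_sum[OF x] x \<mu>(2) by (simp add: \<mu>(1) ennreal_mult)
    have nonneg: "0 \<le> \<mu> n * x ^ n" for n using x \<mu>(2) by simp
    have summable: "summable (\<lambda>n. \<mu> n * x ^ n)"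
      by (rule summable_suminf_not_top[OF nonneg]) (simp only: total ennreal_neq_top not_False_eq_True)
    have "ennreal (\<Sum>n. \<mu> n * x ^ n) = ennreal (Re (G (of_real (s0 - x))))"
      by (simp only: suminf_ennreal2[OF nonneg summable, symmetric] total)
    then have "(\<Sum>n. \<mu> n * x ^ n) = Re (G (of_real (s0 - x)))"
      by (simp only: ennreal_inj[OF suminf_nonneg[OF summable nonneg] G0(2)])
    with summable have "(\<lambda>n. \<mu> n * x ^ n) sums Re (G (of_real (s0 - x)))"
      by (simp add: sums_iff)
    then have "(\<lambda>n. complex_of_real (\<mu> n * x ^ n)) sums of_real (Re (G (of_real (s0 - x))))"
      by (rule sums_of_real)
    then show ?thesis using G0(1) by (simp add: of_real_Re)
  qed
  have "(\<lambda>n. complex_of_real (\<mu> n)) = (\<lambda>n. g n * (-1) ^ n)"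
    by (rule powser_coeffs_unique[OF s0(1), where f = "\<lambda>x. G (of_real (s0 - x))"])
       (use mu_sums g r in auto)
  then have "(\<lambda>n. complex_of_real (\<mu> n) * of_real (s0 - s) ^ n) sums G (of_real (s0 - (s0 - s)))"
    using g[of "s0 - s"] r s s0 by (simp add: fun_eq_iff)
  then have "(\<lambda>n. Re (complex_of_real (\<mu> n) * of_real (s0 - s) ^ n)) sums Re (G (of_real s))"
    by (intro sums_Re) simp
  then have "(\<lambda>n. \<mu> n * (s0 - s) ^ n) sums Re (G (of_real s))"
    by (simp flip: of_real_power of_real_mult of_real_diff)
  then have "(\<Sum>n. ennreal (\<mu> n * (s0 - s) ^ n)) = ennreal (Re (G (of_real s)))"
    using s s0 \<mu>(2) by (intro suminf_ennreal_eq) auto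
  moreover have "(\<integral>\<^sup>+ \<omega>. ennreal (exp (- s * X \<omega>)) \<partial>\<nu>) = (\<Sum>n. ennreal (\<mu> n * (s0 - s) ^ n))"
    using m[of "s0 - s"] s s0 \<mu>(2) by (simp add: \<mu>(1) ennreal_mult)
  ultimately show ?thesis by simp
qed

lemma even_holomorphic_factors_through_square:
  fixes f :: "complex \<Rightarrow> complex"
  assumes f: "f holomorphic_on ball 0 1" and even: "\<And>z. z \<in> ball 0 1 \<Longrightarrow> f (- z) = f z"
  obtains g where "g holomorphic_on ball 0 1" "\<And>z. z \<in> ball 0 1 \<Longrightarrow> g (z\<^sup>2) = f z"
proof -
  define c where "c n = (deriv ^^ n) f 0 / fact n" for n
  define g where "g w = (\<Sum>n. c (2 * n) * w ^ n)" for w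
  have c: "(\<lambda>n. c n * z ^ n) sums f z" if "z \<in> ball 0 1" for z
    using holomorphic_power_series[OF f that] by (simp add: c_def)
  have sq: "(\<lambda>n. c (2 * n) * (z\<^sup>2) ^ n) sums f z" if z: "z \<in> ball 0 1" for z
  proof -
    have "(\<lambda>n. (c n * z ^ n + c n * (- z) ^ n) / 2) sums ((f z + f (- z)) / 2)"
      using z by (intro sums_divide sums_add c) auto
    moreover have "(\<lambda>n. (c n * z ^ n + c n * (- z) ^ n) / 2) = (\<lambda>n. if even n then c n * z ^ n else 0)"
      by (auto simp: fun_eq_iff)
    ultimately have s: "(\<lambda>n. if even n then c n * z ^ n else 0) sums f z" using even[OF z] by simp
    have "strict_mono (\<lambda>n::nat. 2 * n)" by (simp add: strict_mono_def)
    moreover have "(if even n then c n * z ^ n else 0) = 0" if "n \<notin> range (\<lambda>n::nat. 2 * n)" for n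
      using that by (auto elim!: evenE)
    ultimately have "(\<lambda>n. if even (2 * n) then c (2 * n) * z ^ (2 * n) else 0) sums f z"
      using sums_mono_reindex[of "\<lambda>n. 2 * n" "\<lambda>n. if even n then c n * z ^ n else 0" "f z"] s
      by simp
    then show ?thesis by (simp add: power_mult)
  qed
  have "(\<lambda>n. c (2 * n) * (w - 0) ^ n) sums g w" if w: "w \<in> ball 0 1" for w
  proof -
    have "norm (csqrt w) < 1" using w by (simp add: norm_csqrt)
    then have "(\<lambda>n. c (2 * n) * w ^ n) sums f (csqrt w)" using sq[of "csqrt w"] by simp
    then show ?thesis unfolding g_def by (simp add: sums_iff)
  qed
  then have "g holomorphic_on ball 0 1" by (rule power_series_holomorphic)
  moreover have "g (z\<^sup>2) = f z" if "z \<in> ball 0 1" for z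
    unfolding g_def using sq[OF that] by (simp add: sums_iff)
  ultimately show ?thesis by (rule that)
qed

text \<open>Although \<open>arcsin (sqrt w)\<close> branches at the origin, its square is holomorphic in the unit disc,
  because \<open>(arcsin z)\<^sup>2\<close> is even. On the negative axis it is minus the square of
  \<open>arsinh (sqrt (- w))\<close>. This is the function that continues the Gaussian density, written in terms
  of \<open>cosh\<close> of its argument, across the value \<open>1\<close> of \<open>cosh\<close>.\<close>

lemma squared_arcsin_of_sqrt:
  obtains S :: "complex \<Rightarrow> complex" where "S holomorphic_on ball 0 1"
    "\<And>\<theta>. \<bar>\<theta>\<bar> < pi / 2 \<Longrightarrow> S (of_real ((sin \<theta>)\<^sup>2)) = of_real (\<theta>\<^sup>2)"
    "\<And>y. sinh y < 1 \<Longrightarrow> 0 \<le> y \<Longrightarrow> S (of_real (- (sinh y)\<^sup>2)) = of_real (- (y\<^sup>2))"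
proof -
  have small: "\<bar>Re z\<bar> < 1" if "norm z < 1" for z
    using abs_Re_le_cmod[of z] that by linarith
  have cos: "cos (Arcsin z) = csqrt (1 - z\<^sup>2)" for z
  proof -
    have i: "\<i> * (- \<i> * L) = L" for L :: complex by simp
    have "exp (\<i> * Arcsin z) = \<i> * z + csqrt (1 - z\<^sup>2)"
      unfolding Arcsin_def i by (rule exp_Ln[OF Arcsin_body_lemma])
    then have "cos (Arcsin z) + \<i> * z = \<i> * z + csqrt (1 - z\<^sup>2)"
      unfolding exp_Euler sin_Arcsin .
    then show ?thesis by (metis add.commute add_left_cancel)
  qed
  have h: "(\<lambda>z. (Arcsin z)\<^sup>2) holomorphic_on ball 0 1"
    by (intro holomorphic_on_power holomorphic_on_Arcsin) (auto intro: small)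
  have e: "(Arcsin (- z))\<^sup>2 = (Arcsin z)\<^sup>2" if "z \<in> ball 0 1" for z
  proof -
    have "((\<lambda>z. Arcsin z + Arcsin (- z)) has_field_derivative 0) (at z within ball 0 1)"
      if z: "z \<in> ball 0 1" for z
    proof -
      have b: "\<bar>Re z\<bar> < 1" "\<bar>Re (- z)\<bar> < 1" using small[of z] z by auto
      have "((\<lambda>z. Arcsin (- z)) has_field_derivative inverse (cos (Arcsin (- z))) * - 1) (at z)"
        by (rule DERIV_chain2[OF has_field_derivative_Arcsin]) (use b in \<open>auto intro!: derivative_eq_intros\<close>)
      from DERIV_add[OF has_field_derivative_Arcsin this] b
      have "((\<lambda>z. Arcsin z + Arcsin (- z)) has_field_derivative 0) (at z)"
        by (simp add: cos)
      then show ?thesis by (rule has_field_derivative_at_within)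
    qed
    then obtain c where c: "\<And>z. z \<in> ball 0 1 \<Longrightarrow> Arcsin z + Arcsin (- z) = c"
      using has_field_derivative_zero_constant[of "ball 0 1" "\<lambda>z. Arcsin z + Arcsin (- z)"] by auto
    have "Arcsin (- z) = - Arcsin z"
    proof -
      have "c = 0" using c[of 0] by simp
      then show ?thesis using minus_unique[of "Arcsin z" "Arcsin (- z)"] c[OF that] by simp
    qed
    then show ?thesis by simp
  qed
  obtain S where S: "S holomorphic_on ball 0 1" "\<And>z. z \<in> ball 0 1 \<Longrightarrow> S (z\<^sup>2) = (Arcsin z)\<^sup>2"
    using even_holomorphic_factors_through_square[OF h e] by blast
  show ?thesis
  proof (rule that[OF S(1)])
    fix \<theta> :: real assume t: "\<bar>\<theta>\<bar> < pi / 2"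
    have "\<bar>sin \<theta>\<bar> < 1"
    proof -
      have "cos \<theta> > 0" using t by (intro cos_gt_zero_pi) auto
      then have "(sin \<theta>)\<^sup>2 < 1" using sin_cos_squared_add[of \<theta>] zero_less_power[of "cos \<theta>" 2] by linarith
      then show ?thesis by (simp add: abs_square_less_1)
    qed
    then have "S ((of_real (sin \<theta>))\<^sup>2) = (Arcsin (of_real (sin \<theta>)))\<^sup>2"
      by (intro S(2)) auto
    also have "Arcsin (of_real (sin \<theta>)) = of_real \<theta>"
      unfolding sin_of_real[symmetric] using t by (intro Arcsin_sin) auto
    finally show "S (of_real ((sin \<theta>)\<^sup>2)) = of_real (\<theta>\<^sup>2)" by simp
  next
    fix y :: real assume y: "sinh y < 1" "0 \<le> y"
    have s: "sin (\<i> * of_real y) = \<i> * of_real (sinh y)"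
    proof -
      have "complex_of_real (sinh y) = sinh (of_real y)"
        by (simp add: sinh_field_def exp_of_real exp_minus)
      then show ?thesis by (simp add: sinh_conv_sin)
    qed
    have "S ((\<i> * of_real (sinh y))\<^sup>2) = (Arcsin (\<i> * of_real (sinh y)))\<^sup>2"
      using y by (intro S(2)) (auto simp: norm_mult)
    also have "Arcsin (\<i> * of_real (sinh y)) = \<i> * of_real y"
      unfolding s[symmetric] by (intro Arcsin_sin) auto
    finally show "S (of_real (- (sinh y)\<^sup>2)) = of_real (- (y\<^sup>2))"
      by (simp add: power_mult_distrib)
  qed
qed

section \<open>Riemann sums and test functions\<close>

lemma left_riemann_sum_tendsto:
  fixes F f :: "real \<Rightarrow> real"
  assumes F: "\<And>x. (F has_real_derivative f x) (at x)" and f: "continuous_on UNIV f" and st: "s < t"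
  shows "(\<lambda>n. \<Sum>k<Suc n. (t - s) / Suc n * f (s + k * ((t - s) / Suc n))) \<longlonglongrightarrow> F t - F s"
proof (rule tendstoI)
  fix e :: real assume e: "e > 0"
  define e' where "e' = e / (2 * (t - s))"
  have e': "e' > 0" using e st by (simp add: e'_def)
  have "uniformly_continuous_on {s..t} f"
    by (intro compact_uniformly_continuous continuous_on_subset[OF f]) auto
  then obtain d where d: "d > 0" "\<And>x y. x \<in> {s..t} \<Longrightarrow> y \<in> {s..t} \<Longrightarrow> dist x y < d \<Longrightarrow> dist (f x) (f y) < e'"
    using e' unfolding uniformly_continuous_on_def by metis
  have "(\<lambda>n. (t - s) / real (Suc n)) \<longlonglongrightarrow> 0"
    using LIMSEQ_Suc[OF lim_const_over_n[of "t - s"]] by simp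
  then have "\<forall>\<^sub>F n in sequentially. (t - s) / real (Suc n) < d" using d(1) by (rule order_tendstoD)
  then show "\<forall>\<^sub>F n in sequentially.
      dist (\<Sum>k<Suc n. (t - s) / Suc n * f (s + k * ((t - s) / Suc n))) (F t - F s) < e"
  proof eventually_elim
    case (elim n)
    define h where "h = (t - s) / real (Suc n)"
    define \<tau> where "\<tau> k = s + real k * h" for k
    have h: "h > 0" "h < d" using st elim by (auto simp: h_def)
    have hn: "real (Suc n) * h = t - s" by (simp add: h_def)
    have step: "\<bar>h * f (\<tau> k) - (F (\<tau> (Suc k)) - F (\<tau> k))\<bar> \<le> h * e'" if k: "k < Suc n" for k
    proof -
      have lt: "\<tau> k < \<tau> (Suc k)" using h by (simp add: \<tau>_def algebra_simps)
      then obtain z where z: "z > \<tau> k" "z < \<tau> (Suc k)" "F (\<tau> (Suc k)) - F (\<tau> k) = (\<tau> (Suc k) - \<tau> k) * f z"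
        using MVT2[of "\<tau> k" "\<tau> (Suc k)" F f] F by blast
      have "real (Suc k) * h \<le> real (Suc n) * h" using k h by (intro mult_right_mono) auto
      then have r: "s \<le> \<tau> k" "\<tau> (Suc k) \<le> t" using h hn by (simp_all add: \<tau>_def del: of_nat_Suc)
      have gap: "\<tau> (Suc k) - \<tau> k = h" by (simp add: \<tau>_def algebra_simps)
      have "dist (f (\<tau> k)) (f z) < e'"
        using r z gap h by (intro d(2)) (auto simp: dist_real_def)
      then have "h * \<bar>f (\<tau> k) - f z\<bar> \<le> h * e'" using h by (intro mult_left_mono) (auto simp: dist_real_def)
      then show ?thesis using h unfolding z(3) gap by (simp add: abs_mult flip: right_diff_distrib)
    qed
    have "(\<Sum>k<Suc n. F (\<tau> (Suc k)) - F (\<tau> k)) = F (\<tau> (Suc n)) - F (\<tau> 0)"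
      by (rule sum_lessThan_telescope)
    moreover have "\<tau> (Suc n) = t" "\<tau> 0 = s" using hn by (auto simp: \<tau>_def)
    ultimately have "(\<Sum>k<Suc n. h * f (\<tau> k)) - (F t - F s) =
        (\<Sum>k<Suc n. h * f (\<tau> k) - (F (\<tau> (Suc k)) - F (\<tau> k)))"
      by (simp only: sum_subtractf)
    also have "\<bar>\<dots>\<bar> \<le> (\<Sum>k<Suc n. h * e')"
      by (intro order_trans[OF sum_abs] sum_mono step) auto
    also have "\<dots> = (real (Suc n) * h) * e'" by simp
    also have "\<dots> = e / 2" unfolding hn e'_def using st by (simp add: divide_simps)
    finally show ?case using e by (simp add: dist_real_def \<tau>_def h_def)
  qed
qed

text \<open>The discrete form of \<open>\<integral> \<integral> f r * f u\<close> over \<open>r < u\<close> being half of the square of \<open>\<integral> f\<close>.\<close>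

lemma sum_upper_triangle:
  fixes a :: "nat \<Rightarrow> real"
  shows "(\<Sum>k<n. a k * (\<Sum>j\<in>{k<..<n}. a j)) = ((\<Sum>k<n. a k)\<^sup>2 - (\<Sum>k<n. (a k)\<^sup>2)) / 2"
proof (induction n)
  case (Suc n)
  have "{k<..<Suc n} = insert n {k<..<n}" if "k < n" for k using that by auto
  then have "(\<Sum>k<n. a k * (\<Sum>j\<in>{k<..<Suc n}. a j)) = (\<Sum>k<n. a k * (a n + (\<Sum>j\<in>{k<..<n}. a j)))"
    by (intro sum.cong) auto
  also have "\<dots> = a n * (\<Sum>k<n. a k) + (\<Sum>k<n. a k * (\<Sum>j\<in>{k<..<n}. a j))"
    by (simp add: algebra_simps sum.distrib sum_distrib_left)
  finally have "(\<Sum>k<n. a k * (\<Sum>j\<in>{k<..<Suc n}. a j)) =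
      a n * (\<Sum>k<n. a k) + (\<Sum>k<n. a k * (\<Sum>j\<in>{k<..<n}. a j))" .
  moreover have "{n<..<Suc n} = {}" by auto
  ultimately show ?case using Suc by (simp add: power2_eq_square field_simps)
qed simp

text \<open>Functions of the pair \<open>(A, B)\<close>; \<open>g1\<close> and \<open>g2\<close> are the partial derivatives of \<open>g\<close>.
  The increment of the path at one time is shifted by \<open>x\<close>: this adds \<open>x\<close> to \<open>B\<close> and multiplies by
  \<open>exp x\<close> the part \<open>C\<close> of \<open>A\<close> that comes from later times. Differentiability is only
  required along these curves. The bounds make all the integrands below bounded.\<close>

locale test_function =
  fixes g g1 g2 :: "real \<Rightarrow> real \<Rightarrow> real" and A0 M :: real
  assumes deriv: "0 < A + (exp x - 1) * C \<Longrightarrow>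
      ((\<lambda>x. g (A + (exp x - 1) * C) (b + x)) has_real_derivative
        g2 (A + (exp x - 1) * C) (b + x) + exp x * C * g1 (A + (exp x - 1) * C) (b + x)) (at x)"
    and cont: "0 < A \<Longrightarrow> isCont (\<lambda>p. g (fst p) (snd p)) (A, b)"
      "0 < A \<Longrightarrow> isCont (\<lambda>p. g1 (fst p) (snd p)) (A, b)"
      "0 < A \<Longrightarrow> isCont (\<lambda>p. g2 (fst p) (snd p)) (A, b)"
    and meas: "(\<lambda>p. g (fst p) (snd p)) \<in> borel_measurable (borel \<Otimes>\<^sub>M borel)"
      "(\<lambda>p. g1 (fst p) (snd p)) \<in> borel_measurable (borel \<Otimes>\<^sub>M borel)"
      "(\<lambda>p. g2 (fst p) (snd p)) \<in> borel_measurable (borel \<Otimes>\<^sub>M borel)"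
    and bound: "0 < A \<Longrightarrow> \<bar>g A b\<bar> * (1 + exp b + A) \<le> M"
    and bound': "0 < A \<Longrightarrow> \<bar>g2 A b\<bar> + A * \<bar>g1 A b\<bar> \<le> M"
    and supp: "A0 \<le> A \<Longrightarrow> g A b = 0" and A0: "A0 > 0"
begin

lemma bound_nonneg: "M \<ge> 0"
  using bound'[of 1 0] by (simp add: order_trans[OF _ bound'[of 1 0]])

lemma increment:
  assumes "0 < A" "0 \<le> C" "C \<le> A" "0 < x"
  obtains z where "0 < z" "z < x"
    "g (A + (exp x - 1) * C) (b + x) - g A b =
      x * (g2 (A + (exp z - 1) * C) (b + z) + exp z * C * g1 (A + (exp z - 1) * C) (b + z))"
proof -
  have pos: "0 < A + (exp z - 1) * C" if "0 \<le> z" for z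
    using assms that by (intro add_pos_nonneg mult_nonneg_nonneg) auto
  show ?thesis
    using MVT2[OF \<open>0 < x\<close>, of "\<lambda>x. g (A + (exp x - 1) * C) (b + x)"
      "\<lambda>x. g2 (A + (exp x - 1) * C) (b + x) + exp x * C * g1 (A + (exp x - 1) * C) (b + x)"]
      deriv pos that by auto
qed

lemma increment_bound:
  assumes "0 < A" "0 \<le> C" "C \<le> A" "0 < x"
  shows "A * \<bar>g (A + (exp x - 1) * C) (b + x) - g A b\<bar> \<le> A0 * M * x"
proof (cases "A0 \<le> A")
  case True
  then have "A0 \<le> A + (exp x - 1) * C" using assms by (intro add_increasing2 mult_nonneg_nonneg) auto
  then show ?thesis using True assms A0 bound_nonneg by (simp add: supp)
next
  case False
  obtain z where z: "0 < z" "z < x" "g (A + (exp x - 1) * C) (b + x) - g A b =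
      x * (g2 (A + (exp z - 1) * C) (b + z) + exp z * C * g1 (A + (exp z - 1) * C) (b + z))"
    by (rule increment[OF assms])
  let ?A = "A + (exp z - 1) * C"
  have A: "?A > 0" using assms z by (intro add_pos_nonneg mult_nonneg_nonneg) auto
  have "exp z * C \<le> ?A" using assms by (simp add: algebra_simps)
  then have "\<bar>g2 ?A (b + z)\<bar> + (exp z * C) * \<bar>g1 ?A (b + z)\<bar> \<le> \<bar>g2 ?A (b + z)\<bar> + ?A * \<bar>g1 ?A (b + z)\<bar>"
    by (intro add_mono mult_right_mono) auto
  also have "\<dots> \<le> M" by (rule bound'[OF A])
  finally have K: "\<bar>g2 ?A (b + z)\<bar> + (exp z * C) * \<bar>g1 ?A (b + z)\<bar> \<le> M" .
  have "\<bar>g2 ?A (b + z) + exp z * C * g1 ?A (b + z)\<bar> \<le> \<bar>g2 ?A (b + z)\<bar> + \<bar>exp z * C * g1 ?A (b + z)\<bar>"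
    by (rule abs_triangle_ineq)
  also have "\<dots> \<le> M" using K assms by (simp add: abs_mult)
  finally have "\<bar>g (A + (exp x - 1) * C) (b + x) - g A b\<bar> \<le> x * M"
    unfolding z(3) using assms by (simp add: abs_mult)
  then have "A * \<bar>g (A + (exp x - 1) * C) (b + x) - g A b\<bar> \<le> A0 * (x * M)"
    using False assms A0 by (intro mult_mono) auto
  then show ?thesis by (simp add: algebra_simps)
qed

text \<open>Here \<open>a n k\<close> are the terms of a Riemann sum for \<open>A\<close>, and the \<open>k\<close>-th summand is the effect of
  shifting the \<open>k\<close>-th increment by \<open>v * h n\<close>. To first order it is
  \<open>v * h n * (g2 + C n k * g1)\<close>, and the limit follows from \<open>sum_upper_triangle\<close>.\<close>

lemma sum_of_increments_tendsto:
  fixes a :: "nat \<Rightarrow> nat \<Rightarrow> real" and h :: "nat \<Rightarrow> real" and N :: "nat \<Rightarrow> nat"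
  defines "S \<equiv> \<lambda>n. \<Sum>k<N n. a n k" and "C \<equiv> \<lambda>n k. \<Sum>j\<in>{k<..<N n}. a n j"
  assumes a: "\<And>n k. a n k > 0" and S: "S \<longlonglongrightarrow> A" and A: "A > 0"
    and sq: "(\<lambda>n. \<Sum>k<N n. (a n k)\<^sup>2) \<longlonglongrightarrow> 0"
    and h: "\<And>n. h n > 0" "h \<longlonglongrightarrow> 0" and v: "v > 0"
  shows "(\<lambda>n. (\<Sum>k<N n. a n k * (g (S n + (exp (v * h n) - 1) * C n k) (b + v * h n) - g (S n) b)) / h n)
    \<longlonglongrightarrow> v * (A * g2 A b + A\<^sup>2 / 2 * g1 A b)"
proof -
  define K where "K n k = g2 A b + C n k * g1 A b" for n k
  define D where "D n k = g (S n + (exp (v * h n) - 1) * C n k) (b + v * h n) - g (S n) b" for n k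
  have "(\<lambda>n. S n * g2 A b + ((S n)\<^sup>2 - (\<Sum>k<N n. (a n k)\<^sup>2)) / 2 * g1 A b) \<longlonglongrightarrow>
      A * g2 A b + (A\<^sup>2 - 0) / 2 * g1 A b"
    by (intro tendsto_intros S sq) auto
  moreover have "(\<Sum>k<N n. a n k * K n k) = S n * g2 A b + ((S n)\<^sup>2 - (\<Sum>k<N n. (a n k)\<^sup>2)) / 2 * g1 A b" for n
    unfolding S_def sum_upper_triangle[symmetric] K_def C_def
    by (simp add: algebra_simps sum.distrib sum_distrib_left sum_distrib_right)
  ultimately have main: "(\<lambda>n. v * (\<Sum>k<N n. a n k * K n k)) \<longlonglongrightarrow> v * (A * g2 A b + A\<^sup>2 / 2 * g1 A b)"
    by (auto intro!: tendsto_intros)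
  have C: "0 \<le> C n k" "C n k \<le> S n" for n k
  proof -
    show "0 \<le> C n k" unfolding C_def by (intro sum_nonneg less_imp_le[OF a])
    show "C n k \<le> S n" unfolding C_def S_def by (intro sum_mono2 less_imp_le[OF a]) auto
  qed
  have "(\<lambda>n. (\<Sum>k<N n. a n k * D n k) / h n - v * (\<Sum>k<N n. a n k * K n k)) \<longlonglongrightarrow> 0"
  proof (rule tendstoI)
    fix \<epsilon>' :: real assume "\<epsilon>' > 0"
    define \<epsilon> where "\<epsilon> = \<epsilon>' / (2 * (v * (2 * A) * (2 + 4 * A)))"
    have \<epsilon>: "\<epsilon> > 0" unfolding \<epsilon>_def using \<open>\<epsilon>' > 0\<close> v A by simp
    obtain \<delta>1 where \<delta>1: "\<delta>1 > 0" "\<And>p. dist p (A, b) < \<delta>1 \<Longrightarrow> dist (g1 (fst p) (snd p)) (g1 A b) < \<epsilon>"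
      using cont(2)[OF A, of b] \<epsilon> unfolding continuous_at_eps_delta by (metis fst_conv snd_conv)
    obtain \<delta>2 where \<delta>2: "\<delta>2 > 0" "\<And>p. dist p (A, b) < \<delta>2 \<Longrightarrow> dist (g2 (fst p) (snd p)) (g2 A b) < \<epsilon>"
      using cont(3)[OF A, of b] \<epsilon> unfolding continuous_at_eps_delta by (metis fst_conv snd_conv)
    have e0: "(\<lambda>n. exp (v * h n) - 1) \<longlonglongrightarrow> 0"
    proof -
      have "(\<lambda>n. exp (v * h n) - 1) \<longlonglongrightarrow> exp (v * 0) - 1" by (intro tendsto_intros h)
      then show ?thesis by simp
    qed
    have "\<forall>\<^sub>F n in sequentially. S n < 2 * A" using A by (intro order_tendstoD(2)[OF S]) auto
    moreover have "\<forall>\<^sub>F n in sequentially. exp (v * h n) - 1 < 1" by (rule order_tendstoD(2)[OF e0]) simp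
    moreover have "\<forall>\<^sub>F n in sequentially. \<bar>S n - A\<bar> + (exp (v * h n) - 1) * (2 * A) + v * h n < min \<delta>1 \<delta>2"
    proof (rule order_tendstoD(2))
      show "(\<lambda>n. \<bar>S n - A\<bar> + (exp (v * h n) - 1) * (2 * A) + v * h n) \<longlonglongrightarrow> \<bar>A - A\<bar> + 0 * (2 * A) + v * 0"
        by (intro tendsto_intros S h e0)
    qed (use \<delta>1 \<delta>2 in auto)
    moreover have "\<forall>\<^sub>F n in sequentially. (exp (v * h n) - 1) * (2 * A * \<bar>g1 A b\<bar>) < \<epsilon>"
    proof (rule order_tendstoD(2))
      show "(\<lambda>n. (exp (v * h n) - 1) * (2 * A * \<bar>g1 A b\<bar>)) \<longlonglongrightarrow> 0 * (2 * A * \<bar>g1 A b\<bar>)"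
        by (intro tendsto_intros e0)
    qed (use \<epsilon> in auto)
    moreover have "\<forall>\<^sub>F n in sequentially. 0 < S n" by (rule order_tendstoD(1)[OF S A])
    ultimately show "\<forall>\<^sub>F n in sequentially.
        dist ((\<Sum>k<N n. a n k * D n k) / h n - v * (\<Sum>k<N n. a n k * K n k)) 0 < \<epsilon>'"
    proof eventually_elim
      case (elim n)
      define x where "x = v * h n"
      have x: "x > 0" using h v by (simp add: x_def)
      have "\<bar>D n k / h n - v * K n k\<bar> \<le> v * ((2 + 4 * A) * \<epsilon>)" for k
      proof -
        obtain z where z: "0 < z" "z < x" "D n k = x * (g2 (S n + (exp z - 1) * C n k) (b + z)
            + exp z * C n k * g1 (S n + (exp z - 1) * C n k) (b + z))"
          unfolding D_def x_def[symmetric] by (rule increment[OF elim(5) C x])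
        define A' where "A' = S n + (exp z - 1) * C n k"
        have ez: "0 \<le> exp z - 1" "exp z - 1 \<le> exp x - 1" using z by auto
        have C2: "C n k \<le> 2 * A" using C[where n=n and k=k] elim(1) by simp
        have eC: "(exp z - 1) * C n k \<le> (exp x - 1) * (2 * A)"
          by (rule mult_mono[OF ez(2) C2 _ C(1)]) (use x in auto)
        have "exp z \<le> 2" using ez(2) elim(2) unfolding x_def by linarith
        then have eC': "exp z * C n k \<le> 2 * (2 * A)"
          by (rule mult_mono[OF _ C2 _ C(1)]) simp
        have "0 \<le> (exp z - 1) * C n k" by (rule mult_nonneg_nonneg[OF ez(1) C(1)])
        have "dist (A', b + z) (A, b) \<le> \<bar>A' - A\<bar> + \<bar>z\<bar>"
          unfolding dist_Pair_Pair dist_real_def using sqrt_sum_squares_le_sum_abs[of "\<bar>A' - A\<bar>" "\<bar>z\<bar>"] by simp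
        also have "\<dots> \<le> \<bar>S n - A\<bar> + (exp x - 1) * (2 * A) + x"
          unfolding A'_def using eC \<open>0 \<le> (exp z - 1) * C n k\<close> z by (simp add: abs_if split: if_splits)
        also have "\<dots> < min \<delta>1 \<delta>2" using elim(3) by (simp add: x_def)
        finally have d: "dist (A', b + z) (A, b) < \<delta>1" "dist (A', b + z) (A, b) < \<delta>2" by auto
        have p1: "\<bar>g1 A' (b + z) - g1 A b\<bar> < \<epsilon>" and p2: "\<bar>g2 A' (b + z) - g2 A b\<bar> < \<epsilon>"
          using \<delta>1(2)[OF d(1)] \<delta>2(2)[OF d(2)] by (auto simp: dist_real_def)
        have q1: "\<bar>exp z * C n k * (g1 A' (b + z) - g1 A b)\<bar> \<le> 2 * (2 * A) * \<epsilon>"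
        proof -
          have "(exp z * C n k) * \<bar>g1 A' (b + z) - g1 A b\<bar> \<le> (2 * (2 * A)) * \<epsilon>"
            by (rule mult_mono[OF eC' less_imp_le[OF p1]]) (use A in auto)
          then show ?thesis using C(1)[of n k] by (simp add: abs_mult)
        qed
        have "\<bar>(exp z - 1) * C n k * g1 A b\<bar> \<le> (exp x - 1) * (2 * A) * \<bar>g1 A b\<bar>"
          unfolding abs_mult[of "_ * _"] using eC \<open>0 \<le> (exp z - 1) * C n k\<close>
          by (intro mult_right_mono) auto
        also have "\<dots> < \<epsilon>" using elim(4) by (simp add: x_def mult.assoc)
        finally have q2: "\<bar>(exp z - 1) * C n k * g1 A b\<bar> < \<epsilon>" .
        have "D n k / h n - v * K n k = v * ((g2 A' (b + z) - g2 A b)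
            + exp z * C n k * (g1 A' (b + z) - g1 A b) + (exp z - 1) * C n k * g1 A b)"
          unfolding z(3) A'_def[symmetric] K_def x_def using h(1)[of n] by (simp add: field_simps)
        moreover have "\<bar>(g2 A' (b + z) - g2 A b)
            + exp z * C n k * (g1 A' (b + z) - g1 A b) + (exp z - 1) * C n k * g1 A b\<bar> \<le> (2 + 4 * A) * \<epsilon>"
          using p2 q1 q2 by (simp add: algebra_simps)
        ultimately show ?thesis using v by (simp add: abs_mult)
      qed
      then have "(\<Sum>k<N n. a n k * \<bar>D n k / h n - v * K n k\<bar>) \<le> (\<Sum>k<N n. a n k * (v * ((2 + 4 * A) * \<epsilon>)))"
        using a by (intro sum_mono mult_left_mono) (auto intro: less_imp_le)
      also have "\<dots> = S n * (v * ((2 + 4 * A) * \<epsilon>))" unfolding S_def by (simp add: sum_distrib_right)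
      also have "\<dots> \<le> 2 * A * (v * ((2 + 4 * A) * \<epsilon>))"
        using elim(1) A v \<epsilon> by (intro mult_right_mono) auto
      also have "\<dots> = \<epsilon> * (v * (2 * A) * (2 + 4 * A))" by (simp add: mult_ac)
      also have "\<dots> = \<epsilon>' / 2"
      proof -
        have "v * (2 * A) * (2 + 4 * A) \<noteq> 0" using A v by simp
        then show ?thesis unfolding \<epsilon>_def by (metis nonzero_divide_eq_eq nonzero_divide_mult_cancel_right times_divide_eq_left divide_divide_eq_left mult.commute)
      qed
      also have "\<dots> < \<epsilon>'" using \<open>\<epsilon>' > 0\<close> by simp
      finally have fin: "(\<Sum>k<N n. a n k * \<bar>D n k / h n - v * K n k\<bar>) < \<epsilon>'" .
      have "(\<Sum>k<N n. a n k * D n k) / h n - v * (\<Sum>k<N n. a n k * K n k) =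
          (\<Sum>k<N n. a n k * (D n k / h n - v * K n k))"
        by (simp add: sum_divide_distrib sum_distrib_left sum_subtractf algebra_simps)
      also have "\<bar>\<dots>\<bar> \<le> (\<Sum>k<N n. a n k * \<bar>D n k / h n - v * K n k\<bar>)"
        by (rule order_trans[OF sum_abs]) (simp add: abs_mult abs_of_pos[OF a])
      finally show ?case using fin by simp
    qed
  qed
  from tendsto_add[OF this main] show ?thesis by (simp add: D_def)
qed

end

section \<open>Gaussian shifts\<close>

text \<open>Through \<open>f\<close> and \<open>w\<close>, two independent families of increments, which share one type, yield
  variables of different types: a tuple describing the whole path, and one real increment.\<close>

lemma (in prob_space) indep_var_compose_pair_law:
  assumes ind: "indep_var N U N' W" and f [measurable]: "f \<in> measurable N S" and w [measurable]: "w \<in> measurable N' T"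
  shows "distr M S (\<lambda>\<omega>. f (U \<omega>)) \<Otimes>\<^sub>M distr M T (\<lambda>\<omega>. w (W \<omega>)) =
    distr M (S \<Otimes>\<^sub>M T) (\<lambda>\<omega>. (f (U \<omega>), w (W \<omega>)))"
proof -
  have [measurable]: "U \<in> measurable M N" "W \<in> measurable M N'"
    using ind by (auto dest: indep_var_rv1 indep_var_rv2)
  interpret W: prob_space "distr (distr M N' W) T w"
    by (intro prob_space.prob_space_distr prob_space_distr) measurable
  have "distr (distr M N U) S f \<Otimes>\<^sub>M distr (distr M N' W) T w =
      distr (distr M N U \<Otimes>\<^sub>M distr M N' W) (S \<Otimes>\<^sub>M T) (\<lambda>(x, y). (f x, w y))"
    by (rule pair_measure_distr) (auto intro: W.sigma_finite_measure)
  also have "distr M N U \<Otimes>\<^sub>M distr M N' W = distr M (N \<Otimes>\<^sub>M N') (\<lambda>\<omega>. (U \<omega>, W \<omega>))"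
    using ind by (simp add: indep_var_distribution_eq)
  finally show ?thesis by (simp add: distr_distr comp_def)
qed

text \<open>The Cameron--Martin formula for one Gaussian variable:
  \<open>\<phi> x * exp (x - \<sigma>\<^sup>2 / 2) = \<phi> (x - \<sigma>\<^sup>2)\<close> for the centred density \<open>\<phi>\<close>, followed by a translation.\<close>

lemma (in prob_space) gaussian_tilt:
  fixes H :: "'c \<times> real \<Rightarrow> ennreal"
  assumes X: "distributed M lborel X (normal_density 0 \<sigma>)" and \<sigma>: "\<sigma> > 0"
    and Y [measurable]: "Y \<in> measurable M N"
    and ind: "distr M N Y \<Otimes>\<^sub>M distr M borel X = distr M (N \<Otimes>\<^sub>M borel) (\<lambda>\<omega>. (Y \<omega>, X \<omega>))"
    and H [measurable]: "H \<in> borel_measurable (N \<Otimes>\<^sub>M borel)"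
  shows "(\<integral>\<^sup>+ \<omega>. H (Y \<omega>, X \<omega>) * ennreal (exp (X \<omega> - \<sigma>\<^sup>2 / 2)) \<partial>M) = (\<integral>\<^sup>+ \<omega>. H (Y \<omega>, X \<omega> + \<sigma>\<^sup>2) \<partial>M)"
proof -
  have [measurable]: "X \<in> borel_measurable M" using distributed_measurable[OF X] by simp
  define \<phi> where "\<phi> x = ennreal (normal_density 0 \<sigma> x)" for x
  have [measurable]: "\<phi> \<in> borel_measurable borel" unfolding \<phi>_def by measurable
  have "distr M lborel X = density lborel \<phi>" using X by (simp add: distributed_def \<phi>_def[abs_def])
  moreover have "distr M borel X = distr M lborel X" by (rule distr_cong) auto
  ultimately have PX: "distr M borel X = density lborel \<phi>" by simp
  interpret PY: prob_space "distr M N Y" by (rule prob_space_distr) measurable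
  interpret PX: prob_space "distr M borel X" by (rule prob_space_distr) measurable
  have law: "(\<integral>\<^sup>+ \<omega>. F (Y \<omega>, X \<omega>) \<partial>M) = (\<integral>\<^sup>+ y. \<integral>\<^sup>+ x. \<phi> x * F (y, x) \<partial>lborel \<partial>distr M N Y)"
    if [measurable]: "F \<in> borel_measurable (N \<Otimes>\<^sub>M borel)" for F :: "'c \<times> real \<Rightarrow> ennreal"
  proof -
    have "(\<integral>\<^sup>+ \<omega>. F (Y \<omega>, X \<omega>) \<partial>M) = (\<integral>\<^sup>+ p. F p \<partial>distr M (N \<Otimes>\<^sub>M borel) (\<lambda>\<omega>. (Y \<omega>, X \<omega>)))"
      by (subst nn_integral_distr) auto
    also have "distr M (N \<Otimes>\<^sub>M borel) (\<lambda>\<omega>. (Y \<omega>, X \<omega>)) = distr M N Y \<Otimes>\<^sub>M distr M borel X"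
      by (rule ind[symmetric])
    also have "(\<integral>\<^sup>+ p. F p \<partial>(distr M N Y \<Otimes>\<^sub>M distr M borel X)) =
        (\<integral>\<^sup>+ y. \<integral>\<^sup>+ x. F (y, x) \<partial>distr M borel X \<partial>distr M N Y)"
      by (subst PX.nn_integral_fst[symmetric]) auto
    also have "\<dots> = (\<integral>\<^sup>+ y. \<integral>\<^sup>+ x. \<phi> x * F (y, x) \<partial>lborel \<partial>distr M N Y)"
      unfolding PX by (intro nn_integral_cong nn_integral_density) auto
    finally show ?thesis .
  qed
  have shift: "\<phi> (\<sigma>\<^sup>2 + 1 * x) * ennreal (exp (\<sigma>\<^sup>2 + 1 * x - \<sigma>\<^sup>2 / 2)) = \<phi> x" for x
  proof -
    have "normal_density 0 \<sigma> (\<sigma>\<^sup>2 + x) * exp (\<sigma>\<^sup>2 + x - \<sigma>\<^sup>2 / 2) = normal_density 0 \<sigma> x"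
    proof -
      have "- (\<sigma>\<^sup>2 + x)\<^sup>2 / (2 * \<sigma>\<^sup>2) + (\<sigma>\<^sup>2 + x - \<sigma>\<^sup>2 / 2) = - x\<^sup>2 / (2 * \<sigma>\<^sup>2)"
        using \<sigma> by (simp add: field_simps power2_eq_square)
      then show ?thesis by (simp add: normal_density_def mult_exp_exp)
    qed
    then show ?thesis by (simp add: \<phi>_def ennreal_mult[symmetric])
  qed
  have "(\<integral>\<^sup>+ \<omega>. H (Y \<omega>, X \<omega>) * ennreal (exp (X \<omega> - \<sigma>\<^sup>2 / 2)) \<partial>M) =
      (\<integral>\<^sup>+ y. \<integral>\<^sup>+ x. \<phi> x * (H (y, x) * ennreal (exp (x - \<sigma>\<^sup>2 / 2))) \<partial>lborel \<partial>distr M N Y)"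
    using law[of "\<lambda>p. H p * ennreal (exp (snd p - \<sigma>\<^sup>2 / 2))"] by simp
  also have "\<dots> = (\<integral>\<^sup>+ y. \<integral>\<^sup>+ x. \<phi> x * H (y, x + \<sigma>\<^sup>2) \<partial>lborel \<partial>distr M N Y)"
  proof (rule nn_integral_cong)
    fix y assume "y \<in> space (distr M N Y)"
    then have [measurable]: "(\<lambda>x. H (y, x)) \<in> borel_measurable borel" by simp
    have "(\<integral>\<^sup>+ x. \<phi> x * (H (y, x) * ennreal (exp (x - \<sigma>\<^sup>2 / 2))) \<partial>lborel) =
        (\<integral>\<^sup>+ x. \<phi> (\<sigma>\<^sup>2 + 1 * x) * (H (y, \<sigma>\<^sup>2 + 1 * x) * ennreal (exp (\<sigma>\<^sup>2 + 1 * x - \<sigma>\<^sup>2 / 2))) \<partial>lborel)"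
      by (subst nn_integral_real_affine[where c = 1 and t = "\<sigma>\<^sup>2"]) auto
    also have "\<dots> = (\<integral>\<^sup>+ x. \<phi> x * H (y, x + \<sigma>\<^sup>2) \<partial>lborel)"
      by (subst shift[symmetric]) (simp add: mult_ac add.commute)
    finally show "(\<integral>\<^sup>+ x. \<phi> x * (H (y, x) * ennreal (exp (x - \<sigma>\<^sup>2 / 2))) \<partial>lborel) =
        (\<integral>\<^sup>+ x. \<phi> x * H (y, x + \<sigma>\<^sup>2) \<partial>lborel)" .
  qed
  also have "\<dots> = (\<integral>\<^sup>+ \<omega>. H (Y \<omega>, X \<omega> + \<sigma>\<^sup>2) \<partial>M)"
    using law[of "\<lambda>p. H (fst p, snd p + \<sigma>\<^sup>2)"] by simp
  finally show ?thesis .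
qed

text \<open>For \<open>H\<close> of either sign: by \<open>gaussian_tilt\<close> the law of \<open>(Y, X)\<close> under the tilted measure
  is the law of \<open>(Y, X + \<sigma>\<^sup>2)\<close>.\<close>

lemma (in prob_space) gaussian_tilt_integral:
  fixes H :: "'c \<times> real \<Rightarrow> real"
  assumes X: "distributed M lborel X (normal_density 0 \<sigma>)" and \<sigma>: "\<sigma> > 0"
    and Y [measurable]: "Y \<in> measurable M N"
    and ind: "distr M N Y \<Otimes>\<^sub>M distr M borel X = distr M (N \<Otimes>\<^sub>M borel) (\<lambda>\<omega>. (Y \<omega>, X \<omega>))"
    and H [measurable]: "H \<in> borel_measurable (N \<Otimes>\<^sub>M borel)"
  shows "(\<integral> \<omega>. H (Y \<omega>, X \<omega>) * exp (X \<omega>) \<partial>M) = exp (\<sigma>\<^sup>2 / 2) * (\<integral> \<omega>. H (Y \<omega>, X \<omega> + \<sigma>\<^sup>2) \<partial>M)"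
proof -
  have [measurable]: "X \<in> borel_measurable M" using distributed_measurable[OF X] by simp
  let ?P = "N \<Otimes>\<^sub>M (borel :: real measure)"
  let ?M = "density M (\<lambda>\<omega>. ennreal (exp (X \<omega> - \<sigma>\<^sup>2 / 2)))"
  have eq: "distr ?M ?P (\<lambda>\<omega>. (Y \<omega>, X \<omega>)) = distr M ?P (\<lambda>\<omega>. (Y \<omega>, X \<omega> + \<sigma>\<^sup>2))"
  proof (rule measure_eqI)
    fix C assume "C \<in> sets (distr ?M ?P (\<lambda>\<omega>. (Y \<omega>, X \<omega>)))"
    then have [measurable]: "C \<in> sets ?P" by simp
    have "emeasure (distr ?M ?P (\<lambda>\<omega>. (Y \<omega>, X \<omega>))) C = (\<integral>\<^sup>+ p. indicator C p \<partial>distr ?M ?P (\<lambda>\<omega>. (Y \<omega>, X \<omega>)))"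
      by simp
    also have "\<dots> = (\<integral>\<^sup>+ \<omega>. ennreal (exp (X \<omega> - \<sigma>\<^sup>2 / 2)) * indicator C (Y \<omega>, X \<omega>) \<partial>M)"
      by (simp add: nn_integral_distr nn_integral_density del: nn_integral_indicator)
    also have "\<dots> = (\<integral>\<^sup>+ \<omega>. indicator C (Y \<omega>, X \<omega> + \<sigma>\<^sup>2) \<partial>M)"
      using gaussian_tilt[OF X \<sigma> Y ind, of "indicator C"] by (simp add: mult.commute)
    also have "\<dots> = (\<integral>\<^sup>+ p. indicator C p \<partial>distr M ?P (\<lambda>\<omega>. (Y \<omega>, X \<omega> + \<sigma>\<^sup>2)))"
      by (simp add: nn_integral_distr del: nn_integral_indicator)
    finally show "emeasure (distr ?M ?P (\<lambda>\<omega>. (Y \<omega>, X \<omega>))) C =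
        emeasure (distr M ?P (\<lambda>\<omega>. (Y \<omega>, X \<omega> + \<sigma>\<^sup>2))) C"
      by simp
  qed simp
  have "(\<integral> \<omega>. H (Y \<omega>, X \<omega>) * exp (X \<omega>) \<partial>M) = (\<integral> \<omega>. exp (\<sigma>\<^sup>2 / 2) * (exp (X \<omega> - \<sigma>\<^sup>2 / 2) * H (Y \<omega>, X \<omega>)) \<partial>M)"
    by (rule Bochner_Integration.integral_cong) (auto simp: exp_diff)
  also have "\<dots> = exp (\<sigma>\<^sup>2 / 2) * (\<integral> p. H p \<partial>distr ?M ?P (\<lambda>\<omega>. (Y \<omega>, X \<omega>)))"
    by (simp add: integral_distr integral_density)
  also have "\<dots> = exp (\<sigma>\<^sup>2 / 2) * (\<integral> \<omega>. H (Y \<omega>, X \<omega> + \<sigma>\<^sup>2) \<partial>M)"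
    unfolding eq by (simp add: integral_distr)
  finally show ?thesis .
qed

section \<open>Integration by parts along the exponential of the path\<close>

context two_sided_brownian_motion
begin

text \<open>The tilt is applied to the increment over the \<open>k\<close>-th step, which is independent of the others.
  The later terms \<open>C k\<close> of the Riemann sum \<open>S\<close> carry the factor \<open>exp\<close> of this increment,
  whereas the earlier ones do not involve it.\<close>

lemma increment_tilt:
  fixes g :: "real \<Rightarrow> real \<Rightarrow> real" and s h :: real and n k :: nat
  defines "b \<equiv> \<lambda>k \<omega>. \<xi> (s + real k * h) \<omega> - \<xi> s \<omega>"
  defines "S \<equiv> \<lambda>\<omega>. \<Sum>k<n. h * exp (b k \<omega>)" and "C \<equiv> \<lambda>k \<omega>. \<Sum>j\<in>{k<..<n}. h * exp (b j \<omega>)"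
  assumes v: "v > 0" and h: "h > 0" and k: "k < n"
    and g [measurable]: "(\<lambda>p. g (fst p) (snd p)) \<in> borel_measurable (borel \<Otimes>\<^sub>M borel)"
  shows "(\<integral>\<omega>. g (S \<omega>) (b n \<omega>) * exp (b (Suc k) \<omega>) \<partial>M) =
    exp (v * h / 2) * (\<integral>\<omega>. exp (b k \<omega>) * g (S \<omega> + (exp (v * h) - 1) * C k \<omega>) (b n \<omega> + v * h) \<partial>M)"
proof -
  define \<tau> where "\<tau> k = s + real k * h" for k
  define D where "D i \<omega> = \<xi> (\<tau> (Suc i)) \<omega> - \<xi> (\<tau> i) \<omega>" for i \<omega>
  define I where "I = {..<n} - {k}"
  have "strict_mono_on {..n} \<tau>" using h by (auto simp: strict_mono_on_def \<tau>_def)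
  then have "indep_vars (\<lambda>_. borel) D {..<n}"
    using independent_increments[of n \<tau>] by (simp add: D_def[abs_def])
  then have ind: "indep_var (PiM I (\<lambda>_. borel)) (\<lambda>\<omega>. restrict (\<lambda>i. D i \<omega>) I)
      (PiM {k} (\<lambda>_. borel)) (\<lambda>\<omega>. restrict (\<lambda>i. D i \<omega>) {k})"
    by (rule indep_var_restrict) (use k in \<open>auto simp: I_def\<close>)
  have Dk: "distributed M lborel (D k) (normal_density 0 (sqrt (v * h)))"
    using gaussian_increments[of "\<tau> k" "\<tau> (Suc k)"] h by (simp add: D_def[abs_def] \<tau>_def algebra_simps)
  have b: "b j \<omega> = (\<Sum>i<j. D i \<omega>)" for j \<omega>
    unfolding D_def b_def using sum_lessThan_telescope[of "\<lambda>i. \<xi> (\<tau> i) \<omega>" j] by (simp add: \<tau>_def)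
  have b': "b j \<omega> = D k \<omega> + (\<Sum>i\<in>{..<j} - {k}. D i \<omega>)" if "k < j" for j \<omega>
    unfolding b using that by (intro sum.remove) auto
  \<comment> \<open>Everything except the \<open>k\<close>-th increment: the path at step \<open>k\<close>, the terms of \<open>S\<close> up to step \<open>k\<close>,
    the later terms and the end point of the path with that increment removed.\<close>
  define f where "f y = ((\<Sum>i<k. y i), (\<Sum>j\<le>k. h * exp (\<Sum>i<j. y i)),
      (\<Sum>j\<in>{k<..<n}. h * exp (\<Sum>i\<in>{..<j} - {k}. y i)), (\<Sum>i\<in>I. y i))" for y :: "nat \<Rightarrow> real"
  define N where "N = (borel :: real measure) \<Otimes>\<^sub>M (borel :: real measure) \<Otimes>\<^sub>M (borel :: real measure) \<Otimes>\<^sub>M (borel :: real measure)"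
  have comp: "(\<lambda>y. y i) \<in> borel_measurable (PiM I (\<lambda>_. borel :: real measure))" if "i \<in> I" for i
    using that by (rule measurable_component_singleton)
  have f [measurable]: "f \<in> measurable (PiM I (\<lambda>_. borel)) N"
    unfolding f_def[abs_def] N_def
    by (intro measurable_Pair borel_measurable_sum borel_measurable_times borel_measurable_const
        measurable_compose[OF _ borel_measurable_exp] comp) (use k in \<open>auto simp: I_def\<close>)
  have w [measurable]: "(\<lambda>y. y k) \<in> borel_measurable (PiM {k} (\<lambda>_. borel :: real measure))"
    by (rule measurable_component_singleton) simp
  define Y where "Y \<omega> = f (restrict (\<lambda>i. D i \<omega>) I)" for \<omega>
  have Y [measurable]: "Y \<in> measurable M N"
    unfolding Y_def by (rule measurable_compose[OF indep_var_rv1[OF ind] f])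
  have Yeq: "Y \<omega> = (b k \<omega>, (\<Sum>j\<le>k. h * exp (b j \<omega>)), (\<Sum>j\<in>{k<..<n}. h * exp (b j \<omega> - D k \<omega>)), b n \<omega> - D k \<omega>)" for \<omega>
  proof -
    have r: "(\<Sum>i\<in>J. restrict (\<lambda>i. D i \<omega>) I i) = (\<Sum>i\<in>J. D i \<omega>)" if "J \<subseteq> I" for J
      using that by (intro sum.cong) auto
    have "(\<Sum>i<j. restrict (\<lambda>i. D i \<omega>) I i) = b j \<omega>" if "j \<le> k" for j
      unfolding b using that k by (intro r) (auto simp: I_def)
    moreover have "(\<Sum>i\<in>{..<j} - {k}. restrict (\<lambda>i. D i \<omega>) I i) = b j \<omega> - D k \<omega>" if "k < j" "j \<le> n" for j
      using b'[OF that(1)] that by (subst r) (auto simp: I_def)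
    moreover have "(\<Sum>i\<in>I. restrict (\<lambda>i. D i \<omega>) I i) = b n \<omega> - D k \<omega>"
      using b'[OF k] by (simp add: I_def)
    ultimately show ?thesis unfolding Y_def f_def by simp
  qed
  have law: "distr M N Y \<Otimes>\<^sub>M distr M borel (D k) = distr M (N \<Otimes>\<^sub>M borel) (\<lambda>\<omega>. (Y \<omega>, D k \<omega>))"
    using indep_var_compose_pair_law[OF ind f w] by (simp add: Y_def[abs_def])
  define H where "H = (\<lambda>((p, P, Q, R), x). exp p * g (P + exp x * Q) (R + x))"
  have H: "H \<in> borel_measurable (N \<Otimes>\<^sub>M borel)"
  proof -
    have "(\<lambda>z. (fst (snd (fst z)) + exp (snd z) * fst (snd (snd (fst z))), snd (snd (snd (fst z))) + snd z))
        \<in> measurable (N \<Otimes>\<^sub>M borel) (borel \<Otimes>\<^sub>M (borel :: real measure))"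
      unfolding N_def by measurable
    from measurable_compose[OF this g] have "(\<lambda>z. g (fst (snd (fst z)) + exp (snd z) * fst (snd (snd (fst z))))
        (snd (snd (snd (fst z))) + snd z)) \<in> borel_measurable (N \<Otimes>\<^sub>M borel)" by simp
    moreover have "(\<lambda>z. exp (fst (fst z))) \<in> borel_measurable (N \<Otimes>\<^sub>M borel)"
      unfolding N_def by measurable
    ultimately have "(\<lambda>z. exp (fst (fst z)) * g (fst (snd (fst z)) + exp (snd z) * fst (snd (snd (fst z))))
        (snd (snd (snd (fst z))) + snd z)) \<in> borel_measurable (N \<Otimes>\<^sub>M borel)"
      by (rule borel_measurable_times[rotated])
    then show ?thesis unfolding H_def by (simp add: case_prod_beta')
  qed
  have split: "(\<Sum>j<n. F j) = (\<Sum>j\<le>k. F j) + (\<Sum>j\<in>{k<..<n}. F j)" for F :: "nat \<Rightarrow> real"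
  proof -
    have *: "{..<n} = {..k} \<union> {k<..<n}" using k by auto
    show ?thesis unfolding * by (rule sum.union_disjoint) auto
  qed
  have sq: "(sqrt (v * h))\<^sup>2 = v * h" using v h by simp
  have DC: "exp (D k \<omega>) * (\<Sum>j\<in>{k<..<n}. h * exp (b j \<omega> - D k \<omega>)) = C k \<omega>" for \<omega>
    unfolding C_def by (simp add: sum_distrib_left exp_diff field_simps)
  have "(\<integral>\<omega>. H (Y \<omega>, D k \<omega>) * exp (D k \<omega>) \<partial>M) =
      exp (v * h / 2) * (\<integral>\<omega>. H (Y \<omega>, D k \<omega> + v * h) \<partial>M)"
    using gaussian_tilt_integral[OF Dk _ Y law H] v h unfolding sq by simp
  moreover have "H (Y \<omega>, D k \<omega>) * exp (D k \<omega>) = g (S \<omega>) (b n \<omega>) * exp (b (Suc k) \<omega>)" for \<omega>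
  proof -
    have "b (Suc k) \<omega> = b k \<omega> + D k \<omega>" unfolding b by simp
    moreover have "(\<Sum>j\<le>k. h * exp (b j \<omega>)) + C k \<omega> = S \<omega>" unfolding S_def C_def by (simp add: split)
    ultimately show ?thesis unfolding H_def Yeq by (simp add: DC exp_add)
  qed
  moreover have "H (Y \<omega>, D k \<omega> + v * h) =
      exp (b k \<omega>) * g (S \<omega> + (exp (v * h) - 1) * C k \<omega>) (b n \<omega> + v * h)" for \<omega>
  proof -
    have "(\<Sum>j\<le>k. h * exp (b j \<omega>)) + exp (D k \<omega> + v * h) * (\<Sum>j\<in>{k<..<n}. h * exp (b j \<omega> - D k \<omega>)) =
        S \<omega> + (exp (v * h) - 1) * C k \<omega>"
      unfolding S_def split DC[symmetric] by (simp add: C_def exp_add DC algebra_simps)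
    then show ?thesis unfolding H_def Yeq by simp
  qed
  ultimately show ?thesis by simp
qed

text \<open>Summing \<open>increment_tilt\<close> over \<open>k\<close>, the left-hand sides telescope because
  \<open>exp (b (Suc k))\<close> occurs at step \<open>k\<close> and \<open>exp (b k)\<close> is subtracted there. The factor
  \<open>exp (b k)\<close> is the size of the displacement of the \<open>k\<close>-th increment.\<close>

lemma discrete_integration_by_parts:
  fixes s h :: real and n :: nat
  defines "b \<equiv> \<lambda>k \<omega>. \<xi> (s + real k * h) \<omega> - \<xi> s \<omega>"
  defines "S \<equiv> \<lambda>\<omega>. \<Sum>k<n. h * exp (b k \<omega>)" and "C \<equiv> \<lambda>k \<omega>. \<Sum>j\<in>{k<..<n}. h * exp (b j \<omega>)"
  assumes v: "v > 0" and h: "h > 0" and n: "n > 0" and g: "test_function g g1 g2 A0 L"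
  shows "(\<integral>\<omega>. g (S \<omega>) (b n \<omega>) * (exp (b n \<omega>) - 1 - (exp (v * h / 2) - 1) / h * S \<omega>) \<partial>M) =
    exp (v * h / 2) * (\<integral>\<omega>. (\<Sum>k<n. exp (b k \<omega>) *
      (g (S \<omega> + (exp (v * h) - 1) * C k \<omega>) (b n \<omega> + v * h) - g (S \<omega>) (b n \<omega>))) \<partial>M)"
proof -
  interpret g: test_function g g1 g2 A0 L by fact
  let ?q = "exp (v * h / 2)"
  define G where "G \<omega> = g (S \<omega>) (b n \<omega>)" for \<omega>
  define G' where "G' k \<omega> = g (S \<omega> + (exp (v * h) - 1) * C k \<omega>) (b n \<omega> + v * h)" for k \<omega>
  have bm [measurable]: "b k \<in> borel_measurable M" for k unfolding b_def by measurable
  have Sm [measurable]: "S \<in> borel_measurable M" unfolding S_def by measurable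
  have Cm [measurable]: "C k \<in> borel_measurable M" for k unfolding C_def by measurable
  have [measurable]: "G \<in> borel_measurable M"
    unfolding G_def using measurable_compose[OF measurable_Pair[OF Sm bm[of n]] g.meas(1)] by simp
  have [measurable]: "G' k \<in> borel_measurable M" for k
    unfolding G'_def
    using measurable_compose[OF measurable_Pair[of "\<lambda>\<omega>. S \<omega> + (exp (v * h) - 1) * C k \<omega>" M borel
      "\<lambda>\<omega>. b n \<omega> + v * h" borel] g.meas(1)] by simp
  have Spos: "S \<omega> > 0" for \<omega> unfolding S_def using h n by (intro sum_pos) auto
  have Cpos: "C k \<omega> \<ge> 0" for k \<omega> unfolding C_def using h by (intro sum_nonneg) auto
  \<comment> \<open>Since \<open>exp (b k)\<close> is one term of \<open>S / h\<close>, the bound on \<open>\<bar>g A b\<bar> * A\<close> controls all products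
    \<open>exp (b k) * g\<close>, shifted or not.\<close>
  have expb: "exp (b k \<omega>) \<le> S \<omega> / h" if "k < n" for k \<omega>
  proof -
    have "h * exp (b k \<omega>) \<le> S \<omega>" unfolding S_def
      by (rule member_le_sum) (use that h in auto)
    then show ?thesis using h by (simp add: field_simps)
  qed
  have bnd: "X * \<bar>g A y\<bar> \<le> K * L" if "A > 0" "0 \<le> X" "X \<le> K * (1 + exp y + A)" "K \<ge> 0" for X A y K
  proof -
    have "X * \<bar>g A y\<bar> \<le> K * (1 + exp y + A) * \<bar>g A y\<bar>" using that by (intro mult_right_mono) auto
    also have "\<dots> \<le> K * L" using mult_left_mono[OF g.bound[OF that(1)] that(4), of y] by (simp add: mult_ac)
    finally show ?thesis .
  qed
  have bG: "exp (b k \<omega>) * \<bar>G \<omega>\<bar> \<le> (1 / h + 1) * L" if "k \<le> n" for k \<omega>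
    unfolding G_def
  proof (rule bnd[OF Spos])
    show "exp (b k \<omega>) \<le> (1 / h + 1) * (1 + exp (b n \<omega>) + S \<omega>)"
    proof (cases "k = n")
      case True
      have "0 \<le> 1 / h * (1 + exp (b n \<omega>) + S \<omega>)" using h Spos[of \<omega>] by simp
      then show ?thesis using True Spos[of \<omega>] by (simp add: distrib_right)
    next
      case False
      then have "exp (b k \<omega>) \<le> 1 / h * S \<omega>" using expb[of k \<omega>] that by simp
      also have "\<dots> \<le> (1 / h + 1) * (1 + exp (b n \<omega>) + S \<omega>)"
        using h Spos[of \<omega>] by (intro mult_mono) auto
      finally show ?thesis .
    qed
  qed (use h in auto)
  have bG': "exp (b k \<omega>) * \<bar>G' k \<omega>\<bar> \<le> (1 / h) * L" if "k < n" for k \<omega>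
    unfolding G'_def
  proof (rule bnd)
    have *: "0 \<le> (exp (v * h) - 1) * C k \<omega>" using Cpos v h by (intro mult_nonneg_nonneg) auto
    then show "0 < S \<omega> + (exp (v * h) - 1) * C k \<omega>" using Spos by (intro add_pos_nonneg)
    have "exp (b k \<omega>) \<le> 1 / h * S \<omega>" using expb[OF that] by simp
    also have "\<dots> \<le> 1 / h * (1 + exp (b n \<omega> + v * h) + (S \<omega> + (exp (v * h) - 1) * C k \<omega>))"
      using h * by (intro mult_left_mono) (auto simp: add_increasing)
    finally show "exp (b k \<omega>) \<le> 1 / h * (1 + exp (b n \<omega> + v * h) + (S \<omega> + (exp (v * h) - 1) * C k \<omega>))" .
  qed (use h in auto)
  have iG: "integrable M (\<lambda>\<omega>. exp (b k \<omega>) * G \<omega>)" if "k \<le> n" for k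
    by (rule integrable_const_bound[of _ "(1 / h + 1) * L"]) (use bG[OF that] in \<open>auto simp: abs_mult\<close>)
  have iG': "integrable M (\<lambda>\<omega>. exp (b k \<omega>) * G' k \<omega>)" if "k < n" for k
    by (rule integrable_const_bound[of _ "(1 / h) * L"]) (use bG'[OF that] in \<open>auto simp: abs_mult\<close>)
  have step: "(\<integral>\<omega>. exp (b (Suc k) \<omega>) * G \<omega> \<partial>M) = ?q * (\<integral>\<omega>. exp (b k \<omega>) * G' k \<omega> \<partial>M)" if "k < n" for k
    using increment_tilt[OF v h that g.meas(1), of s] unfolding G_def G'_def b_def S_def C_def
    by (simp add: mult.commute)
  have tele: "G \<omega> * (exp (b n \<omega>) - 1 - (?q - 1) / h * S \<omega>) =
      (\<Sum>k<n. exp (b (Suc k) \<omega>) * G \<omega> - ?q * (exp (b k \<omega>) * G \<omega>))" for \<omega>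
  proof -
    have e1: "S \<omega> / h = (\<Sum>k<n. exp (b k \<omega>))" unfolding S_def using h by (simp flip: sum_distrib_left)
    have e2: "(\<Sum>k<n. exp (b (Suc k) \<omega>) - exp (b k \<omega>)) = exp (b n \<omega>) - exp (b 0 \<omega>)"
      by (rule sum_lessThan_telescope)
    have e3: "b 0 \<omega> = 0" by (simp add: b_def)
    have e4: "(\<Sum>k<n. exp (b (Suc k) \<omega>) * G \<omega> - ?q * (exp (b k \<omega>) * G \<omega>)) =
        G \<omega> * ((\<Sum>k<n. exp (b (Suc k) \<omega>) - exp (b k \<omega>)) - (?q - 1) * (\<Sum>k<n. exp (b k \<omega>)))"
      by (simp add: sum_distrib_left sum_distrib_right sum_subtractf algebra_simps)
    show ?thesis unfolding e4 e2 e3 e1[symmetric] by simp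
  qed
  have "(\<integral>\<omega>. G \<omega> * (exp (b n \<omega>) - 1 - (?q - 1) / h * S \<omega>) \<partial>M) =
      (\<Sum>k<n. (\<integral>\<omega>. exp (b (Suc k) \<omega>) * G \<omega> \<partial>M) - ?q * (\<integral>\<omega>. exp (b k \<omega>) * G \<omega> \<partial>M))"
    unfolding tele using iG by (simp add: Bochner_Integration.integral_sum Bochner_Integration.integral_diff)
  also have "\<dots> = (\<Sum>k<n. ?q * (\<integral>\<omega>. exp (b k \<omega>) * (G' k \<omega> - G \<omega>) \<partial>M))"
    using iG iG' by (intro sum.cong) (auto simp: step right_diff_distrib)
  also have "\<dots> = ?q * (\<integral>\<omega>. (\<Sum>k<n. exp (b k \<omega>) * (G' k \<omega> - G \<omega>)) \<partial>M)"
    using iG iG' by (subst Bochner_Integration.integral_sum) (auto simp: sum_distrib_left right_diff_distrib)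
  finally show ?thesis unfolding G_def G'_def .
qed

end

locale brownian_segment = two_sided_brownian_motion +
  fixes s t :: real
  assumes v: "v > 0" and st: "s < t"
begin

definition B :: "'a \<Rightarrow> real" where "B \<omega> = \<xi> t \<omega> - \<xi> s \<omega>"

text \<open>The integral of \<open>exp (\<xi> u - \<xi> s)\<close> over \<open>[s, t]\<close>.\<close>

definition A :: "'a \<Rightarrow> real" where
  "A \<omega> = (exp_primitive \<xi> \<omega> t - exp_primitive \<xi> \<omega> s) * exp (- \<xi> s \<omega>)"

definition Ob :: "'a \<Rightarrow> real" where "Ob \<omega> = exp (B \<omega> / 2) / A \<omega>"

lemma B_measurable [measurable]: "B \<in> borel_measurable M"
  unfolding B_def by measurable

lemma A_measurable [measurable]: "A \<in> borel_measurable M"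
proof -
  note [measurable] = measurable_compose[OF exp_primitive_measurable borel_measurable_C1_eval]
  show ?thesis unfolding A_def by measurable
qed

lemma Ob_measurable [measurable]: "Ob \<in> borel_measurable M"
  unfolding Ob_def by measurable

lemma A_pos: "\<omega> \<in> space M \<Longrightarrow> A \<omega> > 0"
  using DERIV_pos_imp_increasing[OF st, of "exp_primitive \<xi> \<omega>"] has_field_derivative_exp_primitive[of \<omega>]
  unfolding A_def by (metis diff_gt_0_iff_gt exp_gt_zero zero_less_mult_iff)

lemma Ob_pos: "\<omega> \<in> space M \<Longrightarrow> Ob \<omega> > 0"
  unfolding Ob_def using A_pos by simp

lemma obs_eq_Ob: "\<omega> \<in> space M \<Longrightarrow> obs (exp_primitive \<xi> \<omega>) s t = Ob \<omega>"
proof -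
  assume \<omega>: "\<omega> \<in> space M"
  have "exp (\<xi> s \<omega>) * exp (\<xi> t \<omega>) = (exp ((\<xi> s \<omega> + \<xi> t \<omega>) / 2))\<^sup>2"
    by (simp add: power2_eq_square mult_exp_exp)
  moreover have "exp_primitive \<xi> \<omega> t - exp_primitive \<xi> \<omega> s = A \<omega> * exp (\<xi> s \<omega>)"
    by (simp add: A_def mult.assoc mult_exp_exp)
  ultimately have "obs (exp_primitive \<xi> \<omega>) s t = exp ((\<xi> s \<omega> + \<xi> t \<omega>) / 2) / (A \<omega> * exp (\<xi> s \<omega>))"
    unfolding obs_def deriv_exp_primitive[OF \<omega>] using A_pos[OF \<omega>] by (simp add: abs_mult)
  also have "exp ((\<xi> s \<omega> + \<xi> t \<omega>) / 2) = exp (\<xi> s \<omega>) * exp (B \<omega> / 2)"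
    by (simp add: B_def mult_exp_exp field_simps)
  finally show ?thesis by (simp add: Ob_def)
qed

text \<open>The limit of \<open>discrete_integration_by_parts\<close> along the uniform partitions. On the right stands
  the derivative of \<open>g (A, B)\<close> when the path is displaced by its exponential integral, which
  changes \<open>B\<close> at rate \<open>A\<close> and \<open>A\<close> at rate \<open>A\<^sup>2 / 2\<close>; on the left the divergence of this
  vector field, where the term \<open>v / 2 * A\<close> is the Ito correction.\<close>

theorem integration_by_parts:
  assumes "test_function g g1 g2 A0 L"
  shows "(\<integral>\<omega>. g (A \<omega>) (B \<omega>) * (exp (B \<omega>) - 1 - v / 2 * A \<omega>) \<partial>M) =
    (\<integral>\<omega>. v * (A \<omega> * g2 (A \<omega>) (B \<omega>) + (A \<omega>)\<^sup>2 / 2 * g1 (A \<omega>) (B \<omega>)) \<partial>M)"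
proof -
  interpret g: test_function g g1 g2 A0 L by fact
  define h where "h n = (t - s) / real (Suc n)" for n
  define b where "b n k \<omega> = \<xi> (s + real k * h n) \<omega> - \<xi> s \<omega>" for n k \<omega>
  define S where "S n \<omega> = (\<Sum>k<Suc n. h n * exp (b n k \<omega>))" for n \<omega>
  define C where "C n k \<omega> = (\<Sum>j\<in>{k<..<Suc n}. h n * exp (b n j \<omega>))" for n k \<omega>
  define q where "q n = (exp (v * h n / 2) - 1) / h n" for n
  define R where "R n \<omega> = (\<Sum>k<Suc n. exp (b n k \<omega>) *
      (g (S n \<omega> + (exp (v * h n) - 1) * C n k \<omega>) (B \<omega> + v * h n) - g (S n \<omega>) (B \<omega>)))" for n \<omega>
  have h: "h n > 0" for n using st by (simp add: h_def)
  have h0: "h \<longlonglongrightarrow> 0" unfolding h_def[abs_def] using LIMSEQ_Suc[OF lim_const_over_n[of "t - s"]] by simp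
  have bm [measurable]: "b n k \<in> borel_measurable M" for n k unfolding b_def by measurable
  have Sm [measurable]: "S n \<in> borel_measurable M" for n unfolding S_def by measurable
  have Cm [measurable]: "C n k \<in> borel_measurable M" for n k unfolding C_def by measurable
  have gm: "(\<lambda>\<omega>. g (X \<omega>) (Y \<omega>)) \<in> borel_measurable M"
      "(\<lambda>\<omega>. g1 (X \<omega>) (Y \<omega>)) \<in> borel_measurable M" "(\<lambda>\<omega>. g2 (X \<omega>) (Y \<omega>)) \<in> borel_measurable M"
    if "X \<in> borel_measurable M" "Y \<in> borel_measurable M" for X Y
    using measurable_compose[OF measurable_Pair[OF that] g.meas(1)]
      measurable_compose[OF measurable_Pair[OF that] g.meas(2)]
      measurable_compose[OF measurable_Pair[OF that] g.meas(3)] by simp_all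
  have Spos: "S n \<omega> > 0" for n \<omega> unfolding S_def using h by (intro sum_pos mult_pos_pos) auto
  have C: "0 \<le> C n k \<omega>" "C n k \<omega> \<le> S n \<omega>" for n k \<omega>
  proof -
    have hn: "0 \<le> h n" using h[of n] by simp
    show "0 \<le> C n k \<omega>" unfolding C_def using hn by (intro sum_nonneg) auto
    show "C n k \<omega> \<le> S n \<omega>" unfolding C_def S_def using hn by (intro sum_mono2) auto
  qed
  have SA: "(\<lambda>n. S n \<omega>) \<longlonglongrightarrow> A \<omega>" if \<omega>: "\<omega> \<in> space M" for \<omega>
  proof -
    have "((\<lambda>x. exp_primitive \<xi> \<omega> x * exp (- \<xi> s \<omega>)) has_real_derivative exp (\<xi> x \<omega> - \<xi> s \<omega>)) (at x)" for x
      by (auto intro!: derivative_eq_intros has_field_derivative_exp_primitive[OF \<omega>] simp: mult_exp_exp)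
    moreover have "continuous_on UNIV (\<lambda>x. exp (\<xi> x \<omega> - \<xi> s \<omega>))"
      by (intro continuous_intros continuous_paths[OF \<omega>])
    ultimately have "(\<lambda>n. \<Sum>k<Suc n. (t - s) / Suc n * exp (\<xi> (s + k * ((t - s) / Suc n)) \<omega> - \<xi> s \<omega>)) \<longlonglongrightarrow>
        exp_primitive \<xi> \<omega> t * exp (- \<xi> s \<omega>) - exp_primitive \<xi> \<omega> s * exp (- \<xi> s \<omega>)"
      using st by (rule left_riemann_sum_tendsto)
    then show ?thesis unfolding S_def b_def h_def A_def left_diff_distrib .
  qed
  have sq: "(\<lambda>n. \<Sum>k<Suc n. (h n * exp (b n k \<omega>))\<^sup>2) \<longlonglongrightarrow> 0" if \<omega>: "\<omega> \<in> space M" for \<omega>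
  proof -
    have "continuous_on {s..t} (\<lambda>x. exp (\<xi> x \<omega> - \<xi> s \<omega>))"
      by (intro continuous_intros continuous_on_subset[OF continuous_paths[OF \<omega>]]) auto
    then have "bounded ((\<lambda>x. exp (\<xi> x \<omega> - \<xi> s \<omega>)) ` {s..t})"
      by (intro compact_imp_bounded compact_continuous_image) auto
    then obtain K where "\<forall>x\<in>{s..t}. norm (exp (\<xi> x \<omega> - \<xi> s \<omega>)) \<le> K"
      unfolding bounded_iff by auto
    then have K: "exp (\<xi> x \<omega> - \<xi> s \<omega>) \<le> K" if "x \<in> {s..t}" for x
      using that by auto
    have up: "(\<Sum>k<Suc n. (h n * exp (b n k \<omega>))\<^sup>2) \<le> h n * K * S n \<omega>" for n
      unfolding S_def sum_distrib_left
    proof (rule sum_mono)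
      fix k assume "k \<in> {..<Suc n}"
      then have "real k * h n \<le> real (Suc n) * h n" using h[of n] by (intro mult_right_mono) auto
      also have "\<dots> = t - s" by (simp add: h_def del: of_nat_Suc)
      finally have "exp (b n k \<omega>) \<le> K" unfolding b_def using h[of n] by (intro K) auto
      then have "(h n * exp (b n k \<omega>)) * (h n * exp (b n k \<omega>)) \<le> (h n * K) * (h n * exp (b n k \<omega>))"
        using h[of n] by (intro mult_right_mono mult_left_mono) auto
      then show "(h n * exp (b n k \<omega>))\<^sup>2 \<le> h n * K * (h n * exp (b n k \<omega>))" by (simp add: power2_eq_square)
    qed
    have "(\<lambda>n. h n * K * S n \<omega>) \<longlonglongrightarrow> 0 * K * A \<omega>" by (intro tendsto_intros h0 SA \<omega>)
    then have lim: "(\<lambda>n. h n * K * S n \<omega>) \<longlonglongrightarrow> 0" by simp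
    show ?thesis
      by (rule tendsto_sandwich[OF always_eventually always_eventually tendsto_const lim])
        (use up in \<open>blast intro: sum_nonneg zero_le_power2\<close>)+
  qed
  \<comment> \<open>This limit produces the Ito correction.\<close>
  have q: "q \<longlonglongrightarrow> v / 2"
  proof -
    have "filterlim (\<lambda>n. v * h n / 2) (at 0) sequentially"
      unfolding filterlim_at using tendsto_mult[OF tendsto_const h0, of "v / 2"] h v by (auto simp: less_imp_neq[symmetric])
    from filterlim_compose[OF lim_exp_minus_1 this]
    have "(\<lambda>n. v / 2 * ((exp (v * h n / 2) - 1) / (v * h n / 2))) \<longlonglongrightarrow> v / 2 * 1" by (intro tendsto_intros)
    moreover have "v / 2 * ((exp (v * h n / 2) - 1) / (v * h n / 2)) = q n" for n
      using v h[of n] by (simp add: q_def field_simps)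
    ultimately show ?thesis by simp
  qed
  then have "Bseq q" by (intro convergent_imp_Bseq) (auto simp: convergent_def)
  then obtain K where K: "K > 0" "\<And>n. \<bar>q n\<bar> \<le> K" unfolding Bseq_def by auto
  have L: "L \<ge> 0" by (rule g.bound_nonneg)
  have lhs: "(\<lambda>n. \<integral>\<omega>. g (S n \<omega>) (B \<omega>) * (exp (B \<omega>) - 1 - q n * S n \<omega>) \<partial>M) \<longlonglongrightarrow>
      (\<integral>\<omega>. g (A \<omega>) (B \<omega>) * (exp (B \<omega>) - 1 - v / 2 * A \<omega>) \<partial>M)"
  proof (rule integral_dominated_convergence[where w = "\<lambda>_. (1 + K) * L"])
    show "AE \<omega> in M. (\<lambda>n. g (S n \<omega>) (B \<omega>) * (exp (B \<omega>) - 1 - q n * S n \<omega>)) \<longlonglongrightarrow>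
        g (A \<omega>) (B \<omega>) * (exp (B \<omega>) - 1 - v / 2 * A \<omega>)"
    proof (rule AE_I2)
      fix \<omega> assume \<omega>: "\<omega> \<in> space M"
      have "(\<lambda>n. (S n \<omega>, B \<omega>)) \<longlonglongrightarrow> (A \<omega>, B \<omega>)" by (intro tendsto_intros SA \<omega>)
      from isCont_tendsto_compose[OF g.cont(1)[OF A_pos[OF \<omega>]] this]
      have "(\<lambda>n. g (S n \<omega>) (B \<omega>)) \<longlonglongrightarrow> g (A \<omega>) (B \<omega>)" by simp
      then show "(\<lambda>n. g (S n \<omega>) (B \<omega>) * (exp (B \<omega>) - 1 - q n * S n \<omega>)) \<longlonglongrightarrow>
          g (A \<omega>) (B \<omega>) * (exp (B \<omega>) - 1 - v / 2 * A \<omega>)"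
        by (intro tendsto_intros q SA \<omega>)
    qed
    show "AE \<omega> in M. norm (g (S n \<omega>) (B \<omega>) * (exp (B \<omega>) - 1 - q n * S n \<omega>)) \<le> (1 + K) * L" for n
    proof (rule AE_I2)
      fix \<omega>
      have "\<bar>q n * S n \<omega>\<bar> \<le> K * S n \<omega>" unfolding abs_mult using K Spos[of n \<omega>] by (intro mult_mono) auto
      then have "\<bar>exp (B \<omega>) - 1 - q n * S n \<omega>\<bar> \<le> exp (B \<omega>) + 1 + K * S n \<omega>"
        by (simp add: abs_le_iff) (use exp_gt_zero[of "B \<omega>"] in linarith)
      also have "\<dots> \<le> (1 + K) * (1 + exp (B \<omega>) + S n \<omega>)"
        using K Spos[of n \<omega>] by (simp add: algebra_simps add_nonneg_nonneg)
      finally have "\<bar>g (S n \<omega>) (B \<omega>)\<bar> * \<bar>exp (B \<omega>) - 1 - q n * S n \<omega>\<bar> \<le>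
          \<bar>g (S n \<omega>) (B \<omega>)\<bar> * ((1 + K) * (1 + exp (B \<omega>) + S n \<omega>))"
        by (intro mult_left_mono) auto
      also have "\<dots> \<le> (1 + K) * L"
        using mult_left_mono[OF g.bound[OF Spos[of n \<omega>]], of "1 + K" "B \<omega>"] K by (simp add: mult_ac)
      finally show "norm (g (S n \<omega>) (B \<omega>) * (exp (B \<omega>) - 1 - q n * S n \<omega>)) \<le> (1 + K) * L"
        by (simp add: abs_mult)
    qed
  qed (auto intro!: borel_measurable_times gm)
  have R: "(\<lambda>n. \<integral>\<omega>. R n \<omega> \<partial>M) \<longlonglongrightarrow>
      (\<integral>\<omega>. v * (A \<omega> * g2 (A \<omega>) (B \<omega>) + (A \<omega>)\<^sup>2 / 2 * g1 (A \<omega>) (B \<omega>)) \<partial>M)"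
  proof (rule integral_dominated_convergence[where w = "\<lambda>_. A0 * L * v"])
    show "AE \<omega> in M. (\<lambda>n. R n \<omega>) \<longlonglongrightarrow> v * (A \<omega> * g2 (A \<omega>) (B \<omega>) + (A \<omega>)\<^sup>2 / 2 * g1 (A \<omega>) (B \<omega>))"
    proof (rule AE_I2)
      fix \<omega> assume \<omega>: "\<omega> \<in> space M"
      have "(\<lambda>n. (\<Sum>k<Suc n. h n * exp (b n k \<omega>) *
          (g ((\<Sum>k<Suc n. h n * exp (b n k \<omega>)) + (exp (v * h n) - 1) * (\<Sum>j\<in>{k<..<Suc n}. h n * exp (b n j \<omega>))) (B \<omega> + v * h n)
            - g (\<Sum>k<Suc n. h n * exp (b n k \<omega>)) (B \<omega>))) / h n)
        \<longlonglongrightarrow> v * (A \<omega> * g2 (A \<omega>) (B \<omega>) + (A \<omega>)\<^sup>2 / 2 * g1 (A \<omega>) (B \<omega>))"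
        by (rule g.sum_of_increments_tendsto) (use h h0 v SA[OF \<omega>] sq[OF \<omega>] A_pos[OF \<omega>] in \<open>simp_all add: S_def del: sum.lessThan_Suc\<close>)
      moreover have "(\<Sum>k<Suc n. h n * exp (b n k \<omega>) * X k) / h n = (\<Sum>k<Suc n. exp (b n k \<omega>) * X k)" for n X
        unfolding sum_divide_distrib using h[of n] by (intro sum.cong) auto
      ultimately show "(\<lambda>n. R n \<omega>) \<longlonglongrightarrow> v * (A \<omega> * g2 (A \<omega>) (B \<omega>) + (A \<omega>)\<^sup>2 / 2 * g1 (A \<omega>) (B \<omega>))"
        unfolding R_def S_def C_def by (simp only:)
    qed
    show "AE \<omega> in M. norm (R n \<omega>) \<le> A0 * L * v" for n
    proof (rule AE_I2)
      fix \<omega>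
      let ?D = "\<lambda>k. g (S n \<omega> + (exp (v * h n) - 1) * C n k \<omega>) (B \<omega> + v * h n) - g (S n \<omega>) (B \<omega>)"
      \<comment> \<open>The increments of \<open>g\<close> are weighted by the terms of \<open>S\<close>, whose sum cancels the
        denominator \<open>S n \<omega>\<close>; the bound is therefore uniform in \<open>\<omega>\<close> and \<open>n\<close>.\<close>
      have D: "exp (b n k \<omega>) * \<bar>?D k\<bar> \<le> h n * exp (b n k \<omega>) * (A0 * L * v / S n \<omega>)" for k
      proof -
        have "S n \<omega> * \<bar>?D k\<bar> \<le> A0 * L * (v * h n)"
          using v h[of n] by (intro g.increment_bound Spos C) auto
        then have "\<bar>?D k\<bar> \<le> h n * (A0 * L * v / S n \<omega>)" using Spos[of n \<omega>] by (simp add: field_simps)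
        then have "exp (b n k \<omega>) * \<bar>?D k\<bar> \<le> exp (b n k \<omega>) * (h n * (A0 * L * v / S n \<omega>))"
          by (intro mult_left_mono) auto
        then show ?thesis by (simp add: mult_ac)
      qed
      have "norm (R n \<omega>) \<le> (\<Sum>k<Suc n. exp (b n k \<omega>) * \<bar>?D k\<bar>)"
        unfolding R_def real_norm_def by (rule order_trans[OF sum_abs]) (simp add: abs_mult)
      also have "\<dots> \<le> (\<Sum>k<Suc n. h n * exp (b n k \<omega>) * (A0 * L * v / S n \<omega>))"
        by (intro sum_mono D)
      also have "\<dots> = S n \<omega> * (A0 * L * v / S n \<omega>)" unfolding S_def by (rule sum_distrib_right[symmetric])
      also have "\<dots> = A0 * L * v" using Spos[of n \<omega>] by simp
      finally show "norm (R n \<omega>) \<le> A0 * L * v" .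
    qed
  qed (auto simp: R_def intro!: borel_measurable_times borel_measurable_divide borel_measurable_add borel_measurable_sum borel_measurable_diff gm)
  have Bn: "B \<omega> = \<xi> (s + real (Suc n) * h n) \<omega> - \<xi> s \<omega>" for n \<omega>
    by (simp add: B_def h_def del: of_nat_Suc)
  have "(\<integral>\<omega>. g (S n \<omega>) (B \<omega>) * (exp (B \<omega>) - 1 - q n * S n \<omega>) \<partial>M) = exp (v * h n / 2) * (\<integral>\<omega>. R n \<omega> \<partial>M)" for n
    using discrete_integration_by_parts[OF v h[of n] zero_less_Suc[of n] assms, of s]
    unfolding R_def q_def S_def C_def Bn[of _ n] b_def .
  then have "(\<lambda>n. exp (v * h n / 2) * (\<integral>\<omega>. R n \<omega> \<partial>M)) \<longlonglongrightarrow>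
      (\<integral>\<omega>. g (A \<omega>) (B \<omega>) * (exp (B \<omega>) - 1 - v / 2 * A \<omega>) \<partial>M)"
    using lhs by simp
  moreover have "(\<lambda>n. exp (v * h n / 2) * (\<integral>\<omega>. R n \<omega> \<partial>M)) \<longlonglongrightarrow>
      exp (v * 0 / 2) * (\<integral>\<omega>. v * (A \<omega> * g2 (A \<omega>) (B \<omega>) + (A \<omega>)\<^sup>2 / 2 * g1 (A \<omega>) (B \<omega>)) \<partial>M)"
    by (intro tendsto_intros R h0) auto
  ultimately show ?thesis by (simp add: LIMSEQ_unique)
qed

end

section \<open>Moebius-invariant test functions\<close>

text \<open>The displacement by the exponential integral leaves \<open>u = exp (b / 2) / A\<close> fixed. With the factor
  \<open>1 / A\<close> in \<open>g\<close> the variable \<open>b\<close> moves at unit speed, and \<open>W\<close>, which is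
  \<open>exp (a * u * cosh (b / 2))\<close>, cancels the divergence when \<open>a = 4 / v\<close>. A function \<open>k\<close> with
  compact support in the open half-line makes all supports compact, as \<open>u\<close> and \<open>b\<close> determine \<open>A\<close>.\<close>

lemma conformal_test_function:
  fixes \<psi> \<psi>' k k' :: "real \<Rightarrow> real" and a L r0 r1 :: real
  defines "W \<equiv> \<lambda>A b. exp (a / 2 * ((1 + exp b) / A))" and "u \<equiv> \<lambda>A b. exp (b / 2) / A"
  defines "g \<equiv> \<lambda>A b. \<psi> b * (W A b * k (u A b)) / A"
  defines "g1 \<equiv> \<lambda>A b. - g A b / A - a / 2 * (1 + exp b) / A\<^sup>2 * g A b - \<psi> b * W A b * k' (u A b) * u A b / A\<^sup>2"
    and "g2 \<equiv> \<lambda>A b. \<psi>' b * (W A b * k (u A b)) / A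
      + \<psi> b * (W A b * (a / 2 * (exp b / A)) * k (u A b) + W A b * k' (u A b) * (u A b / 2)) / A"
  assumes \<psi>: "\<And>b. (\<psi> has_real_derivative \<psi>' b) (at b)" "continuous_on UNIV \<psi>'"
      "\<And>b. L < \<bar>b\<bar> \<Longrightarrow> \<psi> b = 0 \<and> \<psi>' b = 0"
    and k: "\<And>r. 0 < r \<Longrightarrow> (k has_real_derivative k' r) (at r)" "continuous_on {0<..} k'"
      "\<And>r. 0 < r \<Longrightarrow> r < r0 \<or> r1 < r \<Longrightarrow> k r = 0 \<and> k' r = 0" "0 < r0" "0 < r1"
      "k \<in> borel_measurable borel" "k' \<in> borel_measurable borel"
  shows "\<exists>A0 K. test_function g g1 g2 A0 K"
    and "\<And>\<phi>. continuous_on UNIV \<phi> \<Longrightarrow> (\<And>b. L < \<bar>b\<bar> \<Longrightarrow> \<phi> b = 0) \<Longrightarrow>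
      \<exists>K. \<forall>A>0. \<forall>b. \<bar>\<phi> b * (W A b * k (u A b))\<bar> \<le> K"
proof -
  have [measurable]: "k \<in> borel_measurable borel" "k' \<in> borel_measurable borel" by fact+
  have \<psi>c: "continuous_on UNIV \<psi>" using \<psi>(1) by (meson DERIV_isCont continuous_at_imp_continuous_on)
  have [measurable]: "\<psi> \<in> borel_measurable borel" "\<psi>' \<in> borel_measurable borel"
    using \<psi>c \<psi>(2) by (auto intro: borel_measurable_continuous_onI)
  have kc: "continuous_on {0<..} k" using k(1) by (meson DERIV_isCont continuous_at_imp_continuous_on greaterThan_iff)
  let ?H = "{0::real<..} \<times> (UNIV :: real set)"
  have u: "u A b > 0" if "A > 0" for A b using that by (simp add: u_def)
  have uc: "continuous_on ?H (\<lambda>p. u (fst p) (snd p))"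
    unfolding u_def by (auto intro!: continuous_intros)
  have Wc: "continuous_on ?H (\<lambda>p. W (fst p) (snd p))"
    unfolding W_def by (auto intro!: continuous_intros)
  have kuc: "continuous_on ?H (\<lambda>p. k (u (fst p) (snd p)))" "continuous_on ?H (\<lambda>p. k' (u (fst p) (snd p)))"
    using u by (auto intro!: continuous_on_compose2[OF kc uc] continuous_on_compose2[OF k(2) uc])
  have \<psi>sc: "continuous_on ?H (\<lambda>p. \<psi> (snd p))" "continuous_on ?H (\<lambda>p. \<psi>' (snd p))"
    by (auto intro!: continuous_on_compose2[OF \<psi>c] continuous_on_compose2[OF \<psi>(2)] continuous_intros)
  have gc: "continuous_on ?H (\<lambda>p. g (fst p) (snd p))"
    unfolding g_def by (intro continuous_on_mult continuous_on_divide Wc kuc \<psi>sc continuous_intros) auto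
  have g1c: "continuous_on ?H (\<lambda>p. g1 (fst p) (snd p))"
    unfolding g1_def
    by (intro continuous_on_mult continuous_on_divide continuous_on_diff continuous_on_minus Wc kuc \<psi>sc gc uc continuous_intros) auto
  have g2c: "continuous_on ?H (\<lambda>p. g2 (fst p) (snd p))"
    unfolding g2_def
    by (intro continuous_on_mult continuous_on_divide continuous_on_add Wc kuc \<psi>sc gc uc continuous_intros) auto
  define \<alpha> \<beta> where "\<alpha> = exp (- \<bar>L\<bar> / 2) / r1" and "\<beta> = exp (\<bar>L\<bar> / 2) / r0"
  have \<alpha>\<beta>: "\<alpha> > 0" "\<beta> > 0" using k by (auto simp: \<alpha>_def \<beta>_def)
  let ?K = "{\<alpha>..\<beta>} \<times> {-\<bar>L\<bar>..\<bar>L\<bar>}"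
  have out: "L < \<bar>b\<bar> \<or> (k (u A b) = 0 \<and> k' (u A b) = 0)" if A: "A > 0" and n: "(A, b) \<notin> ?K" for A b
  proof (cases "\<bar>b\<bar> \<le> \<bar>L\<bar>")
    case False
    then have "L < \<bar>b\<bar>" by linarith
    then show ?thesis by simp
  next
    case True
    then have "A < \<alpha> \<or> \<beta> < A" using n by auto
    moreover have "r1 < u A b" if "A < \<alpha>"
    proof -
      have "r1 * A < exp (- \<bar>L\<bar> / 2)" using that k by (simp add: \<alpha>_def field_simps)
      also have "\<dots> \<le> exp (b / 2)" using True by simp
      finally show ?thesis using A by (simp add: u_def field_simps)
    qed
    moreover have "u A b < r0" if "\<beta> < A"
    proof -
      have "exp (b / 2) \<le> exp (\<bar>L\<bar> / 2)" using True by simp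
      also have "\<dots> < r0 * A" using that k by (simp add: \<beta>_def field_simps)
      finally show ?thesis using A by (simp add: u_def field_simps)
    qed
    ultimately show ?thesis using k(3)[OF u[OF A]] by blast
  qed
  have bdd: "\<exists>K. \<forall>A>0. \<forall>b. \<bar>f A b\<bar> \<le> K"
    if f: "continuous_on ?H (\<lambda>p. f (fst p) (snd p))" and z: "\<And>A b. A > 0 \<Longrightarrow> (A, b) \<notin> ?K \<Longrightarrow> f A b = 0"
    for f :: "real \<Rightarrow> real \<Rightarrow> real"
  proof -
    have "compact ((\<lambda>p. f (fst p) (snd p)) ` ?K)"
      using \<alpha>\<beta> by (intro compact_continuous_image continuous_on_subset[OF f] compact_Times) auto
    then obtain K where K: "\<And>p. p \<in> ?K \<Longrightarrow> \<bar>f (fst p) (snd p)\<bar> \<le> K"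
      by (force dest!: compact_imp_bounded simp: bounded_iff)
    have "\<bar>f A b\<bar> \<le> \<bar>K\<bar>" if "A > 0" for A b
      using K[of "(A, b)"] z[OF that, of b] by (cases "(A, b) \<in> ?K") auto
    then show ?thesis by blast
  qed
  have z: "A > 0 \<Longrightarrow> (A, b) \<notin> ?K \<Longrightarrow> g A b = 0 \<and> g1 A b = 0 \<and> g2 A b = 0" for A b
    using out[of A b] \<psi>(3)[of b] by (auto simp: g1_def g2_def g_def)
  obtain K0 where K0: "\<And>A b. A > 0 \<Longrightarrow> \<bar>g A b\<bar> \<le> K0" using bdd[OF gc] z by blast
  obtain K1 where K1: "\<And>A b. A > 0 \<Longrightarrow> \<bar>g1 A b\<bar> \<le> K1" using bdd[OF g1c] z by blast
  obtain K2 where K2: "\<And>A b. A > 0 \<Longrightarrow> \<bar>g2 A b\<bar> \<le> K2" using bdd[OF g2c] z by blast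
  have Kpos: "0 \<le> K0" "0 \<le> K1" "0 \<le> K2"
    using K0[of 1] K1[of 1] K2[of 1] by (force intro: order_trans[OF abs_ge_zero])+
  define K where "K = K0 * (1 + exp \<bar>L\<bar> + \<beta>) + K2 + \<beta> * K1"
  have nn: "0 \<le> K0 * (1 + exp \<bar>L\<bar> + \<beta>)" "0 \<le> \<beta> * K1" using Kpos \<alpha>\<beta> by (auto intro!: mult_nonneg_nonneg add_nonneg_nonneg)
  have "test_function g g1 g2 (\<beta> + 1) K"
  proof
    fix A x C b :: real
    define X where "X = A + (exp x - 1) * C"
    define c where "c = exp x * C"
    assume "0 < A + (exp x - 1) * C"
    then have X: "X > 0" by (simp add: X_def)
    have dX: "((\<lambda>x. A + (exp x - 1) * C) has_real_derivative c) (at x)"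
      by (auto intro!: derivative_eq_intros simp: c_def)
    have d\<psi>: "((\<lambda>x. \<psi> (b + x)) has_real_derivative \<psi>' (b + x) * 1) (at x)"
      by (rule DERIV_chain2[OF \<psi>(1)]) (auto intro!: derivative_eq_intros)
    have du: "((\<lambda>x. u (A + (exp x - 1) * C) (b + x)) has_real_derivative u X (b + x) * (1 / 2 - c / X)) (at x)"
    proof -
      have "((\<lambda>x. exp ((b + x) / 2)) has_real_derivative exp ((b + x) / 2) * (1 / 2)) (at x)"
        by (auto intro!: derivative_eq_intros)
      from DERIV_divide[OF this dX] X
      have "((\<lambda>x. u (A + (exp x - 1) * C) (b + x)) has_real_derivative
          (exp ((b + x) / 2) * (1 / 2) * X - exp ((b + x) / 2) * c) / (X * X)) (at x)"
        unfolding u_def X_def[symmetric] by simp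
      moreover have "(exp ((b + x) / 2) * (1 / 2) * X - exp ((b + x) / 2) * c) / (X * X) =
          u X (b + x) * (1 / 2 - c / X)"
        unfolding u_def using X by (simp add: field_simps)
      ultimately show ?thesis by simp
    qed
    have dk: "((\<lambda>x. k (u (A + (exp x - 1) * C) (b + x))) has_real_derivative
        k' (u X (b + x)) * (u X (b + x) * (1 / 2 - c / X))) (at x)"
      unfolding X_def by (rule DERIV_chain2[OF k(1) du[unfolded X_def]]) (use X in \<open>auto simp: X_def intro: u\<close>)
    have dW: "((\<lambda>x. W (A + (exp x - 1) * C) (b + x)) has_real_derivative
        W X (b + x) * (a / 2 * (exp (b + x) / X - (1 + exp (b + x)) * c / X\<^sup>2))) (at x)"
    proof -
      have "((\<lambda>x. 1 + exp (b + x)) has_real_derivative exp (b + x)) (at x)"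
        by (auto intro!: derivative_eq_intros)
      from DERIV_divide[OF this dX] X
      have "((\<lambda>x. (1 + exp (b + x)) / (A + (exp x - 1) * C)) has_real_derivative
          (exp (b + x) * X - (1 + exp (b + x)) * c) / (X * X)) (at x)"
        unfolding X_def[symmetric] by simp
      from DERIV_cmult[OF this, of "a / 2"]
      have "((\<lambda>x. W (A + (exp x - 1) * C) (b + x)) has_real_derivative
          W X (b + x) * (a / 2 * ((exp (b + x) * X - (1 + exp (b + x)) * c) / (X * X)))) (at x)"
        unfolding W_def X_def by (rule DERIV_fun_exp)
      moreover have "(exp (b + x) * X - (1 + exp (b + x)) * c) / (X * X) =
          exp (b + x) / X - (1 + exp (b + x)) * c / X\<^sup>2"
        using X by (simp add: field_simps power2_eq_square)
      ultimately show ?thesis by simp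
    qed
    have "((\<lambda>x. g (A + (exp x - 1) * C) (b + x)) has_real_derivative
        ((\<psi>' (b + x) * 1 * (W X (b + x) * k (u X (b + x)))
          + (W X (b + x) * (a / 2 * (exp (b + x) / X - (1 + exp (b + x)) * c / X\<^sup>2)) * k (u X (b + x))
            + k' (u X (b + x)) * (u X (b + x) * (1 / 2 - c / X)) * W X (b + x)) * \<psi> (b + x)) * X
          - \<psi> (b + x) * (W X (b + x) * k (u X (b + x))) * c) / (X * X)) (at x)"
      using DERIV_divide[OF DERIV_mult[OF d\<psi> DERIV_mult[OF dW dk]] dX] X
      unfolding g_def X_def[symmetric] by simp
    moreover have "((\<psi>' (b + x) * 1 * (W X (b + x) * k (u X (b + x)))
          + (W X (b + x) * (a / 2 * (exp (b + x) / X - (1 + exp (b + x)) * c / X\<^sup>2)) * k (u X (b + x))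
            + k' (u X (b + x)) * (u X (b + x) * (1 / 2 - c / X)) * W X (b + x)) * \<psi> (b + x)) * X
          - \<psi> (b + x) * (W X (b + x) * k (u X (b + x))) * c) / (X * X)
        = g2 X (b + x) + c * g1 X (b + x)"
      unfolding g2_def g1_def g_def using X by (simp add: field_simps power2_eq_square)
    ultimately show "((\<lambda>x. g (A + (exp x - 1) * C) (b + x)) has_real_derivative
        g2 (A + (exp x - 1) * C) (b + x) + exp x * C * g1 (A + (exp x - 1) * C) (b + x)) (at x)"
      by (simp add: X_def c_def)
  next
    fix A b :: real assume A: "0 < A"
    have op: "open ?H" by (intro open_Times) auto
    show "isCont (\<lambda>p. g (fst p) (snd p)) (A, b)" "isCont (\<lambda>p. g1 (fst p) (snd p)) (A, b)"
        "isCont (\<lambda>p. g2 (fst p) (snd p)) (A, b)"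
      using gc g1c g2c A by (auto simp: continuous_on_eq_continuous_at[OF op])
    show "\<bar>g A b\<bar> * (1 + exp b + A) \<le> K"
    proof (cases "(A, b) \<in> ?K")
      case True
      then have "\<bar>g A b\<bar> * (1 + exp b + A) \<le> K0 * (1 + exp \<bar>L\<bar> + \<beta>)"
        using K0[OF A, of b] A Kpos by (intro mult_mono add_mono) (auto simp: add_nonneg_nonneg)
      then show ?thesis using Kpos nn by (simp add: K_def)
    qed (use z[OF A, of b] Kpos nn in \<open>auto simp: K_def\<close>)
    show "\<bar>g2 A b\<bar> + A * \<bar>g1 A b\<bar> \<le> K"
    proof (cases "(A, b) \<in> ?K")
      case True
      then have "A * \<bar>g1 A b\<bar> \<le> \<beta> * K1" using K1[OF A, of b] A by (intro mult_mono) auto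
      then show ?thesis using K2[OF A, of b] Kpos nn by (simp add: K_def)
    qed (use z[OF A, of b] Kpos nn in \<open>auto simp: K_def\<close>)
  next
    fix A b :: real assume "\<beta> + 1 \<le> A"
    then show "g A b = 0" using z[of A b] \<alpha>\<beta> by auto
  next
    show "(\<lambda>p. g (fst p) (snd p)) \<in> borel_measurable (borel \<Otimes>\<^sub>M borel)"
      unfolding g_def W_def u_def by measurable
    show "(\<lambda>p. g1 (fst p) (snd p)) \<in> borel_measurable (borel \<Otimes>\<^sub>M borel)"
      unfolding g1_def g_def W_def u_def by measurable
    show "(\<lambda>p. g2 (fst p) (snd p)) \<in> borel_measurable (borel \<Otimes>\<^sub>M borel)"
      unfolding g2_def g_def W_def u_def by measurable
    show "\<beta> + 1 > 0" using \<alpha>\<beta> by simp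
  qed
  then show "\<exists>A0 K. test_function g g1 g2 A0 K" by blast
  fix \<phi> :: "real \<Rightarrow> real"
  assume \<phi>: "continuous_on UNIV \<phi>" "\<And>b. L < \<bar>b\<bar> \<Longrightarrow> \<phi> b = 0"
  have "continuous_on ?H (\<lambda>p. \<phi> (snd p))"
    by (rule continuous_on_compose2[OF \<phi>(1)]) (auto intro!: continuous_intros)
  then have pc: "continuous_on ?H (\<lambda>p. \<phi> (snd p) * (W (fst p) (snd p) * k (u (fst p) (snd p))))"
    by (intro continuous_on_mult Wc kuc)
  show "\<exists>K. \<forall>A>0. \<forall>b. \<bar>\<phi> b * (W A b * k (u A b))\<bar> \<le> K"
    by (rule bdd[OF pc]) (use out \<phi>(2) in fastforce)
qed

section \<open>Translation invariance of the tilted increment\<close>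

lemma has_real_derivative_half_square_positive_part:
  "((\<lambda>x. (max 0 x)\<^sup>2 / 2) has_real_derivative max 0 x) (at (x::real))"
proof -
  consider "x > 0" | "x < 0" | "x = 0" by linarith
  then show ?thesis
  proof cases
    case 1
    have "((\<lambda>x. x\<^sup>2 / 2) has_real_derivative max 0 x) (at x)"
      using 1 by (auto intro!: derivative_eq_intros)
    then show ?thesis
      by (rule DERIV_cong_ev[THEN iffD1, rotated -1, OF _ refl _ refl])
        (use 1 in \<open>auto intro!: eventually_mono[OF order_tendstoD(1)[OF tendsto_ident_at 1]] simp: eventually_nhds intro: exI[of _ "{0<..}"]\<close>)
  next
    case 2
    have "((\<lambda>x. 0) has_real_derivative max 0 x) (at x)" using 2 by auto
    then show ?thesis
      by (rule DERIV_cong_ev[THEN iffD1, rotated -1, OF _ refl _ refl])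
        (use 2 in \<open>auto simp: eventually_nhds intro: exI[of _ "{..<0}"]\<close>)
  next
    case 3
    have "((\<lambda>h. ((max 0 (0 + h))\<^sup>2 / 2 - (max 0 0)\<^sup>2 / 2) / h) \<longlongrightarrow> 0) (at (0::real))"
    proof (rule Lim_null_comparison)
      show "\<forall>\<^sub>F h in at (0::real). norm (((max 0 (0 + h))\<^sup>2 / 2 - (max 0 0)\<^sup>2 / 2) / h) \<le> \<bar>h\<bar>"
        by (auto simp: max_def power2_eq_square abs_mult intro!: always_eventually)
      show "((\<lambda>h::real. \<bar>h\<bar>) \<longlongrightarrow> 0) (at 0)" by (rule tendsto_rabs_zero) (rule tendsto_ident_at)
    qed
    then show ?thesis using 3 by (simp add: DERIV_def)
  qed
qed

text \<open>Smoothed indicators of \<open>(0, d)\<close>, increasing as \<open>e\<close> decreases to \<open>0\<close>.\<close>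

definition trapezoid :: "real \<Rightarrow> real \<Rightarrow> real \<Rightarrow> real" where
  "trapezoid e d x = max 0 (min 1 (min x (d - x) / e))"

text \<open>The trapezoid is a combination of four positive parts. For \<open>x \<ge> d\<close> the primitive is constant, so
  that the difference of two translates has compact support.\<close>

lemma trapezoid_primitive:
  assumes e: "e > 0" "2 * e \<le> d"
  obtains P where "\<And>x. (P has_real_derivative trapezoid e d x) (at x)"
    "\<And>x. x \<le> 0 \<Longrightarrow> P x = 0" "\<And>x. d \<le> x \<Longrightarrow> P x = d - e"
proof
  define p where "p x = (max 0 x)\<^sup>2 / 2" for x :: real
  let ?P = "\<lambda>x. (p x - p (x - e) - p (x - (d - e)) + p (x - d)) / e"
  have p: "((\<lambda>x. p (x - c)) has_real_derivative max 0 (x - c)) (at x)" for x c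
  proof -
    have "((\<lambda>x. x - c) has_real_derivative 1) (at x)" by (auto intro!: derivative_eq_intros)
    from DERIV_chain2[OF has_real_derivative_half_square_positive_part this] show ?thesis by (simp add: p_def)
  qed
  show "(?P has_real_derivative trapezoid e d x) (at x)" for x
  proof -
    have "(?P has_real_derivative (max 0 (x - 0) - max 0 (x - e) - max 0 (x - (d - e)) + max 0 (x - d)) / e) (at x)"
      using p[of 0] by (intro DERIV_cdivide DERIV_add DERIV_diff p) simp
    moreover have "(max 0 (x - 0) - max 0 (x - e) - max 0 (x - (d - e)) + max 0 (x - d)) / e = trapezoid e d x"
      using e unfolding trapezoid_def by (auto simp: max_def min_def field_simps)
    ultimately show ?thesis by simp
  qed
  show "?P x = 0" if "x \<le> 0" for x using that e by (simp add: p_def)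
  show "?P x = d - e" if "d \<le> x" for x
  proof -
    have "?P x = (x\<^sup>2 / 2 - (x - e)\<^sup>2 / 2 - (x - (d - e))\<^sup>2 / 2 + (x - d)\<^sup>2 / 2) / e"
      using that e by (simp add: p_def)
    also have "x\<^sup>2 / 2 - (x - e)\<^sup>2 / 2 - (x - (d - e))\<^sup>2 / 2 + (x - d)\<^sup>2 / 2 = e * (d - e)"
      by (simp add: power2_eq_square field_simps)
    finally show ?thesis using e by simp
  qed
qed

lemma trapezoid_outside: "x \<le> 0 \<or> d \<le> x \<Longrightarrow> e > 0 \<Longrightarrow> trapezoid e d x = 0"
  by (auto simp: trapezoid_def max_def min_def field_simps)

lemma trapezoid_antimono:
  assumes "0 < e'" "e' \<le> e"
  shows "trapezoid e d x \<le> trapezoid e' d x"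
proof (cases "min x (d - x) \<le> 0")
  case True
  then have "min x (d - x) / e \<le> 0" using assms by (simp add: divide_nonpos_pos)
  then show ?thesis by (simp add: trapezoid_def)
next
  case False
  then have "min x (d - x) / e \<le> min x (d - x) / e'" using assms by (intro divide_left_mono) auto
  then show ?thesis unfolding trapezoid_def by (intro max.mono min.mono) auto
qed

lemma trapezoid_tendsto_indicator:
  assumes "\<And>n. e n > 0" "e \<longlonglongrightarrow> 0"
  shows "(\<lambda>n. trapezoid (e n) d x) \<longlonglongrightarrow> indicator {0<..<d} x"
proof (cases "0 < x \<and> x < d")
  case True
  then have "min x (d - x) > 0" by auto
  then have "\<forall>\<^sub>F n in sequentially. e n < min x (d - x)" by (rule order_tendstoD(2)[OF assms(2)])
  then have "\<forall>\<^sub>F n in sequentially. trapezoid (e n) d x = 1"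
  proof eventually_elim
    case (elim n)
    then have "1 \<le> min x (d - x) / e n" using assms(1)[of n] by (simp add: pos_le_divide_eq)
    then show ?case by (simp add: trapezoid_def)
  qed
  then show ?thesis using True by (simp add: tendsto_eventually)
next
  case False
  then show ?thesis using assms(1) by (auto simp: trapezoid_outside not_less)
qed

context brownian_segment
begin

abbreviation a :: real where "a \<equiv> 4 / v"

text \<open>The infinitesimal form of the invariance: tilted by
  \<open>exp (a * Ob * cosh (B / 2))\<close>, the increment \<open>B\<close> is uniformly distributed for fixed \<open>Ob\<close>.\<close>

lemma weighted_integral_of_derivative_eq_0:
  fixes \<psi> \<psi>' k k' :: "real \<Rightarrow> real"
  assumes \<psi>: "\<And>b. (\<psi> has_real_derivative \<psi>' b) (at b)" "continuous_on UNIV \<psi>'"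
      "\<And>b. L < \<bar>b\<bar> \<Longrightarrow> \<psi> b = 0 \<and> \<psi>' b = 0"
    and k: "\<And>r. 0 < r \<Longrightarrow> (k has_real_derivative k' r) (at r)" "continuous_on {0<..} k'"
      "\<And>r. 0 < r \<Longrightarrow> r < r0 \<or> r1 < r \<Longrightarrow> k r = 0 \<and> k' r = 0" "0 < r0" "0 < r1"
      "k \<in> borel_measurable borel" "k' \<in> borel_measurable borel"
  shows "(\<integral>\<omega>. \<psi>' (B \<omega>) * (exp (a * Ob \<omega> * cosh (B \<omega> / 2)) * k (Ob \<omega>)) \<partial>M) = 0"
    and "continuous_on UNIV \<phi> \<Longrightarrow> (\<And>b. L < \<bar>b\<bar> \<Longrightarrow> \<phi> b = 0) \<Longrightarrow>
      integrable M (\<lambda>\<omega>. \<phi> (B \<omega>) * (exp (a * Ob \<omega> * cosh (B \<omega> / 2)) * k (Ob \<omega>)))"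
proof -
  have [measurable]: "k \<in> borel_measurable borel" by fact
  define W where "W A b = exp (a / 2 * ((1 + exp b) / A))" for A b :: real
  define u where "u A b = exp (b / 2) / A" for A b :: real
  define g where "g A b = \<psi> b * (W A b * k (u A b)) / A" for A b
  define g1 where "g1 A b = - g A b / A - a / 2 * (1 + exp b) / A\<^sup>2 * g A b - \<psi> b * W A b * k' (u A b) * u A b / A\<^sup>2" for A b
  define g2 where "g2 A b = \<psi>' b * (W A b * k (u A b)) / A
      + \<psi> b * (W A b * (a / 2 * (exp b / A)) * k (u A b) + W A b * k' (u A b) * (u A b / 2)) / A" for A b
  have W: "exp (a * Ob \<omega> * cosh (B \<omega> / 2)) = W (A \<omega>) (B \<omega>)" for \<omega>
  proof -
    have "exp (B \<omega> / 2) * cosh (B \<omega> / 2) = (1 + exp (B \<omega>)) / 2"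
      by (simp add: cosh_field_def field_simps mult_exp_exp)
    then have "a * Ob \<omega> * cosh (B \<omega> / 2) = a * ((1 + exp (B \<omega>)) / 2) / A \<omega>"
      unfolding Ob_def by (metis (no_types, lifting) mult.assoc times_divide_eq_left times_divide_eq_right)
    moreover have "c * (E / 2) / X = c / 2 * (E / X)" for c E X :: real by simp
    ultimately show ?thesis unfolding W_def by (simp only:)
  qed
  have u: "Ob \<omega> = u (A \<omega>) (B \<omega>)" for \<omega> by (simp add: Ob_def u_def)
  have int: "integrable M (\<lambda>\<omega>. \<phi> (B \<omega>) * (W (A \<omega>) (B \<omega>) * k (u (A \<omega>) (B \<omega>))))"
    if \<phi>: "continuous_on UNIV \<phi>" "\<And>b. L < \<bar>b\<bar> \<Longrightarrow> \<phi> b = 0" for \<phi>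
  proof -
    obtain K where "\<forall>A>0. \<forall>b. \<bar>\<phi> b * (W A b * k (u A b))\<bar> \<le> K"
      using conformal_test_function(2)[where a = "4 / v", OF \<psi> k \<phi>, folded W_def u_def] by blast
    moreover have [measurable]: "\<phi> \<in> borel_measurable borel"
      using \<phi>(1) by (rule borel_measurable_continuous_onI)
    ultimately show ?thesis
      by (intro integrable_const_bound[of _ K]) (auto simp: W_def u_def A_pos)
  qed
  then show "integrable M (\<lambda>\<omega>. \<phi> (B \<omega>) * (exp (a * Ob \<omega> * cosh (B \<omega> / 2)) * k (Ob \<omega>)))"
    if "continuous_on UNIV \<phi>" "\<And>b. L < \<bar>b\<bar> \<Longrightarrow> \<phi> b = 0" for \<phi>
    using that unfolding W u[symmetric] by (simp add: u)
  obtain A0 K where tf: "test_function g g1 g2 A0 K"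
    using conformal_test_function(1)[where a = "4 / v", OF \<psi> k, folded W_def u_def, folded g_def, folded g1_def g2_def] by blast
  interpret test_function g g1 g2 A0 K by (rule tf)
  let ?I = "\<lambda>\<omega>. g (A \<omega>) (B \<omega>) * (exp (B \<omega>) - 1 - v / 2 * A \<omega>)"
  let ?J = "\<lambda>\<omega>. \<psi>' (B \<omega>) * (W (A \<omega>) (B \<omega>) * k (u (A \<omega>) (B \<omega>)))"
  have J: "integrable M ?J" using int[OF \<psi>(2)] \<psi>(3) by blast
  have [measurable]: "(\<lambda>\<omega>. g (A \<omega>) (B \<omega>)) \<in> borel_measurable M"
    using measurable_compose[OF measurable_Pair[OF A_measurable B_measurable] meas(1)] by simp
  have I: "integrable M ?I"
  proof (rule integrable_const_bound[of _ "(1 + v / 2) * K"])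
    show "AE \<omega> in M. norm (?I \<omega>) \<le> (1 + v / 2) * K"
    proof (rule AE_I2)
      fix \<omega> assume \<omega>: "\<omega> \<in> space M"
      have "\<bar>exp (B \<omega>) - 1 - v / 2 * A \<omega>\<bar> \<le> exp (B \<omega>) + 1 + v / 2 * A \<omega>"
        using A_pos[OF \<omega>] v by (simp add: abs_le_iff)
      also have "\<dots> \<le> (1 + v / 2) * (1 + exp (B \<omega>) + A \<omega>)"
        using A_pos[OF \<omega>] v by (simp add: algebra_simps)
      finally have "norm (?I \<omega>) \<le> \<bar>g (A \<omega>) (B \<omega>)\<bar> * ((1 + v / 2) * (1 + exp (B \<omega>) + A \<omega>))"
        unfolding real_norm_def abs_mult by (intro mult_left_mono) auto
      also have "\<dots> \<le> (1 + v / 2) * K"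
        using mult_left_mono[OF bound[OF A_pos[OF \<omega>], of "B \<omega>"], of "1 + v / 2"] v by (simp add: mult_ac)
      finally show "norm (?I \<omega>) \<le> (1 + v / 2) * K" .
    qed
  qed measurable
  have "v * (A \<omega> * g2 (A \<omega>) (B \<omega>) + (A \<omega>)\<^sup>2 / 2 * g1 (A \<omega>) (B \<omega>)) = ?I \<omega> + v * ?J \<omega>" if \<omega>: "\<omega> \<in> space M" for \<omega>
    unfolding g1_def g2_def g_def using A_pos[OF \<omega>] v by (simp add: field_simps power2_eq_square)
  then have "(\<integral>\<omega>. ?I \<omega> \<partial>M) = (\<integral>\<omega>. ?I \<omega> + v * ?J \<omega> \<partial>M)"
    unfolding integration_by_parts[OF tf] by (intro Bochner_Integration.integral_cong) auto
  also have "\<dots> = (\<integral>\<omega>. ?I \<omega> \<partial>M) + v * (\<integral>\<omega>. ?J \<omega> \<partial>M)" using I J by simp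
  finally show "(\<integral>\<omega>. \<psi>' (B \<omega>) * (exp (a * Ob \<omega> * cosh (B \<omega> / 2)) * k (Ob \<omega>)) \<partial>M) = 0"
    using v unfolding W u[symmetric] by (simp add: u)
qed

text \<open>Apply the preceding lemma to the difference of two translates of a primitive of the trapezoid.\<close>

lemma trapezoid_average_translation_invariant:
  assumes e: "e > 0" "2 * e \<le> d"
    and k: "\<And>r. 0 < r \<Longrightarrow> (k has_real_derivative k' r) (at r)" "continuous_on {0<..} k'"
      "\<And>r. 0 < r \<Longrightarrow> r < r0 \<or> r1 < r \<Longrightarrow> k r = 0 \<and> k' r = 0" "0 < r0" "0 < r1"
      "k \<in> borel_measurable borel" "k' \<in> borel_measurable borel" and k0: "\<And>r. k r \<ge> 0"
  shows "(\<integral>\<^sup>+ \<omega>. ennreal (trapezoid e d (B \<omega> - x) * (exp (a * Ob \<omega> * cosh (B \<omega> / 2)) * k (Ob \<omega>))) \<partial>M) =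
    (\<integral>\<^sup>+ \<omega>. ennreal (trapezoid e d (B \<omega> - y) * (exp (a * Ob \<omega> * cosh (B \<omega> / 2)) * k (Ob \<omega>))) \<partial>M)"
proof -
  obtain P where P: "\<And>x. (P has_real_derivative trapezoid e d x) (at x)"
    "\<And>x. x \<le> 0 \<Longrightarrow> P x = 0" "\<And>x. d \<le> x \<Longrightarrow> P x = d - e"
    using trapezoid_primitive[OF e] by blast
  define L where "L = \<bar>x\<bar> + \<bar>y\<bar> + d"
  define w where "w \<omega> = exp (a * Ob \<omega> * cosh (B \<omega> / 2)) * k (Ob \<omega>)" for \<omega>
  have tc: "continuous_on UNIV (\<lambda>b. trapezoid e d (b - z))" for z
    unfolding trapezoid_def using e by (intro continuous_intros) auto
  have tz: "trapezoid e d (b - z) = 0" if "L < \<bar>b\<bar>" "z = x \<or> z = y" for b z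
    using that e by (intro trapezoid_outside) (auto simp: L_def)
  have dP: "((\<lambda>b. P (b - z)) has_real_derivative trapezoid e d (b - z)) (at b)" for b z
  proof -
    have "((\<lambda>b. b - z) has_real_derivative 1) (at b)" by (auto intro!: derivative_eq_intros)
    from DERIV_chain2[OF P(1) this] show ?thesis by simp
  qed
  let ?\<psi> = "\<lambda>b. P (b - x) - P (b - y)"
  let ?\<psi>' = "\<lambda>b. trapezoid e d (b - x) - trapezoid e d (b - y)"
  have d: "\<And>b. (?\<psi> has_real_derivative ?\<psi>' b) (at b)" by (intro DERIV_diff dP)
  have c: "continuous_on UNIV ?\<psi>'" by (intro continuous_on_diff tc)
  have z: "?\<psi> b = 0 \<and> ?\<psi>' b = 0" if "L < \<bar>b\<bar>" for b
  proof -
    have "?\<psi> b = 0"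
    proof (cases "b > 0")
      case True
      then show ?thesis using that e P(3)[of "b - x"] P(3)[of "b - y"] by (simp add: L_def)
    next
      case False
      then show ?thesis using that e P(2)[of "b - x"] P(2)[of "b - y"] by (simp add: L_def)
    qed
    then show ?thesis using tz[OF that] by simp
  qed
  note zero = weighted_integral_of_derivative_eq_0(1)[OF d c z k, folded w_def]
  have int: "integrable M (\<lambda>\<omega>. trapezoid e d (B \<omega> - q) * w \<omega>)" if "q = x \<or> q = y" for q
    unfolding w_def by (rule weighted_integral_of_derivative_eq_0(2)[OF d c z k tc]) (use tz that in auto)
  have "(\<integral>\<omega>. trapezoid e d (B \<omega> - x) * w \<omega> \<partial>M) = (\<integral>\<omega>. trapezoid e d (B \<omega> - y) * w \<omega> \<partial>M)"
    using zero int by (simp add: left_diff_distrib Bochner_Integration.integral_diff)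
  moreover have "w \<omega> \<ge> 0" for \<omega> using k0 by (simp add: w_def)
  moreover have "trapezoid e d q \<ge> 0" for q by (simp add: trapezoid_def)
  ultimately show ?thesis
    unfolding w_def[symmetric] using int by (simp add: nn_integral_eq_integral)
qed

end

text \<open>A continuously differentiable cutoff with support in \<open>[e, 1 / e]\<close>, increasing to \<open>1\<close> on the
  positive half-line as \<open>e\<close> decreases to \<open>0\<close>.\<close>

definition cutoff :: "real \<Rightarrow> real \<Rightarrow> real" where
  "cutoff e r = (max 0 (1 - e * (r + 1 / r)))\<^sup>2"

lemma cutoff_antimono:
  assumes "0 < e'" "e' \<le> e" "0 < r"
  shows "cutoff e r \<le> cutoff e' r"
proof -
  have "e' * (r + 1 / r) \<le> e * (r + 1 / r)" using assms by (intro mult_right_mono) auto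
  then show ?thesis unfolding cutoff_def by (intro power_mono) auto
qed

lemma cutoff_tendsto: "e \<longlonglongrightarrow> 0 \<Longrightarrow> (\<lambda>n. cutoff (e n) r) \<longlonglongrightarrow> 1"
proof -
  assume "e \<longlonglongrightarrow> 0"
  then have "(\<lambda>n. cutoff (e n) r) \<longlonglongrightarrow> (max 0 (1 - 0 * (r + 1 / r)))\<^sup>2"
    unfolding cutoff_def by (intro tendsto_intros)
  then show ?thesis by simp
qed

lemma has_real_derivative_cutoff:
  assumes "r > 0"
  shows "(cutoff e has_real_derivative 2 * max 0 (1 - e * (r + 1 / r)) * (- e * (1 - 1 / r\<^sup>2))) (at r)"
proof -
  have "((\<lambda>r. 1 - e * (r + 1 / r)) has_real_derivative (- e * (1 - 1 / r\<^sup>2))) (at r)"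
    using assms by (auto intro!: derivative_eq_intros simp: power2_eq_square field_simps)
  from DERIV_cmult[OF DERIV_chain2[OF has_real_derivative_half_square_positive_part this], of 2]
  show ?thesis by (simp add: cutoff_def[abs_def] mult.assoc)
qed

lemma cutoff_outside:
  fixes e r :: real
  assumes "0 < e" "0 < r" "r < e \<or> 1 / e < r"
  shows "1 - e * (r + 1 / r) \<le> 0"
  using assms(3)
proof
  assume "r < e"
  then have "1 \<le> e * (1 / r)" using assms by (simp add: pos_le_divide_eq)
  moreover have "0 \<le> e * r" using assms by simp
  ultimately show ?thesis by (simp add: distrib_left)
next
  assume "1 / e < r"
  then have "1 \<le> e * r" using assms by (simp add: pos_divide_less_eq mult.commute)
  moreover have "0 \<le> e * (1 / r)" using assms by simp
  ultimately show ?thesis by (simp add: distrib_left)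
qed

context brownian_segment
begin

definition tilt :: "real \<Rightarrow> 'a \<Rightarrow> real" where
  "tilt l \<omega> = exp (a * Ob \<omega> * (cosh (B \<omega> / 2) - l))"

text \<open>For an interval \<open>I\<close> this is its length times \<open>\<integral> exp (- a * l * r) \<Theta>(dr)\<close>, where
  \<open>\<Theta>\<close> is the measure of the introduction; the values may be infinite.\<close>

definition tilted_mass :: "real \<Rightarrow> real set \<Rightarrow> ennreal" where
  "tilted_mass l I = (\<integral>\<^sup>+ \<omega>. indicator I (B \<omega>) * ennreal (tilt l \<omega>) \<partial>M)"

lemma tilt_measurable [measurable]: "tilt l \<in> borel_measurable M"
  unfolding tilt_def cosh_field_def by measurable

text \<open>The weight \<open>exp (- a * l * Ob)\<close> depends on \<open>Ob\<close> alone and may therefore be included in the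
  function \<open>k\<close> of the invariance statement. Monotone convergence removes the cutoffs, for
  every real \<open>l\<close> and without knowing that the limit is finite.\<close>

lemma tilted_mass_translate:
  assumes d: "d > 0"
  shows "tilted_mass l {x<..<x + d} = tilted_mass l {y<..<y + d}"
proof -
  define e where "e n = d / real (n + 2)" for n
  have e: "e n > 0" "2 * e n \<le> d" "e (Suc n) \<le> e n" for n using d by (auto simp: e_def field_simps)
  have e0: "e \<longlonglongrightarrow> 0"
    unfolding e_def[abs_def] using LIMSEQ_ignore_initial_segment[OF lim_const_over_n[of d], of 2] by simp
  define f where "f z n \<omega> = ennreal (trapezoid (e n) d (B \<omega> - z) * (exp (a * Ob \<omega> * cosh (B \<omega> / 2)) *
      (exp (- (a * l * Ob \<omega>)) * cutoff (e n) (Ob \<omega>))))" for z n \<omega>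
  have tr0: "trapezoid c d q \<ge> 0" for c q by (simp add: trapezoid_def)
  have cut0: "cutoff c q \<ge> 0" for c q by (simp add: cutoff_def)
  have w: "exp (a * Ob \<omega> * cosh (B \<omega> / 2)) * (exp (- (a * l * Ob \<omega>)) * c) = tilt l \<omega> * c" for \<omega> c
  proof -
    have "tilt l \<omega> = exp (a * Ob \<omega> * cosh (B \<omega> / 2)) * exp (- (a * l * Ob \<omega>))"
    proof -
      have "c * q * (C - l) = c * q * C + - (c * l * q)" for c q C :: real by (simp add: algebra_simps)
      then show ?thesis unfolding tilt_def mult_exp_exp by (simp only:)
    qed
    then show ?thesis by (simp only: mult.assoc)
  qed
  have inc: "AE \<omega> in M. f z n \<omega> \<le> f z (Suc n) \<omega>" for z n
  proof (rule AE_I2)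
    fix \<omega> assume \<omega>: "\<omega> \<in> space M"
    show "f z n \<omega> \<le> f z (Suc n) \<omega>" unfolding f_def w
      by (intro ennreal_leI mult_mono mult_left_mono trapezoid_antimono cutoff_antimono e Ob_pos \<omega> mult_nonneg_nonneg tr0 cut0)
        (auto simp: tilt_def)
  qed
  have [measurable]: "f z n \<in> borel_measurable M" for z n
    unfolding f_def trapezoid_def cutoff_def cosh_field_def by measurable
  have lim: "tilted_mass l {z<..<z + d} = (SUP n. \<integral>\<^sup>+ \<omega>. f z n \<omega> \<partial>M)" for z
  proof -
    have "tilted_mass l {z<..<z + d} = (\<integral>\<^sup>+ \<omega>. (SUP n. f z n \<omega>) \<partial>M)"
      unfolding tilted_mass_def
    proof (rule nn_integral_cong)
      fix \<omega> assume \<omega>: "\<omega> \<in> space M"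
      have "incseq (\<lambda>n. f z n \<omega>)"
      proof (rule incseq_SucI)
        show "f z n \<omega> \<le> f z (Suc n) \<omega>" for n unfolding f_def w
          by (intro ennreal_leI mult_mono mult_left_mono trapezoid_antimono cutoff_antimono e Ob_pos \<omega> mult_nonneg_nonneg tr0 cut0)
            (auto simp: tilt_def)
      qed
      then have "(\<lambda>n. f z n \<omega>) \<longlonglongrightarrow> (SUP n. f z n \<omega>)" by (rule LIMSEQ_SUP)
      moreover have "(\<lambda>n. f z n \<omega>) \<longlonglongrightarrow> ennreal (indicator {0<..<d} (B \<omega> - z) * (tilt l \<omega> * 1))"
        unfolding f_def w
        by (intro tendsto_ennrealI tendsto_mult tendsto_const trapezoid_tendsto_indicator cutoff_tendsto e e0)
      ultimately have "(SUP n. f z n \<omega>) = ennreal (indicator {0<..<d} (B \<omega> - z) * (tilt l \<omega> * 1))"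
        by (rule LIMSEQ_unique)
      also have "\<dots> = indicator {z<..<z + d} (B \<omega>) * ennreal (tilt l \<omega>)"
        by (auto simp: indicator_def)
      finally show "indicator {z<..<z + d} (B \<omega>) * ennreal (tilt l \<omega>) = (SUP n. f z n \<omega>)" by simp
    qed
    also have "\<dots> = (SUP n. \<integral>\<^sup>+ \<omega>. f z n \<omega> \<partial>M)"
      by (rule nn_integral_monotone_convergence_SUP_AE) (auto intro: inc)
    finally show ?thesis .
  qed
  have "(\<integral>\<^sup>+ \<omega>. f x n \<omega> \<partial>M) = (\<integral>\<^sup>+ \<omega>. f y n \<omega> \<partial>M)" for n
    unfolding f_def
  proof (rule trapezoid_average_translation_invariant[OF e(1,2)])
    let ?k' = "\<lambda>r. exp (- (a * l * r)) * (2 * max 0 (1 - e n * (r + 1 / r)) * (- e n * (1 - 1 / r\<^sup>2)))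
        + exp (- (a * l * r)) * (- (a * l)) * cutoff (e n) r"
    show "((\<lambda>r. exp (- (a * l * r)) * cutoff (e n) r) has_real_derivative ?k' r) (at r)" if "0 < r" for r
      by (rule DERIV_mult'[OF _ has_real_derivative_cutoff[OF that]]) (use v in \<open>auto intro!: derivative_eq_intros\<close>)
    show "continuous_on {0<..} ?k'" unfolding cutoff_def by (intro continuous_intros) auto
    show "exp (- (a * l * r)) * cutoff (e n) r = 0 \<and> ?k' r = 0" if "0 < r" "r < e n \<or> 1 / e n < r" for r
      using cutoff_outside[OF e(1) that] by (simp add: cutoff_def)
    show "0 < e n" "0 < 1 / e n" using e(1)[of n] by auto
    show "(\<lambda>r. exp (- (a * l * r)) * cutoff (e n) r) \<in> borel_measurable borel" "?k' \<in> borel_measurable borel"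
      unfolding cutoff_def by measurable
    show "0 \<le> exp (- (a * l * r)) * cutoff (e n) r" for r by (simp add: cut0)
  qed
  then show ?thesis unfolding lim by simp
qed

lemma B_distributed: "distributed M lborel B (normal_density 0 (sqrt (v * (t - s))))"
  using gaussian_increments[OF st] by (simp add: B_def[abs_def])

lemma tilted_mass_singleton: "tilted_mass l {x} = 0"
proof -
  have "emeasure M (B -` {x} \<inter> space M) = (\<integral>\<^sup>+ y. ennreal (normal_density 0 (sqrt (v * (t - s))) y) * indicator {x} y \<partial>lborel)"
    by (rule distributed_emeasure[OF B_distributed]) simp
  also have "\<dots> = 0" by (rule nn_integral_null_set) (simp add: null_sets_def)
  finally have "AE \<omega> in M. B \<omega> \<noteq> x"
    by (intro AE_I[of _ _ "B -` {x} \<inter> space M"]) auto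
  then have "tilted_mass l {x} = (\<integral>\<^sup>+ \<omega>. 0 \<partial>M)"
    unfolding tilted_mass_def by (intro nn_integral_cong_AE) auto
  then show ?thesis by simp
qed

lemma tilted_mass_disjoint_Un:
  "I \<in> sets borel \<Longrightarrow> J \<in> sets borel \<Longrightarrow> I \<inter> J = {} \<Longrightarrow> tilted_mass l (I \<union> J) = tilted_mass l I + tilted_mass l J"
  unfolding tilted_mass_def
  by (subst nn_integral_add[symmetric]) (auto intro!: nn_integral_cong simp: indicator_def)

lemma tilted_mass_scale:
  assumes n: "n > 0"
  shows "of_nat n * tilted_mass l {x<..<x + 1 / real n} = tilted_mass l {0<..<1}"
proof -
  let ?d = "1 / real n"
  have d: "?d > 0" using n by simp
  have "tilted_mass l {0<..<real k * ?d} = of_nat k * tilted_mass l {x<..<x + ?d}" if "k > 0" for k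
    using that
  proof (induction k rule: nat_induct_non_zero)
    case 1
    then show ?case using tilted_mass_translate[OF d, of l 0 x] by simp
  next
    case (Suc k)
    have pos: "0 < real k * ?d" using Suc d by simp
    have "{0<..<real (Suc k) * ?d} = {0<..<real k * ?d} \<union> ({real k * ?d} \<union> {real k * ?d<..<real k * ?d + ?d})"
    proof -
      have "real (Suc k) * ?d = real k * ?d + ?d" by (simp add: add_divide_distrib)
      moreover have "{0<..<q + w} = {0<..<q} \<union> ({q} \<union> {q<..<q + w})" if "0 < q" "0 < w" for q w :: real
        using that by auto
      ultimately show ?thesis using pos d by simp
    qed
    then have "tilted_mass l {0<..<real (Suc k) * ?d} =
        tilted_mass l ({0<..<real k * ?d} \<union> ({real k * ?d} \<union> {real k * ?d<..<real k * ?d + ?d}))"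
      by (simp only:)
    also have "\<dots> = tilted_mass l {0<..<real k * ?d} + tilted_mass l ({real k * ?d} \<union> {real k * ?d<..<real k * ?d + ?d})"
      by (rule tilted_mass_disjoint_Un) auto
    also have "tilted_mass l ({real k * ?d} \<union> {real k * ?d<..<real k * ?d + ?d}) =
        tilted_mass l {real k * ?d} + tilted_mass l {real k * ?d<..<real k * ?d + ?d}"
      by (rule tilted_mass_disjoint_Un) auto
    also have "tilted_mass l {real k * ?d<..<real k * ?d + ?d} = tilted_mass l {x<..<x + ?d}" by (rule tilted_mass_translate[OF d])
    finally show ?case using Suc by (simp add: tilted_mass_singleton algebra_simps)
  qed
  from this[OF n] show ?thesis using n by simp
qed

section \<open>The tilted mass is the Gaussian density\<close>

definition increment_density :: "real \<Rightarrow> real" where "increment_density = normal_density 0 (sqrt (v * (t - s)))"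

lemma increment_density_eq: "increment_density x = 1 / sqrt (2 * pi * (v * (t - s))) * exp (- x\<^sup>2 / (2 * (v * (t - s))))"
  using v st by (simp add: increment_density_def normal_density_def)

lemma increment_density_nonneg: "0 \<le> increment_density x" unfolding increment_density_def by simp

lemma increment_density_antimono: "0 \<le> x \<Longrightarrow> x \<le> y \<Longrightarrow> increment_density y \<le> increment_density x"
  unfolding increment_density_eq using v st by (intro mult_left_mono) (auto intro!: divide_right_mono power_mono)

lemma prob_B_interval:
  "(\<integral>\<^sup>+ \<omega>. indicator {x<..<y} (B \<omega>) \<partial>M) = (\<integral>\<^sup>+ z. ennreal (increment_density z) * indicator {x<..<y} z \<partial>lborel)"
proof -
  have "(\<integral>\<^sup>+ \<omega>. indicator {x<..<y} (B \<omega>) \<partial>M) = (\<integral>\<^sup>+ \<omega>. indicator (B -` {x<..<y} \<inter> space M) \<omega> \<partial>M)"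
    by (intro nn_integral_cong) (auto simp: indicator_def)
  also have "\<dots> = emeasure M (B -` {x<..<y} \<inter> space M)" by (intro nn_integral_indicator) measurable
  also have "\<dots> = (\<integral>\<^sup>+ z. ennreal (increment_density z) * indicator {x<..<y} z \<partial>lborel)"
    unfolding increment_density_def by (rule distributed_emeasure[OF B_distributed]) simp
  finally show ?thesis .
qed

lemma cosh_half_mono: "\<bar>x\<bar> \<le> \<bar>y\<bar> \<Longrightarrow> cosh (x / 2) \<le> cosh (y / 2 :: real)"
  using cosh_real_nonneg_le_iff[of "\<bar>x / 2\<bar>" "\<bar>y / 2\<bar>"] by (simp add: abs_if split: if_splits)

text \<open>With \<open>l = cosh (y / 2)\<close> the tilt is at least \<open>1\<close> where \<open>B > y\<close> and at most \<open>1\<close> where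
  \<open>\<bar>B\<bar> < y\<close>. Short intervals on either side of \<open>y\<close> thus compare the tilted mass with the density of \<open>B\<close>
  from both sides; by translation invariance the two bounds concern the same quantity.\<close>

lemma density_le_tilted_mass:
  assumes y: "0 \<le> y" and n: "n > 0"
  shows "ennreal (increment_density (y + 1 / real n)) \<le> tilted_mass (cosh (y / 2)) {0<..<1}"
proof -
  let ?I = "{y<..<y + 1 / real n}"
  have "ennreal (1 / real n) * ennreal (increment_density (y + 1 / real n)) = (\<integral>\<^sup>+ z. ennreal (increment_density (y + 1 / real n)) * indicator ?I z \<partial>lborel)"
    by (subst nn_integral_cmult_indicator) (use n in \<open>auto simp: mult.commute\<close>)
  also have "\<dots> \<le> (\<integral>\<^sup>+ z. ennreal (increment_density z) * indicator ?I z \<partial>lborel)"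
    using y by (intro nn_integral_mono) (auto simp: indicator_def intro!: ennreal_leI increment_density_antimono)
  also have "\<dots> \<le> tilted_mass (cosh (y / 2)) ?I"
    unfolding prob_B_interval[symmetric] tilted_mass_def
  proof (rule nn_integral_mono)
    fix \<omega> assume \<omega>: "\<omega> \<in> space M"
    have "1 \<le> tilt (cosh (y / 2)) \<omega>" if "B \<omega> \<in> ?I"
      unfolding tilt_def using that y v Ob_pos[OF \<omega>] cosh_half_mono[of y "B \<omega>"]
      by (intro one_le_exp_iff[THEN iffD2] mult_nonneg_nonneg) auto
    then show "indicator ?I (B \<omega>) \<le> indicator ?I (B \<omega>) * ennreal (tilt (cosh (y / 2)) \<omega>)"
      by (auto simp: indicator_def)
  qed
  finally have "of_nat n * (ennreal (1 / real n) * ennreal (increment_density (y + 1 / real n))) \<le> of_nat n * tilted_mass (cosh (y / 2)) ?I"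
    by (rule mult_left_mono) simp
  then show ?thesis unfolding tilted_mass_scale[OF n]
    using n by (simp add: mult.assoc[symmetric] ennreal_of_nat_eq_real_of_nat ennreal_mult[symmetric] increment_density_nonneg)
qed

lemma tilted_mass_le_density:
  assumes y: "1 / real n \<le> y" and n: "n > 0"
  shows "tilted_mass (cosh (y / 2)) {0<..<1} \<le> ennreal (increment_density (y - 1 / real n))"
proof -
  let ?x = "y - 1 / real n"
  let ?I = "{?x<..<?x + 1 / real n}"
  have "tilted_mass (cosh (y / 2)) ?I \<le> (\<integral>\<^sup>+ z. ennreal (increment_density z) * indicator ?I z \<partial>lborel)"
    unfolding prob_B_interval[symmetric] tilted_mass_def
  proof (rule nn_integral_mono)
    fix \<omega> assume \<omega>: "\<omega> \<in> space M"
    have "tilt (cosh (y / 2)) \<omega> \<le> 1" if "B \<omega> \<in> ?I"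
      unfolding tilt_def using that y v Ob_pos[OF \<omega>] cosh_half_mono[of "B \<omega>" y]
      by (intro exp_le_one_iff[THEN iffD2] mult_nonneg_nonpos) auto
    then show "indicator ?I (B \<omega>) * ennreal (tilt (cosh (y / 2)) \<omega>) \<le> indicator ?I (B \<omega>)"
      by (auto simp: indicator_def)
  qed
  also have "\<dots> \<le> (\<integral>\<^sup>+ z. ennreal (increment_density ?x) * indicator ?I z \<partial>lborel)"
    using y by (intro nn_integral_mono) (auto simp: indicator_def intro!: ennreal_leI increment_density_antimono)
  also have "\<dots> = ennreal (1 / real n) * ennreal (increment_density ?x)"
    by (subst nn_integral_cmult_indicator) (use n in \<open>auto simp: mult.commute\<close>)
  finally have "of_nat n * tilted_mass (cosh (y / 2)) ?I \<le> of_nat n * (ennreal (1 / real n) * ennreal (increment_density ?x))"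
    by (rule mult_left_mono) simp
  then show ?thesis unfolding tilted_mass_scale[OF n]
    using n by (simp add: mult.assoc[symmetric] ennreal_of_nat_eq_real_of_nat ennreal_mult[symmetric] increment_density_nonneg)
qed

lemma tilted_mass_eq_density:
  assumes y: "0 < y"
  shows "tilted_mass (cosh (y / 2)) {0<..<1} = ennreal (increment_density y)"
proof (rule antisym)
  have inv: "(\<lambda>n. 1 / real n) \<longlonglongrightarrow> 0" by (rule lim_const_over_n)
  have pc: "isCont increment_density z" for z unfolding increment_density_eq[abs_def] using v st by (intro continuous_intros) auto
  have "(\<lambda>n. y + 1 / real n) \<longlonglongrightarrow> y + 0" by (intro tendsto_intros inv)
  then have "(\<lambda>n. ennreal (increment_density (y + 1 / real n))) \<longlonglongrightarrow> ennreal (increment_density y)"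
    by (intro tendsto_ennrealI isCont_tendsto_compose[OF pc]) simp
  then show "ennreal (increment_density y) \<le> tilted_mass (cosh (y / 2)) {0<..<1}"
    by (rule LIMSEQ_le_const2) (use y density_le_tilted_mass in \<open>auto intro!: exI[of _ 1]\<close>)
  have "(\<lambda>n. y - 1 / real n) \<longlonglongrightarrow> y - 0" by (intro tendsto_intros inv)
  then have lim: "(\<lambda>n. ennreal (increment_density (y - 1 / real n))) \<longlonglongrightarrow> ennreal (increment_density y)"
    by (intro tendsto_ennrealI isCont_tendsto_compose[OF pc]) simp
  have "\<forall>\<^sub>F n in sequentially. 1 / real n < y" by (rule order_tendstoD(2)[OF inv y])
  then have "\<forall>\<^sub>F n in sequentially. tilted_mass (cosh (y / 2)) {0<..<1} \<le> ennreal (increment_density (y - 1 / real n))"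
    using eventually_gt_at_top[of 0] by eventually_elim (auto intro: tilted_mass_le_density)
  then show "tilted_mass (cosh (y / 2)) {0<..<1} \<le> ennreal (increment_density y)"
    by (rule tendsto_lowerbound[OF lim]) simp
qed

lemma tilted_mass_antimono:
  assumes "l \<le> l'"
  shows "tilted_mass l' I \<le> tilted_mass l I"
  unfolding tilted_mass_def
proof (rule nn_integral_mono)
  fix \<omega> assume "\<omega> \<in> space M"
  then have "0 \<le> a * Ob \<omega>" using v Ob_pos[of \<omega>] by simp
  then have "a * Ob \<omega> * (cosh (B \<omega> / 2) - l') \<le> a * Ob \<omega> * (cosh (B \<omega> / 2) - l)"
    using assms by (intro mult_left_mono) auto
  then show "indicator I (B \<omega>) * ennreal (tilt l' \<omega>) \<le> indicator I (B \<omega>) * ennreal (tilt l \<omega>)"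
    unfolding tilt_def by (intro mult_left_mono ennreal_leI) auto
qed

text \<open>The value at \<open>l = -1\<close> of the continued Laplace transform.\<close>

definition critical_bound :: real where
  "critical_bound = 1 / sqrt (2 * pi * (v * (t - s))) * exp (2 * pi\<^sup>2 / (v * (t - s)))"

text \<open>With \<open>l = 1 + q / a\<close> the tilted mass is the Laplace transform at \<open>q\<close> of \<open>Ob\<close> under a fixed measure.
  For \<open>l = cosh (y / 2) > 1\<close> it is the Gaussian density at \<open>y\<close>, and
  \<open>- q / (2 * a) = - (sinh (y / 4))\<^sup>2\<close> turns the exponent into a multiple of the function of
  \<open>squared_arcsin_of_sqrt\<close>. Its unit disc corresponds to \<open>\<bar>q\<bar> < 2 * a\<close>, hence the continuation
  reaches all \<open>l > -1\<close>.\<close>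

lemma tilted_mass_le_critical_bound:
  assumes l: "-1 < l" "l \<le> 1"
  shows "tilted_mass l {0<..<1} \<le> ennreal critical_bound"
proof -
  define c where "c = 1 / sqrt (2 * pi * (v * (t - s)))"
  define T where "T = v * (t - s)"
  have T: "T > 0" using v st by (simp add: T_def)
  have c: "c \<ge> 0" using v st by (simp add: c_def)
  obtain S :: "complex \<Rightarrow> complex" where S: "S holomorphic_on ball 0 1"
    "\<And>\<theta>. \<bar>\<theta>\<bar> < pi / 2 \<Longrightarrow> S (of_real ((sin \<theta>)\<^sup>2)) = of_real (\<theta>\<^sup>2)"
    "\<And>y. sinh y < 1 \<Longrightarrow> 0 \<le> y \<Longrightarrow> S (of_real (- (sinh y)\<^sup>2)) = of_real (- (y\<^sup>2))"
    using squared_arcsin_of_sqrt by blast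
  define G where "G z = of_real c * exp (of_real (8 / T) * S (- z / of_real (2 * a)))" for z
  have a: "a > 0" using v by simp
  have hol: "G holomorphic_on ball 0 (2 * a)"
  proof -
    have "(S \<circ> (\<lambda>z. - z / of_real (2 * a))) holomorphic_on ball 0 (2 * a)"
      by (rule holomorphic_on_compose_gen[OF _ S(1)])
        (use v in \<open>auto intro!: holomorphic_intros simp: norm_divide norm_mult field_simps\<close>)
    then show ?thesis unfolding G_def comp_def by (intro holomorphic_intros)
  qed
  let ?\<nu> = "density M (\<lambda>\<omega>. indicator {0<..<1} (B \<omega>) * ennreal (tilt 1 \<omega>))"
  have lap: "(\<integral>\<^sup>+ \<omega>. ennreal (exp (- q * Ob \<omega>)) \<partial>?\<nu>) = tilted_mass (1 + q / a) {0<..<1}" for q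
  proof -
    have e: "tilt 1 \<omega> * exp (- q * Ob \<omega>) = tilt (1 + q / a) \<omega>" for \<omega>
    proof -
      have "a * Ob \<omega> * (cosh (B \<omega> / 2) - 1) + - q * Ob \<omega> = a * Ob \<omega> * (cosh (B \<omega> / 2) - (1 + q / a))"
        using v by (simp add: field_simps)
      then show ?thesis unfolding tilt_def mult_exp_exp by simp
    qed
    have "(\<integral>\<^sup>+ \<omega>. ennreal (exp (- q * Ob \<omega>)) \<partial>?\<nu>) =
        (\<integral>\<^sup>+ \<omega>. indicator {0<..<1} (B \<omega>) * ennreal (tilt 1 \<omega>) * ennreal (exp (- q * Ob \<omega>)) \<partial>M)"
      by (rule nn_integral_density) auto
    also have "\<dots> = tilted_mass (1 + q / a) {0<..<1}"
      unfolding tilted_mass_def e[symmetric] by (simp add: ennreal_mult tilt_def mult.assoc)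
    finally show ?thesis .
  qed
  have pos: "G (of_real q) = of_real (increment_density y) \<and> tilted_mass (1 + q / a) {0<..<1} = ennreal (increment_density y)"
    if q: "0 < q" "q < 2 * a" and y: "y = 4 * arsinh (sqrt (q / (2 * a)))" for q y
  proof -
    have r: "0 < q / (2 * a)" using q a by simp
    have r1: "q / (2 * a) < 1" by (subst divide_less_eq_1_pos) (use q a in auto)
    have sh: "sinh (y / 4) = sqrt (q / (2 * a))" by (simp add: y)
    have y0: "y > 0" using r y by simp
    have "(sinh (y / 4))\<^sup>2 = q / (2 * a)" using r by (simp add: sh)
    then have arg: "of_real (- (sinh (y / 4))\<^sup>2) = - complex_of_real q / of_real (2 * a)"
      by (simp only: of_real_minus of_real_divide minus_divide_left)
    have "sinh (y / 4) < 1" using r r1 unfolding sh by (simp only: real_sqrt_lt_1_iff)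
    then have "S (- complex_of_real q / of_real (2 * a)) = of_real (- (y / 4)\<^sup>2)"
      using S(3)[of "y / 4"] y0 unfolding arg by simp
    then have "G (of_real q) = of_real (c * exp (8 / T * - (y / 4)\<^sup>2))"
      unfolding G_def by (simp flip: exp_of_real)
    moreover have "8 / T * - (y / 4)\<^sup>2 = - y\<^sup>2 / (2 * T)" by (simp add: power2_eq_square)
    ultimately have "G (of_real q) = of_real (increment_density y)" by (simp add: increment_density_eq c_def T_def)
    moreover have "cosh (y / 2) = 1 + q / a"
    proof -
      have "cosh (y / 2) = 1 + 2 * (sinh (y / 4))\<^sup>2"
        using cosh_double[of "y / 4"] cosh_square_eq[of "y / 4"] by simp
      also have "\<dots> = 1 + q / a" using r by (simp add: sh)
      finally show ?thesis .
    qed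
    ultimately show ?thesis using tilted_mass_eq_density[OF y0] by simp
  qed
  define q where "q = a * (l - 1)"
  have q: "- (2 * a) < q" "q \<le> 0" "1 + q / a = l"
  proof -
    have "a * (-2) < a * (l - 1)" using a l by (intro mult_strict_left_mono) auto
    then show "- (2 * a) < q" by (simp add: q_def)
    have "a * (l - 1) \<le> 0" using a l by (intro mult_nonneg_nonpos) auto
    then show "q \<le> 0" by (simp add: q_def)
    show "1 + q / a = l" using v by (simp add: q_def field_simps)
  qed
  have "tilted_mass l {0<..<1} = (\<integral>\<^sup>+ \<omega>. ennreal (exp (- q * Ob \<omega>)) \<partial>?\<nu>)" using lap[of q] q by simp
  also have "\<dots> = ennreal (Re (G (of_real q)))"
  proof (rule laplace_transform_extends[OF _ _ hol])
    fix q' :: real assume "0 < q'" "q' < 2 * a"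
    note * = pos[OF this refl]
    show "G (of_real q') \<in> \<real> \<and> 0 \<le> Re (G (of_real q'))" using * by (simp add: increment_density_nonneg)
    show "(\<integral>\<^sup>+ \<omega>. ennreal (exp (- q' * Ob \<omega>)) \<partial>?\<nu>) = ennreal (Re (G (of_real q')))"
      unfolding lap using * by simp
  qed (use q in \<open>auto simp: Ob_pos less_imp_le\<close>)
  also have "\<dots> \<le> ennreal critical_bound"
  proof (rule ennreal_leI)
    define \<theta> where "\<theta> = arcsin (sqrt (- q / (2 * a)))"
    have r: "0 \<le> - q / (2 * a)" "- q / (2 * a) < 1"
    proof -
      show "0 \<le> - q / (2 * a)" using q a by (intro divide_nonneg_pos) auto
      show "- q / (2 * a) < 1" by (subst divide_less_eq_1_pos) (use q a in auto)
    qed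
    have r': "0 \<le> sqrt (- q / (2 * a))" "sqrt (- q / (2 * a)) < 1" using r by (auto simp: real_sqrt_lt_1_iff)
    have "- (pi / 2) < \<theta> \<and> \<theta> < pi / 2"
      unfolding \<theta>_def by (rule arcsin_lt_bounded) (use r' in linarith)+
    then have \<theta>: "\<bar>\<theta>\<bar> < pi / 2" by linarith
    have "sin \<theta> = sqrt (- q / (2 * a))" unfolding \<theta>_def using r' by (intro sin_arcsin) linarith+
    then have "(sin \<theta>)\<^sup>2 = - q / (2 * a)" using r by simp
    then have "S (- complex_of_real q / of_real (2 * a)) = of_real (\<theta>\<^sup>2)"
      using S(2)[OF \<theta>] by simp
    then have "G (of_real q) = of_real c * exp (of_real (8 / T) * of_real (\<theta>\<^sup>2))"
      unfolding G_def by (simp only:)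
    also have "\<dots> = of_real (c * exp (8 / T * \<theta>\<^sup>2))"
      unfolding of_real_mult[of c] exp_of_real[symmetric] of_real_mult[of "8 / T"] by (rule refl)
    finally have "Re (G (of_real q)) = c * exp (8 / T * \<theta>\<^sup>2)"
      by (simp only: Re_complex_of_real)
    also have "\<dots> \<le> c * exp (2 * pi\<^sup>2 / T)"
    proof -
      have "\<bar>\<theta>\<bar>\<^sup>2 \<le> (pi / 2)\<^sup>2" using \<theta> by (intro power_mono) auto
      then have "8 / T * \<theta>\<^sup>2 \<le> 8 / T * (pi / 2)\<^sup>2" using T by (intro mult_left_mono) auto
      also have "\<dots> = 2 * pi\<^sup>2 / T" by (simp add: power2_eq_square)
      finally show ?thesis using c by (intro mult_left_mono) auto
    qed
    finally show "Re (G (of_real q)) \<le> critical_bound" by (simp add: critical_bound_def c_def T_def)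
  qed
  finally show ?thesis .
qed

lemma tilted_mass_critical: "tilted_mass (-1) {0<..<1} \<le> ennreal critical_bound"
proof -
  define l where "l n = -1 + 1 / real (Suc n)" for n
  have l: "-1 < l n" "l n \<le> 1" for n by (auto simp: l_def divide_simps)
  have "(\<lambda>n. 1 / real (Suc n)) \<longlonglongrightarrow> 0" by (rule LIMSEQ_Suc[OF lim_const_over_n])
  then have l0: "l \<longlonglongrightarrow> -1" unfolding l_def[abs_def] using tendsto_add[OF tendsto_const[of "-1"]] by fastforce
  have "tilted_mass (-1) {0<..<1} = (\<integral>\<^sup>+ \<omega>. liminf (\<lambda>n. indicator {0<..<1} (B \<omega>) * ennreal (tilt (l n) \<omega>)) \<partial>M)"
    unfolding tilted_mass_def
  proof (rule nn_integral_cong)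
    fix \<omega>
    have "(\<lambda>n. ennreal (indicator {0<..<1} (B \<omega>) * tilt (l n) \<omega>)) \<longlonglongrightarrow> ennreal (indicator {0<..<1} (B \<omega>) * tilt (-1) \<omega>)"
      unfolding tilt_def by (intro tendsto_ennrealI tendsto_intros l0)
    moreover have "ennreal (indicator {0<..<1} (B \<omega>) * tilt r \<omega>) = indicator {0<..<1} (B \<omega>) * ennreal (tilt r \<omega>)" for r
      by (simp add: indicator_def)
    ultimately have "(\<lambda>n. indicator {0<..<1} (B \<omega>) * ennreal (tilt (l n) \<omega>)) \<longlonglongrightarrow> indicator {0<..<1} (B \<omega>) * ennreal (tilt (-1) \<omega>)"
      by simp
    then show "indicator {0<..<1} (B \<omega>) * ennreal (tilt (-1) \<omega>) = liminf (\<lambda>n. indicator {0<..<1} (B \<omega>) * ennreal (tilt (l n) \<omega>))"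
      by (intro lim_imp_Liminf[symmetric]) auto
  qed
  also have "\<dots> \<le> liminf (\<lambda>n. tilted_mass (l n) {0<..<1})"
    unfolding tilted_mass_def by (rule nn_integral_liminf) measurable
  also have "\<dots> \<le> ennreal critical_bound"
    using tilted_mass_le_critical_bound[OF l] by (intro Liminf_le always_eventually) auto
  finally show ?thesis .
qed

section \<open>The critical exponential moment\<close>

text \<open>Only the first few \<open>k\<close> need the critical bound. As soon as \<open>cosh (k / 4) \<ge> 3 / 2\<close>, one has
  \<open>cosh (k / 2) - 2 \<ge> cosh (k / 4)\<close> and the tilted mass is at most the Gaussian density at \<open>k / 2\<close>.
  The constant \<open>exp (- 1 / (8 * (v * (t - s)))) ^ 8\<close> in the denominator absorbs the values \<open>k < 8\<close>.\<close>

lemma tilted_mass_le_geometric: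
  "tilted_mass (cosh (real k / 2) - 2) {0<..<1} \<le> ennreal (critical_bound / exp (- 1 / (8 * (v * (t - s)))) ^ 8 * exp (- 1 / (8 * (v * (t - s)))) ^ k)"
proof -
  define T where "T = v * (t - s)"
  define r where "r = exp (- 1 / (8 * T))"
  define c where "c = 1 / sqrt (2 * pi * T)"
  have T: "T > 0" using v st by (simp add: T_def)
  have r: "0 < r" "r \<le> 1" using T by (auto simp: r_def)
  have c: "c \<ge> 0" using T by (simp add: c_def)
  have critical_bound: "critical_bound = c * exp (2 * pi\<^sup>2 / T)" by (simp add: critical_bound_def c_def T_def)
  then have critical_bound_nonneg: "0 \<le> critical_bound" using c by simp
  have "tilted_mass (cosh (real k / 2) - 2) {0<..<1} \<le> ennreal (critical_bound / r ^ 8 * r ^ k)"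
  proof (cases "k < 8")
    case True
    have "-1 \<le> cosh (real k / 2) - 2" using cosh_real_ge_1[of "real k / 2"] by simp
    then have "tilted_mass (cosh (real k / 2) - 2) {0<..<1} \<le> tilted_mass (-1) {0<..<1}" by (rule tilted_mass_antimono)
    also have "\<dots> \<le> ennreal critical_bound" by (rule tilted_mass_critical)
    also have "\<dots> \<le> ennreal (critical_bound / r ^ 8 * r ^ k)"
    proof (rule ennreal_leI)
      have "r ^ 8 \<le> r ^ k" using r True by (intro power_decreasing) auto
      then have "critical_bound / r ^ 8 * r ^ 8 \<le> critical_bound / r ^ 8 * r ^ k" using critical_bound_nonneg r by (intro mult_left_mono) auto
      then show "critical_bound \<le> critical_bound / r ^ 8 * r ^ k" using r by simp
    qed
    finally show ?thesis .
  next
    case False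
    define X where "X = cosh (real k / 4)"
    have "3 / 2 \<le> X"
    proof -
      have "2 \<le> real k / 4" using False by simp
      then have "3 \<le> exp (real k / 4)" using exp_ge_add_one_self[of "real k / 4"] by linarith
      then have "3 \<le> exp (real k / 4) + exp (- (real k / 4))" by (simp add: add_increasing2)
      then show ?thesis by (simp add: X_def cosh_field_def)
    qed
    moreover have "cosh (real k / 2) = 2 * X\<^sup>2 - 1"
      using cosh_double[of "real k / 4"] cosh_square_eq[of "real k / 4"] by (simp add: X_def)
    moreover have "(X - 3 / 2) * (2 * X + 2) \<ge> 0" using calculation by (intro mult_nonneg_nonneg) auto
    ultimately have "X \<le> cosh (real k / 2) - 2" by (simp add: power2_eq_square algebra_simps)
    then have "tilted_mass (cosh (real k / 2) - 2) {0<..<1} \<le> tilted_mass (cosh ((real k / 2) / 2)) {0<..<1}"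
      by (intro tilted_mass_antimono) (simp add: X_def)
    also have "\<dots> = ennreal (increment_density (real k / 2))" using False by (intro tilted_mass_eq_density) simp
    also have "\<dots> \<le> ennreal (critical_bound / r ^ 8 * r ^ k)"
    proof (rule ennreal_leI)
      have "real k \<le> (real k)\<^sup>2" using False by (simp add: power2_eq_square)
      then have "increment_density (real k / 2) \<le> c * exp (real k * (- 1 / (8 * T)))"
        unfolding increment_density_eq c_def T_def[symmetric] using T
        by (intro mult_left_mono) (auto simp: field_simps power2_eq_square)
      also have "exp (real k * (- 1 / (8 * T))) = r ^ k" unfolding r_def by (rule exp_of_nat_mult)
      also have "c * r ^ k \<le> critical_bound / r ^ 8 * r ^ k"
      proof (rule mult_right_mono)
        have "c * 1 \<le> c * exp (2 * pi\<^sup>2 / T)" using c T by (intro mult_left_mono) auto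
        also have "\<dots> \<le> critical_bound / r ^ 8"
        proof -
          have "r ^ 8 \<le> 1" using r by (intro power_le_one) auto
          then have "critical_bound * r ^ 8 \<le> critical_bound * 1" using critical_bound_nonneg by (intro mult_left_mono)
          then show ?thesis unfolding critical_bound[symmetric] using r by (simp add: pos_le_divide_eq)
        qed
        finally show "c \<le> critical_bound / r ^ 8" by simp
      qed (use r in simp)
      finally show "increment_density (real k / 2) \<le> critical_bound / r ^ 8 * r ^ k" .
    qed
    finally show ?thesis .
  qed
  then show ?thesis by (simp add: r_def T_def)
qed

text \<open>Where \<open>k < \<bar>B\<bar> < k + 1\<close> one has \<open>2 \<le> cosh (B / 2) - (cosh (k / 2) - 2)\<close>, so the expectation
  over this event is at most twice the tilted mass of a unit interval for \<open>l = cosh (k / 2) - 2\<close>.\<close>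

theorem critical_exponential_moment_finite:
  "(\<integral>\<^sup>+ \<omega>. ennreal (exp (8 / v * Ob \<omega>)) \<partial>M) < \<infinity>"
proof -
  define r where "r = exp (- 1 / (8 * (v * (t - s))))"
  define I where "I k = {real k<..<real k + 1} \<union> {- real k - 1<..<- real k - 1 + 1}" for k
  have r: "0 < r" "r < 1" using v st by (auto simp: r_def)
  have critical_bound: "0 \<le> critical_bound" using v st by (simp add: critical_bound_def)
  have noint: "AE \<omega> in M. B \<omega> \<noteq> of_int i" for i
  proof -
    have "(\<integral>\<^sup>+ \<omega>. indicator {of_int i} (B \<omega>) * ennreal (tilt 0 \<omega>) \<partial>M) = 0"
      using tilted_mass_singleton[of 0 "of_int i"] unfolding tilted_mass_def .
    then have "AE \<omega> in M. indicator {of_int i} (B \<omega>) * ennreal (tilt 0 \<omega>) = 0"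
      by (subst (asm) nn_integral_0_iff_AE) auto
    then show ?thesis by eventually_elim (auto simp: tilt_def indicator_def ennreal_eq_0_iff)
  qed
  then have "AE \<omega> in M. \<forall>i. B \<omega> \<noteq> of_int i" by (simp add: AE_all_countable)
  then have "(\<integral>\<^sup>+ \<omega>. ennreal (exp (8 / v * Ob \<omega>)) \<partial>M) \<le>
      (\<integral>\<^sup>+ \<omega>. (\<Sum>k. indicator (I k) (B \<omega>) * ennreal (tilt (cosh (real k / 2) - 2) \<omega>)) \<partial>M)"
  proof (rule nn_integral_mono_AE[OF AE_mp], intro AE_I2 impI)
    fix \<omega> assume \<omega>: "\<omega> \<in> space M" and ni: "\<forall>i. B \<omega> \<noteq> of_int i"
    obtain k where k: "B \<omega> \<in> I k"
    proof (cases "B \<omega> \<ge> 0")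
      case True
      let ?k = "nat \<lfloor>B \<omega>\<rfloor>"
      have "real ?k = of_int \<lfloor>B \<omega>\<rfloor>" using True by simp
      moreover have "of_int \<lfloor>B \<omega>\<rfloor> < B \<omega>" using ni of_int_floor_le[of "B \<omega>"] by (metis order_le_less)
      moreover have "B \<omega> < of_int \<lfloor>B \<omega>\<rfloor> + 1" by (rule floor_less_cancel) simp
      ultimately have "B \<omega> \<in> I ?k" by (simp add: I_def)
      then show ?thesis by (rule that)
    next
      case False
      let ?k = "nat \<lfloor>- B \<omega>\<rfloor>"
      have "real ?k = of_int \<lfloor>- B \<omega>\<rfloor>" using False by simp
      moreover have "of_int \<lfloor>- B \<omega>\<rfloor> < - B \<omega>"
        using ni of_int_floor_le[of "- B \<omega>"] by (metis order_le_less minus_minus of_int_minus)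
      moreover have "- B \<omega> < of_int \<lfloor>- B \<omega>\<rfloor> + 1" by linarith
      ultimately have "- real ?k - 1 < B \<omega>" "B \<omega> < - real ?k - 1 + 1" by linarith+
      then have "B \<omega> \<in> I ?k" unfolding I_def Un_iff greaterThanLessThan_iff by blast
      then show ?thesis by (rule that)
    qed
    then have b: "\<bar>real k\<bar> \<le> \<bar>B \<omega>\<bar>" by (auto simp: I_def)
    have "8 / v * Ob \<omega> = a * Ob \<omega> * 2" by simp
    also have "\<dots> \<le> a * Ob \<omega> * (cosh (B \<omega> / 2) - (cosh (real k / 2) - 2))"
      using cosh_half_mono[OF b] v Ob_pos[OF \<omega>] by (intro mult_left_mono) auto
    finally have "ennreal (exp (8 / v * Ob \<omega>)) \<le> indicator (I k) (B \<omega>) * ennreal (tilt (cosh (real k / 2) - 2) \<omega>)"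
      using k unfolding tilt_def by (simp add: ennreal_leI)
    also have "\<dots> \<le> (\<Sum>j. indicator (I j) (B \<omega>) * ennreal (tilt (cosh (real j / 2) - 2) \<omega>))"
    proof -
      have "F k \<le> (\<Sum>j. F j)" for F :: "nat \<Rightarrow> ennreal" using sum_le_suminf[of F "{k}"] by simp
      then show ?thesis .
    qed
    finally show "ennreal (exp (8 / v * Ob \<omega>)) \<le> (\<Sum>j. indicator (I j) (B \<omega>) * ennreal (tilt (cosh (real j / 2) - 2) \<omega>))" .
  qed
  also have "\<dots> = (\<Sum>k. tilted_mass (cosh (real k / 2) - 2) (I k))"
    unfolding tilted_mass_def by (rule nn_integral_suminf) (auto simp: I_def)
  also have "\<dots> \<le> (\<Sum>k. ennreal (2 * (critical_bound / r ^ 8) * r ^ k))"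
  proof (rule suminf_le)
    fix k
    let ?l = "cosh (real k / 2) - 2"
    have "tilted_mass ?l (I k) = tilted_mass ?l {real k<..<real k + 1} + tilted_mass ?l {- real k - 1<..<- real k - 1 + 1}"
      unfolding I_def by (rule tilted_mass_disjoint_Un) auto
    also have "\<dots> = tilted_mass ?l {0<..<0 + 1} + tilted_mass ?l {0<..<0 + 1}"
      by (intro arg_cong2[where f = "(+)"] tilted_mass_translate zero_less_one)
    also have "\<dots> \<le> ennreal (critical_bound / r ^ 8 * r ^ k) + ennreal (critical_bound / r ^ 8 * r ^ k)"
      using tilted_mass_le_geometric[of k] by (intro add_mono) (auto simp: r_def)
    also have "\<dots> = ennreal (2 * (critical_bound / r ^ 8) * r ^ k)"
      using critical_bound r by (subst ennreal_plus[symmetric]) auto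
    finally show "tilted_mass ?l (I k) \<le> ennreal (2 * (critical_bound / r ^ 8) * r ^ k)" .
  qed auto
  also have "\<dots> = ennreal (\<Sum>k. 2 * (critical_bound / r ^ 8) * r ^ k)"
    using critical_bound r by (intro suminf_ennreal2) (auto intro!: summable_mult summable_geometric)
  also have "\<dots> < \<infinity>" by simp
  finally show ?thesis .
qed

end

theorem corollary6:
  fixes \<kappa> s t :: real
    and M :: "'a measure"
    and \<xi> :: "real \<Rightarrow> 'a \<Rightarrow> real"
  assumes "\<kappa> > 0"
    and "s \<noteq> t"
    and "two_sided_brownian_motion M (\<kappa>\<^sup>2) \<xi>"
  shows "(\<integral>\<^sup>+ f. ennreal (exp (8 / \<kappa>\<^sup>2 * obs f s t)) \<partial>schwarzian_measure M \<xi>) < \<infinity>"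
proof -
  interpret two_sided_brownian_motion M "\<kappa>\<^sup>2" \<xi> by fact
  note [measurable] = borel_measurable_obs
  have lt: "(\<integral>\<^sup>+ f. ennreal (exp (8 / \<kappa>\<^sup>2 * obs f s' t')) \<partial>schwarzian_measure M \<xi>) < \<infinity>" if "s' < t'" for s' t'
  proof -
    interpret brownian_segment M "\<kappa>\<^sup>2" \<xi> s' t'
      by unfold_locales (use assms(1) that in auto)
    have "(\<integral>\<^sup>+ f. ennreal (exp (8 / \<kappa>\<^sup>2 * obs f s' t')) \<partial>schwarzian_measure M \<xi>) =
        (\<integral>\<^sup>+ \<omega>. ennreal (exp (8 / \<kappa>\<^sup>2 * obs (exp_primitive \<xi> \<omega>) s' t')) \<partial>M)"
      unfolding schwarzian_measure_def by (rule nn_integral_distr[OF exp_primitive_measurable]) measurable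
    also have "\<dots> = (\<integral>\<^sup>+ \<omega>. ennreal (exp (8 / \<kappa>\<^sup>2 * Ob \<omega>)) \<partial>M)"
      by (rule nn_integral_cong) (simp add: obs_eq_Ob)
    finally show ?thesis using critical_exponential_moment_finite by simp
  qed
  have sym: "obs f s t = obs f t s" for f
    by (simp add: obs_def mult.commute abs_minus_commute)
  show ?thesis
  proof (cases "s < t")
    case True
    then show ?thesis by (rule lt)
  next
    case False
    then have "t < s" using assms(2) by simp
    then show ?thesis unfolding sym by (rule lt)
  qed
qed

end
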